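(* Let $\Omega\subset\mathbb{R}^{d+1}$ be the closure of an open, connected, bounded $C^2$-domain with boundary $\Gamma=\partial\Omega$. Let $\mu>1$, $0<p\le\infty$, and let $r,j,l$ be nonnegative integers. Then there is a constant $C>0$ (depending on $\mu,p,d,\Omega,r,j,l$) such that for every $n\in\mathbb{N}$ and every polynomial $f$ on $\mathbb{R}^{d+1}$ of total degree at most $n$, $$\bigl\|\varphi_{n,\Gamma}^{\,j}\,\mathcal{M}_{n,\mu}^{r,j+l}f\bigr\|_{L^p(\Omega)}\le C\,n^{r+j+2l}\,\|f\|_{L^p(\Omega)}.$$
   Context: Here $d\ge1$ and $\|\cdot\|$ is the Euclidean norm. For $\xi\in\Omega$, $\varphi_{n,\Gamma}(\xi)=\sqrt{\mathrm{dist}(\xi,\Gamma)}+n^{-1}$. For $\eta\in\Gamma$, $\mathbf n_\eta$ is the unit outer normal vector to $\Gamma$ at $\eta$ and $\mathcal S_\eta=\{\tau\in\mathbb{R}^{d+1}:\|\tau\|=1,\ \tau\cdot\mathbf n_\eta=0\}$ is the set of unit tangent vectors at $\eta$. For a vector $v$ and $\ell\in\mathbb{Z}_{\ge0}$, $\partial_v^\ell=(v\cdot\nabla)^\ell$. For nonnegative integers $l_1,l_2$ and $f\in C^\infty(\Omega)$, $$\mathcal M_{n,\mu}^{l_1,l_2}f(\xi)=\max_{\eta}\max_{\tau\in\mathcal S_\eta}\bigl|\partial_\tau^{l_1}\partial_{\mathbf n_\eta}^{l_2}f(\xi)\bigr|,\quad\xi\in\Omega,$$ where the outer maximum is over all $\eta\in\Gamma$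 with $\|\eta-\xi\|\le\mu\varphi_{n,\Gamma}(\xi)$ (a maximum over the empty set is $0$). $C^2$-domain: a bounded domain for which there are $\delta>0$, $M>0$ and a finite cover of the boundary by connected open sets $U_1,\dots,U_J$ such that (i) every $x$ in the domain with distance $<\delta$ to the boundary lies in some $U_j$ with $\mathrm{dist}(x,\partial U_j)>\delta$; (ii) for each $j$ there is a Cartesian coordinate system $(\xi_{j,1},\dots,\xi_{j,d+1})$ in $U_j$ in which the part of the domain in $U_j$ is given by $\xi_{j,d+1}\le f_j(\xi_{j,1},\dots,\xi_{j,d})$ with $f_j\in C^2(\mathbb{R}^d)$ and $\max_{i,k}\|\partial_i\partial_kf_j\|_\infty\le M$. *)

theory Defs
  imports "HOL-Analysis.Analysis" "HOL-Probability.Essential_Supremum"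
begin

text \<open>
  The space \<open>\<real>\<^sup>d\<^sup>+\<^sup>1\<close> is modelled as the Euclidean product of \<open>\<real>\<^sup>d\<close> and
  \<open>\<real>\<close>, so that the last coordinate of a point is its second component.
\<close>

definition dir_deriv :: "'a::euclidean_space \<Rightarrow> ('a \<Rightarrow> real) \<Rightarrow> 'a \<Rightarrow> real" where
  "dir_deriv v f x = frechet_derivative f (at x) v"

definition C2_function :: "('a::euclidean_space \<Rightarrow> real) \<Rightarrow> bool" where
  "C2_function g \<longleftrightarrow>
     (\<forall>x. g differentiable (at x)) \<and>
     (\<forall>b\<in>Basis. \<forall>x. dir_deriv b g differentiable (at x)) \<and>
     (\<forall>b\<in>Basis. \<forall>c\<in>Basis. continuous_on UNIV (dir_deriv b (dir_deriv c g)))"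

text \<open>
  A Cartesian coordinate system is given by the rigid motion \<open>\<lambda>x. Q x + a\<close> that sends a
  point to its tuple of new coordinates. The predicate is meant for closed sets: because of the
  non-strict inequality \<open>\<le>\<close> in the local description, no nonempty bounded open set
  satisfies it, so a \<open>C\<^sup>2\<close>-domain enters through its closure. The sets \<open>U\<close> below are
  never the whole space when \<open>\<Omega>\<close> is bounded, hence \<open>infdist\<close> is only applied to
  nonempty frontiers.
\<close>

definition C2_domain :: "('a::euclidean_space \<times> real) set \<Rightarrow> bool" where
  "C2_domain \<Omega> \<longleftrightarrow> bounded \<Omega> \<and>
     (\<exists>\<delta>>0. \<exists>M>0. \<exists>\<U>. finite \<U> \<and>
        (\<forall>U\<in>\<U>. open U \<and> connected U) \<and>
        frontier \<Omega> \<subseteq> \<Union>\<U> \<and>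
        (\<forall>x\<in>\<Omega>. infdist x (frontier \<Omega>) < \<delta> \<longrightarrow>
           (\<exists>U\<in>\<U>. x \<in> U \<and> infdist x (frontier U) > \<delta>)) \<and>
        (\<forall>U\<in>\<U>. \<exists>(Q :: 'a \<times> real \<Rightarrow> 'a \<times> real) a g.
           orthogonal_transformation Q \<and> C2_function g \<and>
           (\<forall>b\<in>Basis. \<forall>c\<in>Basis. \<forall>y. \<bar>dir_deriv b (dir_deriv c g) y\<bar> \<le> M) \<and>
           \<Omega> \<inter> U = {x\<in>U. snd (Q x + a) \<le> g (fst (Q x + a))}))"

definition tangent_vectors :: "'a::euclidean_space set \<Rightarrow> 'a \<Rightarrow> 'a set" where
  "tangent_vectors \<Gamma> \<eta> =
     {v. \<exists>\<gamma>::real \<Rightarrow> 'a. \<gamma> 0 = \<eta> \<and> (\<forall>\<^sub>F t in nhds 0. \<gamma> t \<in> \<Gamma>) \<and>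
          (\<gamma> has_vector_derivative v) (at 0)}"

text \<open>
  At a point of the boundary of a closed \<open>C\<^sup>2\<close>-domain exactly two unit vectors are orthogonal
  to all tangent vectors of the boundary, and precisely one of them points out of the domain.
\<close>

definition is_unit_outer_normal :: "'a::euclidean_space set \<Rightarrow> 'a \<Rightarrow> 'a \<Rightarrow> bool" where
  "is_unit_outer_normal \<Omega> \<eta> \<nu> \<longleftrightarrow>
     norm \<nu> = 1 \<and>
     (\<forall>v\<in>tangent_vectors (frontier \<Omega>) \<eta>. v \<bullet> \<nu> = 0) \<and>
     (\<forall>\<^sub>F t in at_right 0. \<eta> + t *\<^sub>R \<nu> \<notin> \<Omega>)"

definition outer_normal :: "'a::euclidean_space set \<Rightarrow> 'a \<Rightarrow> 'a" where
  "outer_normal \<Omega> \<eta> = (THE \<nu>. is_unit_outer_normal \<Omega> \<eta> \<nu>)"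

definition unit_tangents :: "'a::euclidean_space set \<Rightarrow> 'a \<Rightarrow> 'a set" where
  "unit_tangents \<Omega> \<eta> = {\<tau>. norm \<tau> = 1 \<and> \<tau> \<bullet> outer_normal \<Omega> \<eta> = 0}"

definition phi :: "'a::euclidean_space set \<Rightarrow> nat \<Rightarrow> 'a \<Rightarrow> real" where
  "phi \<Omega> n \<xi> = sqrt (infdist \<xi> (frontier \<Omega>)) + 1 / real n"

definition near_boundary :: "'a::euclidean_space set \<Rightarrow> nat \<Rightarrow> real \<Rightarrow> 'a \<Rightarrow> 'a set" where
  "near_boundary \<Omega> n \<mu> \<xi> = {\<eta> \<in> frontier \<Omega>. norm (\<eta> - \<xi>) \<le> \<mu> * phi \<Omega> n \<xi>}"

definition max_deriv ::
  "'a::euclidean_space set \<Rightarrow> nat \<Rightarrow> real \<Rightarrow> nat \<Rightarrow> nat \<Rightarrow> ('a \<Rightarrow> real) \<Rightarrow> 'a \<Rightarrow> real" where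
  "max_deriv \<Omega> n \<mu> l\<^sub>1 l\<^sub>2 f \<xi> =
     (if near_boundary \<Omega> n \<mu> \<xi> = {} then 0
      else SUP \<eta> \<in> near_boundary \<Omega> n \<mu> \<xi>. SUP \<tau> \<in> unit_tangents \<Omega> \<eta>.
        \<bar>(dir_deriv \<tau> ^^ l\<^sub>1) ((dir_deriv (outer_normal \<Omega> \<eta>) ^^ l\<^sub>2) f) \<xi>\<bar>)"

text \<open>The index set consists of the multi-indices of order at most \<open>n\<close>.\<close>

definition poly_of_degree_at_most :: "nat \<Rightarrow> ('a::euclidean_space \<Rightarrow> real) \<Rightarrow> bool" where
  "poly_of_degree_at_most n f \<longleftrightarrow>
     (\<exists>c. \<forall>x. f x =
        (\<Sum>\<alpha> \<in> {\<alpha> \<in> Basis \<rightarrow>\<^sub>E {..n}. (\<Sum>b\<in>Basis. \<alpha> b) \<le> n}.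
           c \<alpha> * (\<Prod>b\<in>Basis. (x \<bullet> b) ^ \<alpha> b)))"

definition ennreal_powr :: "ennreal \<Rightarrow> real \<Rightarrow> ennreal" where
  "ennreal_powr x a = (if x = \<infinity> then \<infinity> else ennreal (enn2real x powr a))"

definition Lp_norm :: "ennreal \<Rightarrow> 'a::euclidean_space set \<Rightarrow> ('a \<Rightarrow> real) \<Rightarrow> ennreal" where
  "Lp_norm p \<Omega> f =
     (if p = \<infinity> then esssup (lebesgue_on \<Omega>) (\<lambda>x. ennreal \<bar>f x\<bar>)
      else ennreal_powr (\<integral>\<^sup>+ x. ennreal (\<bar>f x\<bar> powr enn2real p) \<partial>lebesgue_on \<Omega>)
             (1 / enn2real p))"

end

theory Submission
  imports Defs "HOL-Complex_Analysis.Complex_Analysis" "HOL-Computational_Algebra.Fundamental_Theorem_Algebra"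
    "HOL-Probability.Infinite_Product_Measure"
begin

text \<open>
  By Cauchy's inequalities it suffices to bound the complexified polynomial on complex boxes around \<open>\<xi>\<close> of size
  \<open>1 / n\<close> in the tangential and \<open>\<phi> / n\<close> in the normal directions. Since the normals at nearby boundary points
  differ by \<open>O(\<phi>)\<close>, one such box serves all \<open>\<eta>\<close> and \<open>\<tau>\<close> in the maximum.

  In one variable, reflecting the zeros of a polynomial at the unit circle gives a zero-free majorant \<open>G\<close>, and
  the Poisson formula for \<open>G\<^sup>p\<close> bounds \<open>\<bar>Q\<bar>\<^sup>p\<close> near a point of an interval by a Poisson average of
  \<open>\<bar>Q\<bar>\<^sup>p\<close> over the interval, for every \<open>p > 0\<close>; a holomorphic factor vanishing at both ends yields the weight needed
  for vertical segments that end on the boundary. Near the boundary this is applied along parabolas that are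
  tangential to the boundary and bend inwards, and then along vertical segments. For fixed parameters the parabolas
  define measure preserving shears, so that the averages integrate to a multiple of \<open>\<integral>\<bar>f\<bar>\<^sup>p\<close>. Away from the boundary
  the parabolas are replaced by translations.
\<close>

section \<open>Poisson kernel and zeros of polynomials\<close>

text \<open>The zeros are reflected because of where the bound is needed. A point of the interval
  lifts to the unit circle, where the Poisson kernel degenerates, so the evaluation point is moved
  inward by about \<open>1 / N\<close>. With zeros in the disc, the modulus may collapse under this
  move; without them a polynomial of degree \<open>2 N\<close> loses only a bounded factor. The
  resulting kernel is symmetric in its two angles and has mass one, so integrating over the
  evaluation point by Tonelli's theorem loses nothing.

  The square root in \<phi> comes from the cosine parametrization: depth
  \<open>\<Lambda> (1 - cos a) / 2 = h\<close> makes \<open>sin a\<close> of order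
  \<open>sqrt h\<close>, and \<open>(sin a + 1 / n) / n\<close> is the order of the radius in which
  a polynomial of degree \<open>n\<close> is controlled.

  A straight tangential segment of fixed length may leave \<Omega>. A parabola stays inside and is
  still polynomial in its parameter, at the price of the degree \<open>2 n\<close>. Since depth does
  not decrease along it, a vertical offset admissible at its start is admissible at its end.

  Of the \<open>j + l\<close> factors \<open>1 / \<phi>\<close> from Cauchy's inequality,
  \<open>\<phi> ^ j\<close> cancels \<open>j\<close>, and each of the others is at most
  \<open>n\<close>.\<close>

definition unit_circle :: "real \<Rightarrow> complex" where
  "unit_circle t = cis (2 * pi * t)"

definition poisson :: "complex \<Rightarrow> complex \<Rightarrow> real" where
  "poisson w z = (1 - (norm w)\<^sup>2) / (norm (z - w))\<^sup>2"

lemma norm_unit_circle [simp]: "norm (unit_circle t) = 1"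
  by (simp add: unit_circle_def)

lemma continuous_on_unit_circle [continuous_intros]:
  "continuous_on A f \<Longrightarrow> continuous_on A (\<lambda>x. unit_circle (f x))"
  unfolding unit_circle_def cis_conv_exp by (intro continuous_intros)

lemma circlepath_0_1: "circlepath 0 1 t = unit_circle t"
  by (simp add: circlepath unit_circle_def cis_conv_exp mult_ac)

text \<open>This is Cauchy's formula at \<open>w\<close> for \<open>k\<close>, the product of
  \<open>H\<close> with a factor that equals 1 at \<open>w\<close>. On the circle
  \<open>1 - cnj w * z = z * cnj (z - w)\<close>, which turns the Cauchy kernel into the Poisson
  kernel.\<close>

lemma Poisson_integral_formula:
  assumes H: "H holomorphic_on ball 0 R" and R: "R > 1" and w: "norm w < 1"
  shows "((\<lambda>t. of_real (poisson w (unit_circle t)) * H (unit_circle t)) has_integral H w) {0..1}"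
proof -
  define k where "k z = H z * ((1 - w * cnj w) / (1 - cnj w * z))" for z
  have nz: "1 - cnj w * z \<noteq> 0" if "norm z \<le> 1" for z
  proof
    assume "1 - cnj w * z = 0"
    then have "norm (cnj w * z) = 1" by simp
    moreover have "norm (cnj w * z) \<le> norm w * 1"
      unfolding norm_mult complex_mod_cnj using that by (intro mult_left_mono) auto
    ultimately show False using w by linarith
  qed
  have "k holomorphic_on ball 0 1"
    unfolding k_def using nz R by (intro holomorphic_intros holomorphic_on_subset[OF H]) auto
  moreover have "continuous_on (cball 0 1) H"
    using holomorphic_on_imp_continuous_on[OF H] by (rule continuous_on_subset) (use R in auto)
  then have "continuous_on (cball 0 1) k"
    unfolding k_def using nz by (intro continuous_intros) auto
  ultimately have "((\<lambda>u. k u / (u - w)) has_contour_integral (2 * of_real pi * \<i> * k w)) (circlepath 0 1)"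
    using w by (intro Cauchy_integral_circlepath) auto
  then have "((\<lambda>t. (k (unit_circle t) / (unit_circle t - w)) * (2 * pi * \<i> * unit_circle t))
      has_integral (2 * of_real pi * \<i> * k w)) {0..1}"
    unfolding has_contour_integral
    by (rule has_integral_spike_eq[THEN iffD1, OF negligible_empty, rotated])
       (auto simp: circlepath_0_1 vector_derivative_circlepath unit_circle_def cis_conv_exp mult_ac)
  then have I: "((\<lambda>t. (1 / (2 * of_real pi * \<i>)) * ((k (unit_circle t) / (unit_circle t - w)) * (2 * pi * \<i> * unit_circle t)))
      has_integral (1 / (2 * of_real pi * \<i>)) * (2 * of_real pi * \<i> * k w)) {0..1}"
    by (rule has_integral_mult_right)
  have kw: "(1 / (2 * of_real pi * \<i>)) * (2 * of_real pi * \<i> * k w) = H w"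
    using nz[of w] w unfolding k_def by (simp add: mult.commute)
  have eq: "(1 / (2 * of_real pi * \<i>)) * ((k z / (z - w)) * (2 * pi * \<i> * z))
      = of_real (poisson w z) * H z" if z: "norm z = 1" for z
  proof -
    have zz: "z * cnj z = 1" using z by (simp add: complex_mult_cnj cmod_power2[symmetric] flip: complex_norm_square)
    have "(1 - cnj w * z) * (z - w) = z * ((z - w) * cnj (z - w))"
      using zz by (simp add: algebra_simps)
    also have "\<dots> = z * of_real ((norm (z - w))\<^sup>2)" by (simp only: complex_norm_square)
    finally have d: "(1 - cnj w * z) * (z - w) = z * of_real ((norm (z - w))\<^sup>2)" .
    have "z \<noteq> 0" using z by auto
    have "k z / (z - w) * z = H z * (1 - w * cnj w) / ((1 - cnj w * z) * (z - w)) * z"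
      unfolding k_def by simp
    also have "\<dots> = H z * (1 - w * cnj w) / of_real ((norm (z - w))\<^sup>2)"
      unfolding d using \<open>z \<noteq> 0\<close> by simp
    also have "\<dots> = of_real (poisson w z) * H z"
      by (simp only: poisson_def of_real_divide of_real_diff of_real_1 complex_norm_square[of w]) simp
    finally have e: "k z / (z - w) * z = of_real (poisson w z) * H z" .
    have "1 / c * (x * (c * z)) = x * z" if "c \<noteq> 0" for c x :: complex
      using that by simp
    from this[of "2 * of_real pi * \<i>" "k z / (z - w)"] show ?thesis using e by simp
  qed
  show ?thesis using I unfolding kw by (simp only: eq norm_unit_circle)
qed

lemma poisson_nonneg: "norm w < 1 \<Longrightarrow> 0 \<le> poisson w z"
  unfolding poisson_def by (simp add: power_le_one)

lemma continuous_on_poisson [continuous_intros]: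
  assumes "norm w < 1"
  shows "continuous_on A (\<lambda>t. poisson w (unit_circle t))"
  unfolding poisson_def using assms by (intro continuous_intros) (metis norm_unit_circle eq_iff_diff_eq_0 less_irrefl norm_eq_zero zero_eq_power2)

lemma has_integral_poisson:
  assumes "norm w < 1"
  shows "((\<lambda>t. poisson w (unit_circle t)) has_integral 1) {0..1}"
proof -
  have "((\<lambda>t. of_real (poisson w (unit_circle t)) * 1 :: complex) has_integral 1) {0..1}"
    by (rule Poisson_integral_formula[of "\<lambda>_. 1" 2]) (use assms in auto)
  from has_integral_linear[OF this bounded_linear_Re] show ?thesis by (simp add: o_def)
qed

lemma Poisson_norm_le:
  assumes H: "H holomorphic_on ball 0 R" and R: "R > 1" and w: "norm w < 1"
  shows "norm (H w) \<le> integral {0..1} (\<lambda>t. poisson w (unit_circle t) * norm (H (unit_circle t)))"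
proof -
  have cH: "continuous_on {0..1} (\<lambda>t. H (unit_circle t))"
    by (rule continuous_on_compose2[OF holomorphic_on_imp_continuous_on[OF H]])
       (use R in \<open>auto intro!: continuous_intros\<close>)
  have I: "H w = integral {0..1} (\<lambda>t. of_real (poisson w (unit_circle t)) * H (unit_circle t))"
    using Poisson_integral_formula[OF assms] by (simp add: integral_unique)
  show ?thesis unfolding I
  proof (rule integral_norm_bound_integral)
    show "(\<lambda>t. of_real (poisson w (unit_circle t)) * H (unit_circle t)) integrable_on {0..1}"
      using Poisson_integral_formula[OF assms] by blast
    show "(\<lambda>t. poisson w (unit_circle t) * norm (H (unit_circle t))) integrable_on {0..1}"
      by (intro integrable_continuous_interval continuous_intros cH w)
  qed (use poisson_nonneg[OF w] in \<open>auto simp: norm_mult\<close>)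
qed

text \<open>The circles of radius \<open>\<sigma> < 1\<close> avoid the zeros of \<open>G\<close> on the unit circle.\<close>

lemma zero_free_powr_le_Poisson:
  fixes G S :: "complex \<Rightarrow> complex"
  assumes G: "G holomorphic_on UNIV" and S: "S holomorphic_on UNIV"
    and nz: "\<And>z. norm z < 1 \<Longrightarrow> G z \<noteq> 0" and p: "p > 0" and w: "norm w < 1"
  shows "norm (G w) powr p * norm (S w)
    \<le> integral {0..1} (\<lambda>t. poisson w (unit_circle t) * (norm (G (unit_circle t)) powr p * norm (S (unit_circle t))))"
proof -
  \<comment> \<open>A zero-free function on the disc has a holomorphic logarithm \<open>L\<close>.
    Then \<open>exp (p L)\<close> serves as \<open>G\<close> to the real power \<open>p\<close>, and
    its product with \<open>S\<close> stays holomorphic.\<close>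
  obtain L where L: "L holomorphic_on ball 0 1" and GL: "\<And>z. z \<in> ball 0 1 \<Longrightarrow> G z = exp (L z)"
    using contractible_imp_holomorphic_log[of G "ball 0 1"] nz holomorphic_on_subset[OF G]
      convex_imp_contractible[OF convex_ball] by (metis mem_ball_0 subset_UNIV)
  define K where "K \<sigma> z = norm (G (of_real \<sigma> * z)) powr p * norm (S (of_real \<sigma> * z))" for \<sigma> z
  have ineq: "K \<sigma> w \<le> integral {0..1} (\<lambda>t. poisson w (unit_circle t) * K \<sigma> (unit_circle t))"
    if \<sigma>: "0 < \<sigma>" "\<sigma> < 1" for \<sigma>
  proof -
    define H where "H z = exp (of_real p * L (of_real \<sigma> * z)) * S (of_real \<sigma> * z)" for z
    have hL: "(\<lambda>z. L (of_real \<sigma> * z)) holomorphic_on ball 0 (1 / \<sigma>)"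
      by (rule holomorphic_on_compose_gen[of _ _ L "ball 0 1", unfolded o_def])
         (use \<sigma> L in \<open>auto intro!: holomorphic_intros simp: norm_mult field_simps\<close>)
    have hS: "(\<lambda>z. S (of_real \<sigma> * z)) holomorphic_on ball 0 (1 / \<sigma>)"
      by (rule holomorphic_on_compose_gen[of _ _ S UNIV, unfolded o_def])
         (use S in \<open>auto intro!: holomorphic_intros\<close>)
    have H: "H holomorphic_on ball 0 (1 / \<sigma>)"
      unfolding H_def by (intro holomorphic_intros hL hS)
    have HK: "norm (H z) = K \<sigma> z" if "norm z \<le> 1" for z
    proof -
      have "\<sigma> * norm z < 1" using \<sigma> that by (metis mult.commute mult.right_neutral mult_left_mono le_less_trans less_eq_real_def)
      then have "of_real \<sigma> * z \<in> ball 0 1" using \<sigma> by (simp add: norm_mult)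
      then have e: "G (of_real \<sigma> * z) = exp (L (of_real \<sigma> * z))" by (rule GL)
      show ?thesis by (simp add: H_def K_def e norm_mult norm_exp_eq_Re powr_def)
    qed
    have "norm (H w) \<le> integral {0..1} (\<lambda>t. poisson w (unit_circle t) * norm (H (unit_circle t)))"
      by (rule Poisson_norm_le[OF H _ w]) (use \<sigma> in auto)
    then show ?thesis using w by (simp add: HK)
  qed
  have cG: "continuous_on UNIV G" and cS: "continuous_on UNIV S"
    using G S holomorphic_on_imp_continuous_on by auto
  have cK: "continuous_on A (\<lambda>x. K (f x) (h x))" if "continuous_on A f" "continuous_on A h" for A :: "'c::topological_space set" and f h
    unfolding K_def using p
    by (intro continuous_intros continuous_on_compose2[OF cG] continuous_on_compose2[OF cS] that
        continuous_on_powr') auto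
  have cI: "continuous_on {0..1} (\<lambda>\<sigma>. integral {0..1} (\<lambda>t. poisson w (unit_circle t) * K \<sigma> (unit_circle t)))"
  proof -
    have "continuous_on ({0..1::real} \<times> cbox 0 1) (\<lambda>(\<sigma>, t). poisson w (unit_circle t) * K \<sigma> (unit_circle t))"
      unfolding split_def
      by (intro continuous_intros cK continuous_on_compose2[OF continuous_on_poisson[OF w, of UNIV]]) auto
    from integral_continuous_on_param[OF this] show ?thesis by (simp add: split_def)
  qed
  \<comment> \<open>Both sides are continuous in \<open>\<sigma>\<close> on the closed interval, so
    the inequality survives the limit as \<open>\<sigma>\<close> tends to 1.\<close>
  have "K 1 w \<le> integral {0..1} (\<lambda>t. poisson w (unit_circle t) * K 1 (unit_circle t))"
  proof (rule tendsto_le)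
    show "((\<lambda>\<sigma>. integral {0..1} (\<lambda>t. poisson w (unit_circle t) * K \<sigma> (unit_circle t))) \<longlongrightarrow>
       integral {0..1} (\<lambda>t. poisson w (unit_circle t) * K 1 (unit_circle t))) (at 1 within {0..1})"
      using cI by (auto simp: continuous_on_def)
    have "continuous_on {0..1} (\<lambda>\<sigma>. K \<sigma> w)" by (intro cK continuous_intros)
    then show "((\<lambda>\<sigma>. K \<sigma> w) \<longlongrightarrow> K 1 w) (at 1 within {0..1})"
      by (auto simp: continuous_on_def)
    show "\<forall>\<^sub>F \<sigma> in at 1 within {0..1}. K \<sigma> w \<le> integral {0..1} (\<lambda>t. poisson w (unit_circle t) * K \<sigma> (unit_circle t))"
      unfolding eventually_at by (rule exI[of _ 1]) (auto simp: dist_real_def intro!: ineq)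
    show "at (1::real) within {0..1} \<noteq> bot"
      by (simp add: at_within_Icc_at_left[symmetric] trivial_limit_within islimpt_Icc)
  qed
  then show ?thesis by (simp add: K_def)
qed

text \<open>The sign of the right side decides all comparisons of a factor with its reflection: it
  vanishes on the circle and is nonnegative when \<open>a\<close> and \<open>w\<close> lie on the
  same side of it.\<close>

lemma reflected_factor_identity:
  "(norm (1 - cnj a * w))\<^sup>2 - (norm (w - a))\<^sup>2 = (1 - (norm w)\<^sup>2) * (1 - (norm (a::complex))\<^sup>2)"
proof -
  have "(1 - (c * x + d * y))\<^sup>2 + (d * x - c * y)\<^sup>2 - ((x - c)\<^sup>2 + (y - d)\<^sup>2) = (1 - (x\<^sup>2 + y\<^sup>2)) * (1 - (c\<^sup>2 + d\<^sup>2))"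
    for c d x y :: real by algebra
  from this[of "Re a" "Re w" "Im a" "Im w"] show ?thesis unfolding cmod_power2 by simp
qed

lemma norm_reflected_factor:
  assumes "norm w = 1"
  shows "norm (1 - cnj a * w) = norm (w - (a::complex))"
  using reflected_factor_identity[of a w] assms by simp

lemma norm_factor_le_reflected:
  fixes a w :: complex
  assumes "norm w \<le> 1 \<and> norm a \<le> 1 \<or> norm w \<ge> 1 \<and> norm a \<ge> 1"
  shows "norm (w - a) \<le> norm (1 - cnj a * w)"
proof -
  have "0 \<le> (1 - (norm w)\<^sup>2) * (1 - (norm a)\<^sup>2)"
    using assms
  proof
    assume "norm w \<le> 1 \<and> norm a \<le> 1"
    then show ?thesis by (intro mult_nonneg_nonneg) (auto simp: power_le_one)
  next
    assume "norm w \<ge> 1 \<and> norm a \<ge> 1"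
    then show ?thesis by (intro mult_nonpos_nonpos) (auto simp: one_le_power)
  qed
  then have "(norm (w - a))\<^sup>2 \<le> (norm (1 - cnj a * w))\<^sup>2"
    unfolding reflected_factor_identity[symmetric] by linarith
  then show ?thesis by (rule power2_le_imp_le) simp
qed

text \<open>Since 1 lies outside the open disc, shrinking \<open>b\<close> towards 0 cannot bring it
  much closer to 1; \<open>b = -1\<close> gives equality. Taken over all zeros, this bounds what a
  zero-free polynomial can lose when its argument is moved towards the centre.\<close>

lemma norm_one_minus_dilation:
  fixes b :: complex
  assumes b: "norm b \<le> 1" and r: "0 \<le> r" "r \<le> 1"
  shows "(1 + r) / 2 * norm (1 - b) \<le> norm (1 - of_real r * b)"
proof (rule power2_le_imp_le)
  have x: "- 1 \<le> Re b" using abs_Re_le_cmod[of b] b by linarith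
  have n: "(norm b)\<^sup>2 \<le> 1" using b by (simp add: power_le_one)
  have "0 \<le> 3 + r + 2 * Re b * (1 - r) - (1 + 3 * r) * (norm b)\<^sup>2"
  proof -
    have "(1 + 3 * r) * (norm b)\<^sup>2 \<le> (1 + 3 * r) * 1" using n r by (intro mult_left_mono) auto
    moreover have "- 1 * (1 - r) \<le> Re b * (1 - r)" using x r by (intro mult_right_mono) auto
    ultimately show ?thesis by (simp add: algebra_simps)
  qed
  then have "0 \<le> (1 - r) * (3 + r + 2 * Re b * (1 - r) - (1 + 3 * r) * (norm b)\<^sup>2)"
    using r by simp
  also have "\<dots> = 4 * (norm (1 - of_real r * b))\<^sup>2 - (1 + r)\<^sup>2 * (norm (1 - b))\<^sup>2"
  proof -
    have "(1 - r) * (3 + r + 2 * x * (1 - r) - (1 + 3 * r) * (x\<^sup>2 + y\<^sup>2)) =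
        4 * ((1 - r * x)\<^sup>2 + (r * y)\<^sup>2) - (1 + r)\<^sup>2 * ((1 - x)\<^sup>2 + y\<^sup>2)" for x y
      by algebra
    then show ?thesis unfolding cmod_power2 by simp
  qed
  finally show "((1 + r) / 2 * norm (1 - b))\<^sup>2 \<le> (norm (1 - of_real r * b))\<^sup>2"
    by (simp only: power_mult_distrib power_divide) simp
qed (rule norm_ge_zero)

text \<open>\<open>G\<close> arises from \<open>Q\<close> by reflecting the zeros in the open unit disc at the unit circle.\<close>

lemma reflected_zeros_majorant:
  fixes Q :: "complex poly"
  assumes "Q \<noteq> 0"
  shows "\<exists>G :: complex poly.
    (\<forall>z. norm z < 1 \<longrightarrow> poly G z \<noteq> 0) \<and>
    (\<forall>z. norm z = 1 \<longrightarrow> norm (poly G z) = norm (poly Q z)) \<and>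
    (\<forall>z. norm z \<le> 1 \<longrightarrow> norm (poly Q z) \<le> norm (poly G z)) \<and>
    (\<forall>z. norm z \<ge> 1 \<longrightarrow> norm (poly Q z) \<le> norm z ^ degree Q * norm (poly G (1 / cnj z))) \<and>
    (\<forall>z r. norm z \<le> 1 \<longrightarrow> 0 \<le> r \<longrightarrow> r \<le> 1 \<longrightarrow>
      ((1 + r) / 2) ^ degree Q * norm (poly G z) \<le> norm (poly G (of_real r * z)))"
  using assms
proof (induction "degree Q" arbitrary: Q)
  case 0
  then obtain c where "Q = [:c:]" using degree_0_id by metis
  with 0 show ?case by (intro exI[of _ Q]) auto
next
  case (Suc k)
  then obtain a where "poly Q a = 0" using alg_closed_imp_poly_has_root[of Q] by auto
  then obtain Q' where Q: "Q = [:- a, 1:] * Q'" unfolding poly_eq_0_iff_dvd dvd_def by blast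
  with Suc.prems have "Q' \<noteq> 0" by auto
  then have dQ: "degree Q = Suc (degree Q')" using Q degree_mult_eq[of "[:- a, 1:]" Q'] by simp
  with Suc.hyps have "k = degree Q'" by simp
  from Suc.hyps(1)[OF this \<open>Q' \<noteq> 0\<close>] obtain G' where
    G1: "\<And>z. norm z < 1 \<Longrightarrow> poly G' z \<noteq> 0" and
    G2: "\<And>z. norm z = 1 \<Longrightarrow> norm (poly G' z) = norm (poly Q' z)" and
    G3: "\<And>z. norm z \<le> 1 \<Longrightarrow> norm (poly Q' z) \<le> norm (poly G' z)" and
    G4: "\<And>z. norm z \<ge> 1 \<Longrightarrow> norm (poly Q' z) \<le> norm z ^ degree Q' * norm (poly G' (1 / cnj z))" and
    G5: "\<And>z r. norm z \<le> 1 \<Longrightarrow> 0 \<le> r \<Longrightarrow> r \<le> 1 \<Longrightarrow>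
      ((1 + r) / 2) ^ degree Q' * norm (poly G' z) \<le> norm (poly G' (of_real r * z))"
    by blast
  \<comment> \<open>For \<open>a = 0\<close> the reflected zero is at infinity and the factor is the
    constant 1. A zero on or outside the circle is kept.\<close>
  define g where "g = (if norm a < 1 then [:1, - cnj a:] else [:- a, 1:])"
  have pQ: "poly Q z = (z - a) * poly Q' z" for z by (simp add: Q algebra_simps)
  have pg: "poly g z = (if norm a < 1 then 1 - cnj a * z else z - a)" for z
    by (simp add: g_def mult.commute)
  have g1: "poly g z \<noteq> 0" if z: "norm z < 1" for z
  proof (cases "norm a < 1")
    case True
    have "norm (cnj a * z) < 1"
      unfolding norm_mult complex_mod_cnj using True z mult_strict_mono[of "norm a" 1 "norm z" 1] by auto
    then have "cnj a * z \<noteq> 1" by (metis less_irrefl norm_one)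
    then show ?thesis using True pg by auto
  qed (use z pg in auto)
  have g2: "norm (poly g z) = norm (z - a)" if "norm z = 1" for z
    using norm_reflected_factor[OF that] pg by simp
  have g3: "norm (z - a) \<le> norm (poly g z)" if "norm z \<le> 1" for z
    using norm_factor_le_reflected[of z a] that pg by simp
  \<comment> \<open>Outside the disc the comparison is with the reflected argument
    \<open>1 / cnj z\<close>. Multiplying by \<open>cnj z\<close> clears the denominator; this is
    the source of one factor \<open>norm z\<close> for each zero.\<close>
  have g4: "norm (z - a) \<le> norm z * norm (poly g (1 / cnj z))" if z: "norm z \<ge> 1" for z
  proof (cases "norm a < 1")
    case True
    have "norm z * norm (1 - cnj a * (1 / cnj z)) = norm (cnj z * (1 - cnj a * (1 / cnj z)))"
      by (simp add: norm_mult)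
    also have "cnj z * (1 - cnj a * (1 / cnj z)) = cnj (z - a)"
      using z by (auto simp: field_simps)
    finally show ?thesis using True pg by (simp del: complex_cnj_diff)
  next
    case False
    have "norm z * norm (1 / cnj z - a) = norm (cnj z * (1 / cnj z - a))"
      by (simp add: norm_mult)
    also have "cnj z * (1 / cnj z - a) = cnj (1 - cnj a * z)"
      using z by (auto simp: field_simps)
    finally have "norm z * norm (1 / cnj z - a) = norm (1 - cnj a * z)"
      by (simp only: complex_mod_cnj)
    then show ?thesis using False pg norm_factor_le_reflected[of z a] z by simp
  qed
  \<comment> \<open>Up to a constant factor, \<open>poly g z\<close> is \<open>1 - b\<close> with
    \<open>b = cnj a * z\<close> or \<open>b = z / a\<close>, of modulus at most 1, and moving
    \<open>z\<close> to \<open>r z\<close> moves \<open>b\<close> to \<open>r b\<close>.\<close>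
  have g5: "(1 + r) / 2 * norm (poly g z) \<le> norm (poly g (of_real r * z))"
    if z: "norm z \<le> 1" and r: "0 \<le> r" "r \<le> 1" for z r
  proof (cases "norm a < 1")
    case True
    have "norm (cnj a * z) \<le> 1"
      unfolding norm_mult complex_mod_cnj using True z mult_mono[of "norm a" 1 "norm z" 1] by auto
    from norm_one_minus_dilation[OF this r] show ?thesis using True pg by (simp add: mult_ac)
  next
    case False
    then have a: "a \<noteq> 0" by auto
    have f: "norm (y - a) = norm a * norm (1 - y / a)" for y
    proof -
      have "y - a = - a * (1 - y / a)" using a by (simp add: field_simps)
      then show ?thesis by (metis norm_minus_cancel norm_mult)
    qed
    have "norm (z / a) \<le> 1" using z False by (simp add: norm_divide divide_le_eq)
    from norm_one_minus_dilation[OF this r]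
    have "norm a * ((1 + r) / 2 * norm (1 - z / a)) \<le> norm a * norm (1 - of_real r * (z / a))"
      by (intro mult_left_mono) auto
    then show ?thesis using False pg f by (simp add: mult_ac)
  qed
  have cz: "norm (1 / cnj z) \<le> 1" if "norm z \<ge> 1" for z
    using that by (simp add: norm_divide divide_le_eq)
  show ?case
  proof (intro exI[of _ "g * G'"] conjI allI impI)
    fix z :: complex
    show "norm z < 1 \<Longrightarrow> poly (g * G') z \<noteq> 0" using g1 G1 by simp
    show "norm z = 1 \<Longrightarrow> norm (poly (g * G') z) = norm (poly Q z)"
      using g2 G2 by (simp add: pQ norm_mult)
    show "norm z \<le> 1 \<Longrightarrow> norm (poly Q z) \<le> norm (poly (g * G') z)"
      using g3 G3 by (simp add: pQ norm_mult mult_mono)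
    assume "norm z \<ge> 1"
    from mult_mono[OF g4[OF this] G4[OF this]]
    show "norm (poly Q z) \<le> norm z ^ degree Q * norm (poly (g * G') (1 / cnj z))"
      by (simp add: pQ norm_mult dQ mult_ac)
  next
    fix z :: complex and r :: real
    assume z: "norm z \<le> 1" "0 \<le> r" "r \<le> 1"
    from mult_mono[OF g5[OF z] G5[OF z]] z
    show "((1 + r) / 2) ^ degree Q * norm (poly (g * G') z) \<le> norm (poly (g * G') (of_real r * z))"
      by (simp add: norm_mult dQ mult_ac)
  qed
qed

text \<open>A Harnack inequality: the displacement is an eighth of the distance \<open>1 - r\<close>
  to the circle, so the distance to \<open>z\<close> keeps at least 7/8 of its size while the
  numerator grows at most by the factor 9/4, and \<open>9 / 4 * (8 / 7) ^ 2 < 3\<close>.\<close>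

lemma poisson_near_le:
  fixes w w0 z :: complex
  assumes r: "norm w0 = r" "0 \<le> r" "r < 1" and d: "norm (w - w0) \<le> (1 - r) / 8" and z: "norm z = 1"
  shows "poisson w z \<le> 3 * poisson w0 z"
proof -
  have a: "1 - r \<le> norm (z - w0)" using norm_triangle_ineq2[of z w0] r z by simp
  have "norm (z - w0) \<le> norm (z - w) + norm (w - w0)" by (metis norm_triangle_ineq diff_add_cancel add_diff_eq)
  then have b: "7 / 8 * norm (z - w0) \<le> norm (z - w)" using d a by simp
  have w: "norm w \<ge> r - (1 - r) / 8" "norm w \<le> r + (1 - r) / 8"
    using norm_triangle_ineq2[of w0 w] norm_triangle_ineq2[of w w0] d r(1)
    unfolding norm_minus_commute[of w0 w] by linarith+
  have w1: "norm w < 1" using w(2) r(3) by (simp add: field_simps)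
  have "1 - (norm w)\<^sup>2 = (1 - norm w) * (1 + norm w)" by (simp add: power2_eq_square algebra_simps)
  also have "\<dots> \<le> (9 / 8 * (1 - r)) * 2"
  proof (intro mult_mono)
    show "1 - norm w \<le> 9 / 8 * (1 - r)" using w(1) by (simp add: field_simps)
  qed (use w1 r(3) in auto)
  also have "\<dots> \<le> 9 / 4 * ((1 - r) * (1 + r))"
    using mult_nonneg_nonneg[of r "1 - r"] r(2,3) by (simp add: field_simps)
  also have "\<dots> = 9 / 4 * (1 - r\<^sup>2)" by (simp add: power2_eq_square algebra_simps)
  finally have n: "1 - (norm w)\<^sup>2 \<le> 9 / 4 * (1 - r\<^sup>2)" .
  have p: "0 < norm (z - w0)" using a r by linarith
  have r2: "r\<^sup>2 \<le> 1" using r by (simp add: power_le_one)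
  have "(7 / 8 * norm (z - w0))\<^sup>2 \<le> (norm (z - w))\<^sup>2" using b by (intro power_mono) auto
  then have "poisson w z \<le> (9 / 4 * (1 - r\<^sup>2)) / (7 / 8 * norm (z - w0))\<^sup>2"
    unfolding poisson_def using n p r2 w1 by (intro frac_le) auto
  also have "\<dots> = (9 / 4 * (64 / 49)) * poisson w0 z"
    using p by (simp add: poisson_def r power_mult_distrib power_divide field_simps)
  also have "\<dots> \<le> 3 * poisson w0 z"
    using poisson_nonneg[of w0 z] r by (intro mult_right_mono) auto
  finally show ?thesis .
qed

text \<open>The point \<open>w\<close> is reflected into the closed disc if necessary and then moved
  inward to \<open>w'\<close>, each step costing a factor 2; this gives \<open>4 powr p\<close>. The
  factor 3 comes from replacing the Poisson kernel at \<open>w'\<close> by the one at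
  \<open>r u\<close>, which is the same for all \<open>w\<close> near \<open>u\<close>. One
  \<open>w'\<close> serves every \<open>p\<close> and \<open>S\<close>, so that a lower bound for
  \<open>S w'\<close> can be derived from the location of \<open>w'\<close> alone.\<close>

lemma poly_near_circle_bound:
  fixes Q :: "complex poly" and u w :: complex
  assumes Q: "degree Q \<le> m" and m: "m \<ge> 1" and u: "norm u = 1" and w: "norm (w - u) \<le> 1 / (8 * real m)"
  defines "r \<equiv> 1 - 1 / real m"
  shows "\<exists>w'. norm (w' - of_real r * u) \<le> 1 / (8 * real m) \<and>
    (\<forall>p>0. \<forall>S. S holomorphic_on UNIV \<longrightarrow>
      norm (poly Q w) powr p * norm (S w') \<le> 3 * 4 powr p * integral {0..1} (\<lambda>t.
        poisson (of_real r * u) (unit_circle t) * (norm (poly Q (unit_circle t)) powr p * norm (S (unit_circle t)))))"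
proof (cases "Q = 0")
  case True
  then show ?thesis by (intro exI[of _ "of_real r * u"]) auto
next
  case False
  from reflected_zeros_majorant[OF this] obtain G where
    G1: "\<And>z. norm z < 1 \<Longrightarrow> poly G z \<noteq> 0" and
    G2: "\<And>z. norm z = 1 \<Longrightarrow> norm (poly G z) = norm (poly Q z)" and
    G3: "\<And>z. norm z \<le> 1 \<Longrightarrow> norm (poly Q z) \<le> norm (poly G z)" and
    G4: "\<And>z. norm z \<ge> 1 \<Longrightarrow> norm (poly Q z) \<le> norm z ^ degree Q * norm (poly G (1 / cnj z))" and
    G5: "\<And>z r. norm z \<le> 1 \<Longrightarrow> 0 \<le> r \<Longrightarrow> r \<le> 1 \<Longrightarrow>
      ((1 + r) / 2) ^ degree Q * norm (poly G z) \<le> norm (poly G (of_real r * z))"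
    by blast
  have r: "0 \<le> r" "r < 1" using m by (auto simp: r_def)
  have u0: "u \<noteq> 0" using u by auto
  have m8: "1 / (8 * real m) \<le> 1" using m by (simp add: field_simps)
  have "norm w \<le> 1 + 1 / (8 * real m)" "norm w \<ge> 1 - 1 / (8 * real m)"
    using norm_triangle_ineq2[of w u] norm_triangle_ineq2[of u w] u w by (auto simp: norm_minus_commute)
  have m1: "1 / real m \<le> 1" "0 < 1 / real m" using m by auto
  have w0: "w \<noteq> 0"
  proof
    assume "w = 0"
    then have "1 \<le> 1 / (8 * real m)" using w u by simp
    then show False using m by (simp add: field_simps)
  qed
  define v where "v = (if norm w \<le> 1 then w else 1 / cnj w)"
  have v1: "norm v \<le> 1" by (auto simp: v_def norm_divide divide_le_eq)
  \<comment> \<open>The reflection fixes \<open>u\<close> and, for \<open>w\<close> outside the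
    disc, divides the distance to it by \<open>norm w\<close>.\<close>
  have vu: "norm (v - u) \<le> 1 / (8 * real m)"
  proof (cases "norm w \<le> 1")
    case False
    have uu: "u * cnj u = 1" using u by (simp flip: complex_norm_square)
    then have "u = 1 / cnj u" using u0 by (simp add: field_simps)
    then have "1 / cnj w - u = 1 / cnj w - 1 / cnj u" by (rule arg_cong)
    also have "\<dots> = (cnj u - cnj w) / (cnj w * cnj u)"
      using w0 u0 by (simp add: diff_frac_eq)
    finally have "norm (1 / cnj w - u) = norm ((cnj u - cnj w) / (cnj w * cnj u))" by simp
    also have "\<dots> = norm (w - u) / norm w"
      by (simp add: norm_divide norm_mult u norm_minus_commute[of w u] flip: complex_cnj_diff)
    also have "\<dots> \<le> norm (w - u) / 1" using False by (intro divide_left_mono) auto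
    finally show ?thesis using w False by (simp add: v_def)
  qed (use w in \<open>simp add: v_def\<close>)
  define w' where "w' = of_real r * v"
  have "norm (w' - of_real r * u) = r * norm (v - u)"
    using r by (simp add: w'_def norm_mult flip: right_diff_distrib)
  also have "\<dots> \<le> 1 * norm (v - u)" using r by (intro mult_right_mono) auto
  finally have w'u: "norm (w' - of_real r * u) \<le> 1 / (8 * real m)" using vu by simp
  have w'1: "norm w' < 1"
    using mult_mono[of r r "norm v" 1] r v1 by (simp add: w'_def norm_mult)
  \<comment> \<open>\<open>(1 + r) / 2 = 1 - 1 / (2 m)\<close>, and Bernoulli's inequality makes its
    \<open>m\<close>-th power at least 1/2.\<close>
  have half: "1 / 2 \<le> ((1 + r) / 2) ^ degree Q"
  proof -
    have "1 / 2 = 1 + real m * (- 1 / (2 * real m))" using m by (simp add: field_simps)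
    also have "\<dots> \<le> (1 + - 1 / (2 * real m)) ^ m" by (rule Bernoulli_inequality) (use m in \<open>auto simp: field_simps\<close>)
    also have "1 + - 1 / (2 * real m) = (1 + r) / 2" using m by (simp add: r_def field_simps)
    also have "((1 + r) / 2) ^ m \<le> ((1 + r) / 2) ^ degree Q" using r Q by (intro power_decreasing) auto
    finally show ?thesis .
  qed
  have two: "norm w ^ degree Q \<le> 2" if "norm w \<ge> 1"
  proof -
    have "norm w ^ degree Q \<le> norm w ^ m" using that Q by (intro power_increasing) auto
    also have "\<dots> \<le> (1 + 1 / (8 * real m)) ^ m"
      using \<open>norm w \<le> 1 + _\<close> by (intro power_mono) auto
    also have "\<dots> \<le> exp (1 / (8 * real m)) ^ m" by (intro power_mono exp_ge_add_one_self) auto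
    also have "\<dots> = exp (1 / 8)" using m by (simp flip: exp_of_nat_mult)
    also have "\<dots> \<le> 1 + 1 / 8 + (1 / 8)\<^sup>2" by (rule exp_bound) auto
    finally show ?thesis by (simp add: power2_eq_square)
  qed
  have "norm (poly Q w) \<le> 2 * norm (poly G v)"
  proof (cases "norm w \<le> 1")
    case False
    then have "norm (poly Q w) \<le> norm w ^ degree Q * norm (poly G (1 / cnj w))" using G4 by simp
    also have "\<dots> \<le> 2 * norm (poly G (1 / cnj w))" using two False by (intro mult_right_mono) auto
    finally show ?thesis using False by (simp add: v_def)
  next
    case True
    have "norm (poly Q w) \<le> norm (poly G w)" using G3 True by blast
    then show ?thesis using True norm_ge_zero[of "poly G w"] by (simp add: v_def del: norm_ge_zero)
  qed
  moreover have "1 / 2 * norm (poly G v) \<le> norm (poly G w')"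
    using G5[OF v1 r(1)] r half mult_right_mono[OF half, of "norm (poly G v)"] by (simp add: w'_def)
  ultimately have QG: "norm (poly Q w) \<le> 4 * norm (poly G w')" by simp
  show ?thesis
  proof (intro exI[of _ w'] conjI allI impI w'u)
    fix p :: real and S :: "complex \<Rightarrow> complex"
    assume p: "p > 0" and S: "S holomorphic_on UNIV"
    let ?F = "\<lambda>t. norm (poly Q (unit_circle t)) powr p * norm (S (unit_circle t))"
    have cF: "continuous_on {0..1} ?F"
    proof -
      have "continuous_on UNIV S" using S by (rule holomorphic_on_imp_continuous_on)
      then have "continuous_on {0..1} (\<lambda>t. S (unit_circle t))"
        by (rule continuous_on_compose2) (auto intro!: continuous_intros)
      then show ?thesis using p by (intro continuous_intros continuous_on_powr') auto
    qed
    have nr: "norm (of_real r * u) = r" using r u by (simp add: norm_mult)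
    \<comment> \<open>The choice \<open>1 - r = 1 / m\<close> makes the distance to the circle 8
      times the tolerance \<open>1 / (8 m)\<close>, as the kernel comparison requires.\<close>
    have le: "norm (w' - of_real r * u) \<le> (1 - r) / 8" using w'u m by (simp add: r_def)
    have "norm (poly Q w) powr p * norm (S w') \<le> (4 * norm (poly G w')) powr p * norm (S w')"
      using QG p by (intro mult_right_mono powr_mono2) auto
    also have "\<dots> = 4 powr p * (norm (poly G w') powr p * norm (S w'))" by (simp add: powr_mult)
    also have "\<dots> \<le> 4 powr p * integral {0..1} (\<lambda>t. poisson w' (unit_circle t) * ?F t)"
    proof (intro mult_left_mono)
      have "norm (poly G w') powr p * norm (S w') \<le> integral {0..1} (\<lambda>t. poisson w' (unit_circle t) *
          (norm (poly G (unit_circle t)) powr p * norm (S (unit_circle t))))"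
        by (rule zero_free_powr_le_Poisson) (use S p w'1 G1 in \<open>auto intro!: holomorphic_intros\<close>)
      then show "norm (poly G w') powr p * norm (S w') \<le> integral {0..1} (\<lambda>t. poisson w' (unit_circle t) * ?F t)"
        by (simp add: G2)
    qed simp
    also have "\<dots> \<le> 4 powr p * integral {0..1} (\<lambda>t. 3 * (poisson (of_real r * u) (unit_circle t) * ?F t))"
    proof (intro mult_left_mono integral_le)
      show "(\<lambda>t. poisson w' (unit_circle t) * ?F t) integrable_on {0..1}"
        by (intro integrable_continuous_interval continuous_on_mult continuous_on_poisson cF w'1)
      show "(\<lambda>t. 3 * (poisson (of_real r * u) (unit_circle t) * ?F t)) integrable_on {0..1}"
        by (intro integrable_continuous_interval continuous_on_mult continuous_on_poisson cF continuous_on_const) (use nr r in auto)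
      fix t :: real
      have "poisson w' (unit_circle t) * ?F t \<le> (3 * poisson (of_real r * u) (unit_circle t)) * ?F t"
        by (intro mult_right_mono poisson_near_le[OF nr r le]) auto
      then show "poisson w' (unit_circle t) * ?F t \<le> 3 * (poisson (of_real r * u) (unit_circle t) * ?F t)"
        by (simp only: mult.assoc)
    qed simp
    also have "\<dots> = 3 * 4 powr p * integral {0..1} (\<lambda>t. poisson (of_real r * u) (unit_circle t) * ?F t)"
      by simp
    finally show "norm (poly Q w) powr p * norm (S w') \<le> \<dots>" .
  qed
qed

section \<open>Local Bernstein inequalities on an interval\<close>

lemma unit_circle_add_inverse: "unit_circle t + 1 / unit_circle t = 2 * of_real (cos (2 * pi * t))"
proof -
  have "1 / unit_circle t = cis (- (2 * pi * t))"
    by (simp add: unit_circle_def cis_divide flip: cis_zero)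
  then show ?thesis by (simp add: unit_circle_def complex_eq_iff)
qed

lemma norm_one_minus_unit_circle_square: "norm (1 - (unit_circle t)\<^sup>2) = 2 * \<bar>sin (2 * pi * t)\<bar>"
proof -
  let ?a = "2 * pi * t"
  have u2: "(unit_circle t)\<^sup>2 = cis (2 * ?a)"
    unfolding unit_circle_def power2_eq_square cis_mult by (simp only: mult_2)
  have "(norm (1 - (unit_circle t)\<^sup>2))\<^sup>2 = (1 - cos (2 * ?a))\<^sup>2 + (sin (2 * ?a))\<^sup>2"
    unfolding u2 by (simp add: cmod_power2)
  also have "\<dots> = 2 - 2 * cos (2 * ?a)"
    using sin_cos_squared_add[of "2 * ?a"] by (simp add: power2_diff)
  also have "\<dots> = (2 * \<bar>sin ?a\<bar>)\<^sup>2"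
    unfolding cos_double_sin by (simp add: power_mult_distrib)
  finally show ?thesis by (rule power2_eq_imp_eq) auto
qed

text \<open>The two solutions \<open>w\<close> of \<open>w + 1 / w = 2 \<zeta>\<close> are the roots of a quadratic polynomial whose value
  at \<open>u = unit_circle t\<close> is \<open>2 u (cos (2 \<pi> t) - \<zeta>)\<close>.\<close>

lemma inverse_Joukowski_near_circle:
  fixes \<zeta> :: complex
  assumes N: "N \<ge> 1" and \<zeta>: "norm (\<zeta> - of_real (cos (2 * pi * t))) \<le> (\<bar>sin (2 * pi * t)\<bar> + 1 / real N) / (1024 * real N)"
  shows "\<exists>w. w \<noteq> 0 \<and> w + 1 / w = 2 * \<zeta> \<and> norm (w - unit_circle t) \<le> 1 / (16 * real N)"
proof -
  define u where "u = unit_circle t"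
  define \<sigma> where "\<sigma> = \<bar>sin (2 * pi * t)\<bar>"
  define \<epsilon> where "\<epsilon> = norm (\<zeta> - of_real (cos (2 * pi * t)))"
  have u: "norm u = 1" "u \<noteq> 0" by (auto simp: u_def unit_circle_def)
  obtain s where s: "s\<^sup>2 = \<zeta>\<^sup>2 - 1" using power2_csqrt by blast
  define w1 where "w1 = \<zeta> + s"
  define w2 where "w2 = \<zeta> - s"
  have ww: "w1 * w2 = 1" using s by (simp add: w1_def w2_def power2_eq_square algebra_simps)
  have ws: "w1 + w2 = 2 * \<zeta>" by (simp add: w1_def w2_def)
  have u2: "u * u + 1 = 2 * of_real (cos (2 * pi * t)) * u"
    using unit_circle_add_inverse[of t] u(2) unfolding u_def by (simp add: field_simps)
  have "(u - w1) * (u - w2) = u * u - (w1 + w2) * u + w1 * w2" by (simp add: algebra_simps)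
  also have "\<dots> = 2 * (of_real (cos (2 * pi * t)) - \<zeta>) * u"
    using u2 unfolding ws ww by (simp add: algebra_simps)
  finally have prod: "norm (u - w1) * norm (u - w2) = 2 * \<epsilon>"
    unfolding \<epsilon>_def by (metis mult.right_neutral norm_minus_commute norm_mult norm_numeral u(1))
  have "u - of_real (cos (2 * pi * t)) = \<i> * of_real (sin (2 * pi * t))"
    by (simp add: u_def unit_circle_def complex_eq_iff)
  then have e: "(u - w1) + (u - w2) = 2 * (\<i> * of_real (sin (2 * pi * t)) - (\<zeta> - of_real (cos (2 * pi * t))))"
    using ws by (simp add: algebra_simps)
  have "norm ((u - w1) + (u - w2)) \<ge> 2 * (\<sigma> - \<epsilon>)"
    using norm_triangle_ineq2[of "\<i> * of_real (sin (2 * pi * t))" "\<zeta> - of_real (cos (2 * pi * t))"]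
    unfolding e norm_mult[of 2] by (simp add: norm_mult \<sigma>_def \<epsilon>_def)
  then have sum: "2 * (\<sigma> - \<epsilon>) \<le> norm (u - w1) + norm (u - w2)"
    using norm_triangle_ineq[of "u - w1" "u - w2"] by linarith
  \<comment> \<open>Of two distances with product \<open>2 \<epsilon>\<close> the smaller is at most
    \<open>sqrt (2 \<epsilon>)\<close>, which suffices if \<open>\<sigma> \<le> 1 / N\<close>; here
    1024 enters as \<open>4 * 16 ^ 2\<close>. For larger \<open>\<sigma>\<close> the sum forces
    \<open>b \<ge> \<sigma> / 2\<close>, so that
    \<open>a \<le> 4 \<epsilon> / \<sigma>\<close>.\<close>
  have key: "a \<le> 1 / (16 * real N)"
    if ab: "0 \<le> a" "a \<le> b" "a * b = 2 * \<epsilon>" "2 * (\<sigma> - \<epsilon>) \<le> a + b" for a b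
  proof (cases "\<sigma> \<le> 1 / real N")
    case True
    have "a * a \<le> 2 * \<epsilon>" using ab mult_left_mono[of a b a] by simp
    also have "\<epsilon> \<le> (1 / real N + 1 / real N) / (1024 * real N)"
      using \<zeta> True N unfolding \<epsilon>_def[symmetric] \<sigma>_def[symmetric]
      by (elim order_trans) (intro divide_right_mono add_right_mono, auto)
    also have "2 * \<dots> = (1 / (16 * real N))\<^sup>2" by (simp add: power2_eq_square)
    finally show ?thesis by (intro power2_le_imp_le[of a]) (auto simp: power2_eq_square)
  next
    case False
    have N0: "real N > 0" using N by simp
    have "\<epsilon> \<le> (\<sigma> + \<sigma>) / (1024 * real N)"
      using \<zeta> False N0 unfolding \<epsilon>_def[symmetric] \<sigma>_def[symmetric]
      by (elim order_trans) (intro divide_right_mono add_left_mono, auto)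
    then have e: "\<epsilon> * real N \<le> \<sigma> / 512" using N0 by (simp add: field_simps)
    have "\<epsilon> * 1 \<le> \<epsilon> * real N" using N by (intro mult_left_mono) (auto simp: \<epsilon>_def)
    then have "\<epsilon> \<le> \<sigma> / 2" using e by (simp add: \<sigma>_def)
    then have "\<sigma> / 2 \<le> b" using ab by simp
    have "a * (\<sigma> / 2) * real N \<le> a * b * real N"
      using \<open>\<sigma> / 2 \<le> b\<close> ab(1) by (intro mult_right_mono mult_left_mono) auto
    also have "\<dots> = 2 * (\<epsilon> * real N)" using ab(3) by simp
    also have "\<dots> \<le> \<sigma> / 256" using e by simp
    finally have "\<sigma> * (a * real N) \<le> \<sigma> * (1 / 128)" by (simp add: mult_ac)
    moreover have "\<sigma> > 0" using False N0 by (smt (verit) divide_pos_pos)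
    ultimately have "a * real N \<le> 1 / 128" by (metis mult_le_cancel_left_pos)
    then show ?thesis using N0 by (simp add: field_simps)
  qed
  have nz: "w1 \<noteq> 0" "w2 \<noteq> 0" using ww by auto
  have inv: "1 / w1 = w2" "1 / w2 = w1" using ww nz by (auto simp: field_simps)
  show ?thesis
  proof (cases "norm (u - w1) \<le> norm (u - w2)")
    case True
    then have "norm (u - w1) \<le> 1 / (16 * real N)" using key[OF _ _ prod sum] by simp
    then show ?thesis using nz inv ws
      by (intro exI[of _ w1]) (auto simp: u_def norm_minus_commute)
  next
    case False
    then have "norm (u - w2) \<le> 1 / (16 * real N)"
      using key[of "norm (u - w2)" "norm (u - w1)"] prod sum by (simp add: mult.commute)
    then show ?thesis using nz inv ws
      by (intro exI[of _ w2]) (auto simp: u_def norm_minus_commute add.commute)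
  qed
qed

text \<open>The factor \<open>w ^ N\<close> clears the negative powers of \<open>w\<close>. It has
  modulus 1 on the circle, so there \<open>R\<close> has the same modulus as \<open>Q\<close> at the
  corresponding cosine.\<close>

lemma Joukowski_poly:
  fixes Q :: "complex poly"
  assumes "degree Q \<le> N"
  obtains R :: "complex poly" where "degree R \<le> 2 * N"
    and "\<And>w. w \<noteq> 0 \<Longrightarrow> poly R w = w ^ N * poly Q ((w + 1 / w) / 2)"
proof
  define R where "R = (\<Sum>i\<le>N. smult (coeff Q i / 2 ^ i) ([:1, 0, 1:] ^ i * monom 1 (N - i)))"
  have d: "degree (smult (coeff Q i / 2 ^ i) ([:1, 0, 1:] ^ i * monom 1 (N - i))) \<le> 2 * N" if "i \<le> N" for i
  proof -
    have "degree ([:1, 0, 1:] ^ i * monom (1::complex) (N - i)) \<le> degree ([:1, 0, 1:] ^ i :: complex poly) + (N - i)"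
      by (rule order_trans[OF degree_mult_le]) (simp add: degree_monom_eq)
    moreover have "degree ([:1, 0, 1:] ^ i :: complex poly) \<le> 2 * i"
      by (rule order_trans[OF degree_power_le]) (simp add: numeral_2_eq_2)
    ultimately have "degree ([:1, 0, 1:] ^ i * monom (1::complex) (N - i)) \<le> 2 * N" using that by linarith
    then show ?thesis by (rule order_trans[OF degree_smult_le])
  qed
  show "degree R \<le> 2 * N" unfolding R_def by (intro degree_sum_le d) auto
  fix w :: complex assume w: "w \<noteq> 0"
  have Q: "poly Q z = (\<Sum>i\<le>N. coeff Q i * z ^ i)" for z
    using poly_altdef[of Q z] assms
    by (auto intro!: sum.mono_neutral_left le_degree)
  have "coeff Q i / 2 ^ i * ((1 + w * w) ^ i * w ^ (N - i)) = w ^ N * (coeff Q i * ((w + 1 / w) / 2) ^ i)"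
    if "i \<le> N" for i
  proof -
    have "w ^ N = w ^ i * w ^ (N - i)" using that by (simp flip: power_add)
    moreover have "w * ((w + 1 / w) / 2) = (1 + w * w) / 2" using w by (simp add: field_simps)
    then have "w ^ i * ((w + 1 / w) / 2) ^ i = ((1 + w * w) / 2) ^ i"
      by (simp only: power_mult_distrib[symmetric])
    ultimately show ?thesis by (simp add: power_divide mult_ac)
  qed
  then show "poly R w = w ^ N * poly Q ((w + 1 / w) / 2)"
    unfolding Q R_def poly_sum sum_distrib_left by (intro sum.cong) (auto simp: poly_monom)
qed

text \<open>\<open>2 * N\<close> bounds the degree of the polynomial on the circle obtained by the
  Joukowski substitution, and the centre of the kernel sits at distance \<open>1 / (2 * N)\<close>
  from the circle.\<close>

definition cos_kernel :: "nat \<Rightarrow> real \<Rightarrow> real \<Rightarrow> real" where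
  "cos_kernel N t\<^sub>0 t = poisson (of_real (1 - 1 / (2 * real N)) * unit_circle t\<^sub>0) (unit_circle t)"

lemma norm_cos_kernel_center:
  assumes "N \<ge> 1"
  shows "norm (of_real (1 - 1 / (2 * real N)) * unit_circle t) < 1"
  using assms by (simp add: norm_mult del: of_real_diff)

lemma cos_kernel_nonneg: "N \<ge> 1 \<Longrightarrow> 0 \<le> cos_kernel N t\<^sub>0 t"
  unfolding cos_kernel_def by (intro poisson_nonneg norm_cos_kernel_center)

lemma has_integral_cos_kernel: "N \<ge> 1 \<Longrightarrow> ((\<lambda>t. cos_kernel N t\<^sub>0 t) has_integral 1) {0..1}"
  unfolding cos_kernel_def by (intro has_integral_poisson norm_cos_kernel_center)

lemma continuous_on_cos_kernel: "N \<ge> 1 \<Longrightarrow> continuous_on A (\<lambda>t. cos_kernel N t\<^sub>0 t)"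
  unfolding cos_kernel_def by (intro continuous_on_poisson norm_cos_kernel_center)

text \<open>By this symmetry the kernel also has mass one in its first angle, that is, when the
  evaluation point is integrated.\<close>

lemma cos_kernel_commute: "cos_kernel N s t = cos_kernel N t s"
proof -
  have "norm (unit_circle t - of_real r * unit_circle s) = norm (unit_circle s - of_real r * unit_circle t)" for r
  proof (rule power2_eq_imp_eq)
    show "(norm (unit_circle t - of_real r * unit_circle s))\<^sup>2 = (norm (unit_circle s - of_real r * unit_circle t))\<^sup>2"
    proof -
      have "(c - r * a)\<^sup>2 + (d - r * b)\<^sup>2 = (a - r * c)\<^sup>2 + (b - r * d)\<^sup>2"
        if "c\<^sup>2 + d\<^sup>2 = 1" "a\<^sup>2 + b\<^sup>2 = (1::real)" for a b c d
        using that by algebra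
      from this[of "cos (2 * pi * t)" "sin (2 * pi * t)" "cos (2 * pi * s)" "sin (2 * pi * s)"]
      show ?thesis by (simp add: unit_circle_def cmod_power2)
    qed
  qed auto
  then show ?thesis by (simp only: cos_kernel_def poisson_def norm_mult norm_unit_circle)
qed

text \<open>The weighted bound comes from the holomorphic factor \<open>1 - z\<^sup>2\<close>, of modulus \<open>2 \<bar>sin\<bar>\<close> on the circle; at the
  interior point where it is evaluated it is still bounded below by a multiple of \<open>\<bar>sin\<bar> + 1 / N\<close>.\<close>

lemma Bernstein_kernel_bound:
  fixes Q :: "complex poly" and \<zeta> :: complex
  assumes Q: "degree Q \<le> N" and N: "N \<ge> 1" and p: "p > 0"
    and \<zeta>: "norm (\<zeta> - of_real (cos (2 * pi * t\<^sub>0))) \<le> (\<bar>sin (2 * pi * t\<^sub>0)\<bar> + 1 / real N) / (1024 * real N)"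
  shows "norm (poly Q \<zeta>) powr p \<le> 3 * 8 powr p * integral {0..1} (\<lambda>t.
           cos_kernel N t\<^sub>0 t * norm (poly Q (of_real (cos (2 * pi * t)))) powr p)"
    and "norm (poly Q \<zeta>) powr p * (\<bar>sin (2 * pi * t\<^sub>0)\<bar> + 1 / real N) \<le> 36 * 8 powr p * integral {0..1} (\<lambda>t.
           cos_kernel N t\<^sub>0 t * (norm (poly Q (of_real (cos (2 * pi * t)))) powr p * \<bar>sin (2 * pi * t)\<bar>))"
proof -
  obtain w where w0: "w \<noteq> 0" and w: "w + 1 / w = 2 * \<zeta>" and wu: "norm (w - unit_circle t\<^sub>0) \<le> 1 / (16 * real N)"
    using inverse_Joukowski_near_circle[OF N \<zeta>] by blast
  obtain R where dR: "degree R \<le> 2 * N" and R: "\<And>w. w \<noteq> 0 \<Longrightarrow> poly R w = w ^ N * poly Q ((w + 1 / w) / 2)"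
    using Joukowski_poly[OF Q] by blast
  define r where "r = 1 - 1 / (2 * real N)"
  define u where "u = unit_circle t\<^sub>0"
  obtain w' where w'u: "norm (w' - of_real r * u) \<le> 1 / (16 * real N)" and
    B: "\<And>S. S holomorphic_on UNIV \<Longrightarrow> norm (poly R w) powr p * norm (S w') \<le> 3 * 4 powr p * integral {0..1} (\<lambda>t.
        poisson (of_real r * u) (unit_circle t) * (norm (poly R (unit_circle t)) powr p * norm (S (unit_circle t))))"
    using poly_near_circle_bound[OF dR _ _ , of "unit_circle t\<^sub>0" w] N wu p
    by (auto simp: r_def u_def)
  have Rc: "norm (poly R (unit_circle t)) = norm (poly Q (of_real (cos (2 * pi * t))))" for t
  proof -
    have "unit_circle t \<noteq> 0" by (metis norm_unit_circle norm_zero zero_neq_one)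
    from R[OF this] show ?thesis by (simp add: norm_mult norm_power unit_circle_add_inverse)
  qed
  have "norm w \<ge> 1 - 1 / (16 * real N)"
    using norm_triangle_ineq2[of "unit_circle t\<^sub>0" w] wu by (simp add: norm_minus_commute)
  \<comment> \<open>\<open>norm w\<close> is close enough to 1 for its \<open>N\<close>-th power to
    be at least 1/2. The resulting \<open>2 powr p\<close> and the earlier \<open>4 powr p\<close>
    make \<open>8 powr p\<close>.\<close>
  have "1 / 2 \<le> 1 + real N * (- 1 / (16 * real N))" using N by (simp add: field_simps)
  also have "\<dots> \<le> (1 + - 1 / (16 * real N)) ^ N"
    by (rule Bernoulli_inequality) (use N in \<open>auto simp: field_simps\<close>)
  also have "\<dots> \<le> norm w ^ N"
    using \<open>norm w \<ge> _\<close> N by (intro power_mono) (auto simp: field_simps)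
  finally have half: "1 / 2 \<le> norm w ^ N" .
  have "norm (poly R w) = norm w ^ N * norm (poly Q \<zeta>)" using R[OF w0] w by (simp add: norm_mult norm_power)
  then have QR: "norm (poly Q \<zeta>) \<le> 2 * norm (poly R w)"
    using mult_right_mono[OF half, of "norm (poly Q \<zeta>)"] by simp
  have QRp: "norm (poly Q \<zeta>) powr p \<le> 2 powr p * norm (poly R w) powr p"
    using QR p powr_mono2[of p "norm (poly Q \<zeta>)" "2 * norm (poly R w)"] by (simp add: powr_mult)
  have e8: "2 powr p * 4 powr p = (8::real) powr p" by (simp flip: powr_mult)
  have mult: "norm (poly Q \<zeta>) powr p * norm (S w') \<le> 3 * 8 powr p * integral {0..1} (\<lambda>t.
        cos_kernel N t\<^sub>0 t * (norm (poly Q (of_real (cos (2 * pi * t)))) powr p * norm (S (unit_circle t))))"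
    if "S holomorphic_on UNIV" for S
  proof -
    have "norm (poly Q \<zeta>) powr p * norm (S w') \<le> 2 powr p * (norm (poly R w) powr p * norm (S w'))"
      using mult_right_mono[OF QRp, of "norm (S w')"] by (simp add: mult.assoc)
    also have "\<dots> \<le> 2 powr p * (3 * 4 powr p * integral {0..1} (\<lambda>t.
        poisson (of_real r * u) (unit_circle t) * (norm (poly R (unit_circle t)) powr p * norm (S (unit_circle t)))))"
      using B[OF that] by (intro mult_left_mono) auto
    also have "\<dots> = 3 * (2 powr p * 4 powr p) * integral {0..1} (\<lambda>t.
        poisson (of_real r * u) (unit_circle t) * (norm (poly R (unit_circle t)) powr p * norm (S (unit_circle t))))"
      by (simp only: mult_ac)
    finally show ?thesis unfolding Rc e8 cos_kernel_def r_def u_def .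
  qed
  from mult[of "\<lambda>_. 1"] show "norm (poly Q \<zeta>) powr p \<le> 3 * 8 powr p * integral {0..1} (\<lambda>t.
           cos_kernel N t\<^sub>0 t * norm (poly Q (of_real (cos (2 * pi * t)))) powr p)" by simp
  define \<sigma> where "\<sigma> = \<bar>sin (2 * pi * t\<^sub>0)\<bar>"
  \<comment> \<open>The factor \<open>1 - z\<^sup>2\<close> is bounded below at the kernel centre
    \<open>r u\<close> first, against both \<open>\<sigma>\<close> and \<open>1 / N\<close>. The
    bound is then passed on to \<open>w'\<close>, whose square differs from that of the centre by at
    most \<open>1 / (8 N)\<close>.\<close>
  define X where "X = norm (1 - of_real (r\<^sup>2) * u\<^sup>2)"
  have r: "1 / 2 \<le> r" "r < 1" using N by (auto simp: r_def)
  have r2: "0 \<le> r\<^sup>2" "r\<^sup>2 \<le> r" using r by (auto simp: power2_eq_square mult_left_le)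
  have nu: "norm (u\<^sup>2) = 1" by (simp add: u_def norm_power)
  have "(1 + r\<^sup>2) / 2 * norm (1 - u\<^sup>2) \<le> X"
    unfolding X_def by (rule norm_one_minus_dilation) (use nu r r2 in auto)
  moreover have "1 / 2 * norm (1 - u\<^sup>2) \<le> (1 + r\<^sup>2) / 2 * norm (1 - u\<^sup>2)" by (intro mult_right_mono) auto
  moreover have "norm (1 - u\<^sup>2) = 2 * \<sigma>" unfolding u_def \<sigma>_def by (rule norm_one_minus_unit_circle_square)
  ultimately have X1: "\<sigma> \<le> X" by simp
  have "1 - r\<^sup>2 \<le> X"
    using norm_triangle_ineq2[of 1 "of_real (r\<^sup>2) * u\<^sup>2"] nu unfolding X_def by (simp add: norm_mult norm_power)
  then have X2: "1 / (2 * real N) \<le> X" using r2 by (simp add: r_def)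
  have nru: "norm (of_real r * u) = r" using r by (simp add: norm_mult u_def)
  have "norm w' \<le> norm (of_real r * u) + norm (w' - of_real r * u)" using norm_triangle_sub by blast
  also have "\<dots> \<le> 1" using w'u N by (simp add: nru) (simp add: r_def field_simps)
  finally have w'1: "norm w' \<le> 1" .
  have "w'\<^sup>2 - of_real (r\<^sup>2) * u\<^sup>2 = (w' - of_real r * u) * (w' + of_real r * u)"
    by (simp add: power2_eq_square algebra_simps)
  then have "norm (w'\<^sup>2 - of_real (r\<^sup>2) * u\<^sup>2) = norm (w' - of_real r * u) * norm (w' + of_real r * u)"
    by (simp add: norm_mult)
  also have "\<dots> \<le> 1 / (16 * real N) * 2"
    using w'u w'1 nru r norm_triangle_ineq[of w' "of_real r * u"] by (intro mult_mono) auto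
  finally have "norm (w'\<^sup>2 - of_real (r\<^sup>2) * u\<^sup>2) \<le> 1 / (8 * real N)" by simp
  then have Y: "X - 1 / (8 * real N) \<le> norm (1 - w'\<^sup>2)"
    using norm_triangle_ineq2[of "1 - of_real (r\<^sup>2) * u\<^sup>2" "w'\<^sup>2 - of_real (r\<^sup>2) * u\<^sup>2"] unfolding X_def by simp
  define q where "q = 1 / real N"
  have q: "1 / (2 * real N) = q / 2" "1 / (8 * real N) = q / 8" "0 \<le> q" by (auto simp: q_def)
  have S6: "\<sigma> + 1 / real N \<le> 6 * norm (1 - w'\<^sup>2)"
    using X1 X2 Y q(3) unfolding q(1,2) q_def[symmetric] by linarith
  \<comment> \<open>The final constant is \<open>36 = 6 * 3 * 2\<close>, where 2 is the factor of
    \<open>\<bar>sin\<bar>\<close> in the modulus of \<open>1 - z\<^sup>2\<close> on the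
    circle.\<close>
  have "norm (poly Q \<zeta>) powr p * (\<sigma> + 1 / real N) \<le> 6 * (norm (poly Q \<zeta>) powr p * norm (1 - w'\<^sup>2))"
    using mult_left_mono[OF S6, of "norm (poly Q \<zeta>) powr p"] by simp
  also have "\<dots> \<le> 6 * (3 * 8 powr p * integral {0..1} (\<lambda>t. cos_kernel N t\<^sub>0 t *
      (norm (poly Q (of_real (cos (2 * pi * t)))) powr p * norm (1 - (unit_circle t)\<^sup>2))))"
    by (intro mult_left_mono mult) (auto intro!: holomorphic_intros)
  also have "\<dots> = 6 * (3 * 8 powr p * integral {0..1} (\<lambda>t. 2 * (cos_kernel N t\<^sub>0 t *
      (norm (poly Q (of_real (cos (2 * pi * t)))) powr p * \<bar>sin (2 * pi * t)\<bar>))))"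
    by (simp only: norm_one_minus_unit_circle_square) (simp add: mult_ac)
  also have "\<dots> = 36 * 8 powr p * integral {0..1} (\<lambda>t.
           cos_kernel N t\<^sub>0 t * (norm (poly Q (of_real (cos (2 * pi * t)))) powr p * \<bar>sin (2 * pi * t)\<bar>))"
    by simp
  finally show "norm (poly Q \<zeta>) powr p * (\<bar>sin (2 * pi * t\<^sub>0)\<bar> + 1 / real N) \<le> \<dots>"
    unfolding \<sigma>_def .
qed

section \<open>Complexified polynomials\<close>

text \<open>Polynomial functions in complex variables indexed by an arbitrary type, with a degree
  bound carried along. The index type varies: basis vectors of the space, parameters in a chart,
  disjoint sums of blocks of variables. No normal form of coefficients is fixed, and closure
  properties are inductions.\<close>

inductive cpoly :: "nat \<Rightarrow> (('i \<Rightarrow> complex) \<Rightarrow> complex) \<Rightarrow> bool" where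
  const: "cpoly n (\<lambda>\<zeta>. a)"
| var: "n \<ge> 1 \<Longrightarrow> cpoly n (\<lambda>\<zeta>. \<zeta> i)"
| add: "cpoly n F \<Longrightarrow> cpoly n G \<Longrightarrow> cpoly n (\<lambda>\<zeta>. F \<zeta> + G \<zeta>)"
| mult: "cpoly m F \<Longrightarrow> cpoly n G \<Longrightarrow> m + n \<le> k \<Longrightarrow> cpoly k (\<lambda>\<zeta>. F \<zeta> * G \<zeta>)"

lemma cpoly_mono: "cpoly m F \<Longrightarrow> m \<le> n \<Longrightarrow> cpoly n F"
  by (induction arbitrary: n rule: cpoly.induct) (force intro: cpoly.intros)+

lemma cpoly_sum: "(\<And>x. x \<in> A \<Longrightarrow> cpoly n (F x)) \<Longrightarrow> cpoly n (\<lambda>\<zeta>. \<Sum>x\<in>A. F x \<zeta>)"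
  by (induction A rule: infinite_finite_induct) (auto intro: cpoly.intros)

lemma cpoly_power: "cpoly m F \<Longrightarrow> m * k \<le> n \<Longrightarrow> cpoly n (\<lambda>\<zeta>. F \<zeta> ^ k)"
proof (induction k arbitrary: n)
  case (Suc k)
  have "cpoly (m * k) (\<lambda>\<zeta>. F \<zeta> ^ k)" by (rule Suc.IH[OF Suc.prems(1)]) simp
  from cpoly.mult[OF Suc.prems(1) this, of n] Suc.prems(2) show ?case by simp
qed (auto intro: cpoly.intros)

lemma cpoly_prod:
  assumes "finite A" and "\<And>x. x \<in> A \<Longrightarrow> cpoly (d x) (F x)" and "(\<Sum>x\<in>A. d x) \<le> n"
  shows "cpoly n (\<lambda>\<zeta>. \<Prod>x\<in>A. F x \<zeta>)"
  using assms
proof (induction A arbitrary: n rule: finite_induct)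
  case (insert a A)
  have "cpoly (\<Sum>x\<in>A. d x) (\<lambda>\<zeta>. \<Prod>x\<in>A. F x \<zeta>)" using insert.prems(1) by (intro insert.IH) auto
  from cpoly.mult[OF _ this, of "d a" "F a" n] insert show ?case by simp
qed (auto intro: cpoly.intros)

lemma cpoly_compose:
  assumes "cpoly n F" and "\<And>i. cpoly m (G i)"
  shows "cpoly (n * m) (\<lambda>\<zeta>. F (\<lambda>i. G i \<zeta>))"
  using assms(1)
proof (induction rule: cpoly.induct)
  case (var n i)
  then have "m \<le> n * m" by (cases n) auto
  then show ?case by (rule cpoly_mono[OF assms(2)])
next
  case (mult m' F n' G' k)
  have "m' * m + n' * m \<le> k * m" using mult.hyps(3) by (metis add_mult_distrib mult_le_mono1)
  with mult show ?case by (intro cpoly.mult[of "m' * m" _ "n' * m"])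
next
  case (const n a)
  show ?case by (rule cpoly.const)
next
  case (add n F G)
  then show ?case by (intro cpoly.add)
qed

text \<open>Restriction to a polynomial curve produces a genuine \<open>complex poly\<close>, the
  form in which the one-variable inequalities apply.\<close>

lemma cpoly_univariate:
  fixes F :: "('i \<Rightarrow> complex) \<Rightarrow> complex"
  assumes "cpoly n F" and "\<And>i. \<exists>q. degree q \<le> m \<and> (\<forall>z. g i z = poly q z)"
  shows "\<exists>Q. degree Q \<le> n * m \<and> (\<forall>z. F (\<lambda>i. g i z) = poly Q z)"
  using assms(1)
proof (induction rule: cpoly.induct)
  case (const n a)
  then show ?case by (intro exI[of _ "[:a:]"]) auto
next
  case (var n i)
  then have "m \<le> n * m" by (cases n) auto
  moreover from assms(2)[of i] obtain q where "degree q \<le> m" "\<forall>z. g i z = poly q z" by blast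
  ultimately show ?case by (intro exI[of _ q] conjI) (rule order_trans, auto)
next
  case (add n F G)
  then obtain P Q where "degree P \<le> n * m" "degree Q \<le> n * m"
    "\<forall>z. F (\<lambda>i. g i z) = poly P z" "\<forall>z. G (\<lambda>i. g i z) = poly Q z" by blast
  then show ?case by (intro exI[of _ "P + Q"]) (auto intro: degree_add_le)
next
  case (mult m' F n' G k)
  then obtain P Q where "degree P \<le> m' * m" "degree Q \<le> n' * m"
    and PQ: "\<forall>z. F (\<lambda>i. g i z) = poly P z" "\<forall>z. G (\<lambda>i. g i z) = poly Q z" by blast
  moreover have "m' * m + n' * m \<le> k * m" using mult.hyps(3) by (metis add_mult_distrib mult_le_mono1)
  ultimately have "degree (P * Q) \<le> k * m" using degree_mult_le[of P Q] by linarith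
  with PQ show ?case by (intro exI[of _ "P * Q"]) auto
qed

lemma cpoly_measurable:
  assumes "cpoly n F" and "\<And>i. (\<lambda>x. g i x) \<in> borel_measurable M"
  shows "(\<lambda>x. F (\<lambda>i. g i x)) \<in> borel_measurable M"
  using assms(1) by (induction rule: cpoly.induct) (use assms(2) in auto)

lemma cpoly_continuous:
  assumes "cpoly n F" and "\<And>i. continuous_on A (\<lambda>x. g i x)"
  shows "continuous_on A (\<lambda>x. F (\<lambda>i. g i x))"
  using assms(1) by (induction rule: cpoly.induct) (use assms(2) in \<open>auto intro!: continuous_intros\<close>)

lemma cpoly_holomorphic_line:
  assumes "cpoly n F"
  shows "(\<lambda>z. F (\<lambda>i. \<zeta> i + z * v i)) holomorphic_on UNIV"
proof -
  have "\<exists>q. degree q \<le> 1 \<and> (\<forall>z. \<zeta> i + z * v i = poly q z)" for i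
    by (rule exI[of _ "[:\<zeta> i, v i:]"]) auto
  from cpoly_univariate[where g = "\<lambda>i z. \<zeta> i + z * v i", OF assms this] obtain Q where "\<And>z. F (\<lambda>i. \<zeta> i + z * v i) = poly Q z"
    by blast
  then show ?thesis by (auto intro!: holomorphic_intros)
qed

text \<open>The derivative along a complex line is taken with the one-variable \<open>deriv\<close>,
  so no norm on the space of assignments enters.\<close>

definition cderiv :: "('i \<Rightarrow> complex) \<Rightarrow> (('i \<Rightarrow> complex) \<Rightarrow> complex) \<Rightarrow> ('i \<Rightarrow> complex) \<Rightarrow> complex" where
  "cderiv v F \<zeta> = deriv (\<lambda>z. F (\<lambda>i. \<zeta> i + z * v i)) 0"

lemma cpoly_field_differentiable_line:
  "cpoly n F \<Longrightarrow> (\<lambda>z. F (\<lambda>i. \<zeta> i + z * v i)) field_differentiable at x"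
  using cpoly_holomorphic_line[of n F \<zeta> v] by (simp add: holomorphic_on_def)

lemma cderiv_simps:
  shows "cderiv v (\<lambda>\<zeta>. a) = (\<lambda>\<zeta>. 0)"
    and "cderiv v (\<lambda>\<zeta>. \<zeta> i) = (\<lambda>\<zeta>. v i)"
    and "cpoly m F \<Longrightarrow> cpoly n G \<Longrightarrow> cderiv v (\<lambda>\<zeta>. F \<zeta> + G \<zeta>) = (\<lambda>\<zeta>. cderiv v F \<zeta> + cderiv v G \<zeta>)"
    and "cpoly m F \<Longrightarrow> cpoly n G \<Longrightarrow> cderiv v (\<lambda>\<zeta>. F \<zeta> * G \<zeta>) = (\<lambda>\<zeta>. F \<zeta> * cderiv v G \<zeta> + cderiv v F \<zeta> * G \<zeta>)"
proof -
  have "((\<lambda>z. \<zeta> i + z * v i) has_field_derivative v i) (at 0)" for \<zeta>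
    by (auto intro!: derivative_eq_intros)
  then show "cderiv v (\<lambda>\<zeta>. \<zeta> i) = (\<lambda>\<zeta>. v i)" unfolding cderiv_def by (auto intro!: DERIV_imp_deriv)
qed (auto simp: cderiv_def fun_eq_iff cpoly_field_differentiable_line)

lemma cpoly_cderiv: "cpoly n F \<Longrightarrow> cpoly n (cderiv v F)"
proof (induction rule: cpoly.induct)
  case (mult m F n G k)
  then show ?case unfolding cderiv_simps(4)[OF mult(1,2)] by (intro cpoly.add cpoly.mult[of _ _ _ _ k]) auto
qed (auto simp: cderiv_simps intro: cpoly.intros)

lemma cpoly_cderiv_funpow: "cpoly n F \<Longrightarrow> cpoly n ((cderiv v ^^ k) F)"
  by (induction k) (auto intro: cpoly_cderiv)

lemma cderiv_shift:
  "cderiv v F (\<lambda>i. \<zeta> i + z * v i) = deriv (\<lambda>z. F (\<lambda>i. \<zeta> i + z * v i)) z"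
  unfolding cderiv_def by (subst (2) deriv_shift_0) (simp add: o_def algebra_simps)

lemma cderiv_funpow_eq_deriv_funpow:
  "(cderiv v ^^ k) F (\<lambda>i. \<zeta> i + z * v i) = (deriv ^^ k) (\<lambda>z. F (\<lambda>i. \<zeta> i + z * v i)) z"
\<comment> \<open>The position on the line has to be arbitrary, as the induction step differentiates
  in it.\<close>
proof (induction k arbitrary: z)
  case (Suc k)
  have "(cderiv v ^^ Suc k) F (\<lambda>i. \<zeta> i + z * v i) = deriv (\<lambda>z. (cderiv v ^^ k) F (\<lambda>i. \<zeta> i + z * v i)) z"
    by (simp add: cderiv_shift)
  then show ?case by (simp add: Suc.IH)
qed simp

lemma cderiv_Cauchy:
  assumes F: "cpoly n F" and R: "R > 0" and X: "\<And>z. norm z \<le> R \<Longrightarrow> norm (F (\<lambda>i. \<zeta> i + z * v i)) \<le> X"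
  shows "norm ((cderiv v ^^ k) F \<zeta>) \<le> fact k * X / R ^ k"
proof -
  have h: "(\<lambda>z. F (\<lambda>i. \<zeta> i + z * v i)) holomorphic_on UNIV" by (rule cpoly_holomorphic_line[OF F])
  have "norm ((deriv ^^ k) (\<lambda>z. F (\<lambda>i. \<zeta> i + z * v i)) 0) \<le> fact k * X / R ^ k"
    by (rule Cauchy_inequality)
       (use R X in \<open>auto intro: holomorphic_on_subset[OF h] continuous_on_subset[OF holomorphic_on_imp_continuous_on[OF h]]\<close>)
  then show ?thesis using cderiv_funpow_eq_deriv_funpow[of k v F \<zeta> 0] by simp
qed

section \<open>Real polynomials and their complexification\<close>

definition ccoords :: "'a::euclidean_space \<Rightarrow> 'a \<Rightarrow> complex" where
  "ccoords x = (\<lambda>b. of_real (x \<bullet> b))"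

definition complexifies :: "(('a::euclidean_space \<Rightarrow> complex) \<Rightarrow> complex) \<Rightarrow> ('a \<Rightarrow> real) \<Rightarrow> bool" where
  "complexifies F f \<longleftrightarrow> (\<forall>x. of_real (f x) = F (ccoords x))"

lemma poly_of_degree_at_most_complexifies:
  assumes "poly_of_degree_at_most n f"
  shows "\<exists>F. cpoly n F \<and> complexifies F f"
proof -
  obtain c where f: "\<And>x. f x = (\<Sum>\<alpha> \<in> {\<alpha> \<in> Basis \<rightarrow>\<^sub>E {..n}. (\<Sum>b\<in>Basis. \<alpha> b) \<le> n}.
           c \<alpha> * (\<Prod>b\<in>Basis. (x \<bullet> b) ^ \<alpha> b))"
    using assms unfolding poly_of_degree_at_most_def by auto
  let ?F = "\<lambda>\<zeta>. \<Sum>\<alpha> \<in> {\<alpha> \<in> Basis \<rightarrow>\<^sub>E {..n}. (\<Sum>b\<in>Basis. \<alpha> b) \<le> n}.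
           of_real (c \<alpha>) * (\<Prod>b\<in>Basis. \<zeta> b ^ \<alpha> b)"
  have "cpoly n ?F"
    by (intro cpoly_sum cpoly.mult[OF cpoly.const[of 0]] cpoly_prod[where d = "\<lambda>b. _ b"])
       (auto intro!: cpoly_power cpoly.var[of 1])
  moreover have "complexifies ?F f" by (simp add: complexifies_def f ccoords_def)
  ultimately show ?thesis by blast
qed

lemma cpoly_has_derivative:
  assumes "cpoly n F"
  shows "((\<lambda>x. F (ccoords x)) has_derivative (\<lambda>v. cderiv (ccoords v) F (ccoords x))) (at x)"
  using assms
proof (induction rule: cpoly.induct)
  case (var n i)
  have "((\<lambda>x. ccoords x i) has_derivative (\<lambda>v. ccoords v i)) (at x)"
    unfolding ccoords_def by (auto intro!: derivative_eq_intros)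
  then show ?case by (simp add: cderiv_simps)
next
  case (add n F G)
  then show ?case by (auto simp: cderiv_simps intro: has_derivative_add)
next
  case (mult m F n G k)
  then show ?case unfolding cderiv_simps(4)[OF mult(1,2)] by (intro has_derivative_mult)
qed (auto simp: cderiv_simps)

lemma complexifies_has_derivative:
  assumes "cpoly n F" and "complexifies F f"
  shows "(f has_derivative (\<lambda>v. Re (cderiv (ccoords v) F (ccoords x)))) (at x)"
proof -
  have "((\<lambda>x. of_real (f x) :: complex) has_derivative (\<lambda>v. cderiv (ccoords v) F (ccoords x))) (at x)"
    using cpoly_has_derivative[OF assms(1)] assms(2) unfolding complexifies_def by simp
  from bounded_linear.has_derivative[OF bounded_linear_Re this] show ?thesis by simp
qed

text \<open>The derivative of \<open>f\<close>, viewed as a complex-valued map, is both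
  \<open>cderiv\<close> and the real part of \<open>cderiv\<close>. Uniqueness of derivatives shows
  that \<open>cderiv\<close> is real at real points in real directions.\<close>

lemma complexifies_dir_deriv:
  assumes "cpoly n F" and "complexifies F f"
  shows "complexifies (cderiv (ccoords v) F) (dir_deriv v f)"
  unfolding complexifies_def
proof
  fix x
  have "((\<lambda>x. of_real (f x) :: complex) has_derivative (\<lambda>v. cderiv (ccoords v) F (ccoords x))) (at x)"
    using cpoly_has_derivative[OF assms(1)] assms(2) unfolding complexifies_def by simp
  moreover have "((\<lambda>x. of_real (f x) :: complex) has_derivative
      (\<lambda>v. of_real (Re (cderiv (ccoords v) F (ccoords x))))) (at x)"
    by (rule bounded_linear.has_derivative[OF bounded_linear_of_real complexifies_has_derivative[OF assms]])
  ultimately have "(\<lambda>v. cderiv (ccoords v) F (ccoords x)) = (\<lambda>v. of_real (Re (cderiv (ccoords v) F (ccoords x))))"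
    by (rule has_derivative_unique)
  moreover have "dir_deriv v f x = Re (cderiv (ccoords v) F (ccoords x))"
    unfolding dir_deriv_def frechet_derivative_at[OF complexifies_has_derivative[OF assms], symmetric] ..
  ultimately show "of_real (dir_deriv v f x) = cderiv (ccoords v) F (ccoords x)" by metis
qed

lemma complexifies_dir_deriv_funpow:
  assumes "cpoly n F" and "complexifies F f"
  shows "complexifies ((cderiv (ccoords v) ^^ k) F) ((dir_deriv v ^^ k) f)"
  by (induction k) (auto simp: assms intro!: complexifies_dir_deriv[where n = n] cpoly_cderiv_funpow)

text \<open>Cauchy's inequality is used in the direction \<open>\<nu>\<close> at every point of the
  disc in the direction \<open>\<tau>\<close>, and then along \<open>\<tau>\<close>; hence the bound
  is assumed on the product of both discs.\<close>

lemma dir_deriv_Cauchy: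
  fixes \<tau> \<nu> :: "'a::euclidean_space"
  assumes F: "cpoly n F" and f: "complexifies F f" and R: "R1 > 0" "R2 > 0"
    and X: "\<And>z w. norm z \<le> R1 \<Longrightarrow> norm w \<le> R2 \<Longrightarrow>
      norm (F (\<lambda>b. ccoords \<xi> b + z * ccoords \<tau> b + w * ccoords \<nu> b)) \<le> X"
  shows "\<bar>(dir_deriv \<tau> ^^ r) ((dir_deriv \<nu> ^^ k) f) \<xi>\<bar> \<le> fact r * fact k * X / (R1 ^ r * R2 ^ k)"
proof -
  let ?G = "(cderiv (ccoords \<nu>) ^^ k) F"
  have G: "cpoly n ?G" using F by (rule cpoly_cderiv_funpow)
  have "complexifies ((cderiv (ccoords \<tau>) ^^ r) ?G) ((dir_deriv \<tau> ^^ r) ((dir_deriv \<nu> ^^ k) f))"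
    by (intro complexifies_dir_deriv_funpow[OF G] complexifies_dir_deriv_funpow[OF F f])
  then have "\<bar>(dir_deriv \<tau> ^^ r) ((dir_deriv \<nu> ^^ k) f) \<xi>\<bar> = norm ((cderiv (ccoords \<tau>) ^^ r) ?G (ccoords \<xi>))"
    unfolding complexifies_def by (metis norm_of_real)
  also have "\<dots> \<le> fact r * (fact k * X / R2 ^ k) / R1 ^ r"
    by (intro cderiv_Cauchy[OF G R(1)] cderiv_Cauchy[OF F R(2)] X)
  finally show ?thesis by (simp add: mult_ac)
qed

section \<open>Kernel averages\<close>

lemma borel_measurable_unit_circle [measurable]: "unit_circle \<in> borel_measurable borel"
  by (intro borel_measurable_continuous_onI continuous_intros)

lemma borel_measurable_cos_kernel [measurable (raw)]:
  assumes [measurable]: "f \<in> borel_measurable M" "g \<in> borel_measurable M"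
  shows "(\<lambda>x. cos_kernel N (f x) (g x)) \<in> borel_measurable M"
  unfolding cos_kernel_def poisson_def by measurable

lemma nn_integral_01:
  fixes f :: "real \<Rightarrow> real"
  assumes "continuous_on {0..1} f" and "\<And>t. 0 \<le> f t"
  shows "ennreal (integral {0..1} f) = (\<integral>\<^sup>+t. ennreal (indicator {0..1} t * f t) \<partial>lborel)"
  using nn_integral_has_integral_lebesgue[of "{0..1}" f] integrable_integral[OF integrable_continuous_interval[OF assms(1)]] assms(2)
  by simp

lemma nn_integral_lborel_translate:
  fixes f :: "'a::euclidean_space \<Rightarrow> ennreal"
  assumes [measurable]: "f \<in> borel_measurable borel"
  shows "(\<integral>\<^sup>+x. f (c + x) \<partial>lborel) = (\<integral>\<^sup>+x. f x \<partial>lborel)"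
proof -
  have "(\<integral>\<^sup>+x. f x \<partial>lborel) = (\<integral>\<^sup>+x. f x \<partial>distr lborel borel ((+) c))"
    by (simp only: lborel_distr_plus)
  also have "\<dots> = (\<integral>\<^sup>+x. f (c + x) \<partial>lborel)" by (rule nn_integral_distr) auto
  finally show ?thesis ..
qed

text \<open>By Fubini and translation invariance, integrating \<open>f (T x + y)\<close> against the indicator of the
  unit ball in \<open>y\<close> gives the volume of the ball times either integral.\<close>

lemma nn_integral_lborel_orthogonal:
  fixes f :: "'a::euclidean_space \<Rightarrow> ennreal" and T :: "'a \<Rightarrow> 'a"
  assumes T: "orthogonal_transformation T" and f [measurable]: "f \<in> borel_measurable borel"
  shows "(\<integral>\<^sup>+x. f (T x) \<partial>lborel) = (\<integral>\<^sup>+x. f x \<partial>lborel)"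
proof -
  define A :: "'a set" where "A = ball 0 1"
  define v where "v = emeasure lborel A"
  have [measurable]: "A \<in> sets borel" by (simp add: A_def)
  have lT: "linear T" using T by (rule orthogonal_transformation_linear)
  have [measurable]: "T \<in> borel_measurable borel"
    using lT by (intro borel_measurable_continuous_onI linear_continuous_on) (simp add: linear_conv_bounded_linear)
  obtain T' where TT': "\<And>x. T (T' x) = x" "\<And>x. T' (T x) = x" "orthogonal_transformation T'"
    using orthogonal_transformation_inv[OF T] orthogonal_transformation_bij[OF T]
    by (metis bij_inv_eq_iff)
  have Tadd: "T x + y = T (T' y + x)" for x y
    by (simp add: linear_add[OF lT] TT' add.commute)
  have v1: "(\<integral>\<^sup>+y. indicator A y \<partial>lborel) = v" by (simp add: v_def)
  \<comment> \<open>As \<open>T\<close> is an isometry, the set of \<open>x\<close> with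
    \<open>u - T x\<close> in the unit ball is itself a unit ball, around \<open>T' u\<close>. This
    is where orthogonality enters.\<close>
  have v2: "(\<integral>\<^sup>+x. indicator A (u - T x) \<partial>lborel) = v" for u
  proof -
    have "indicator A (u - T x) = (indicator A (- T' u + x) :: ennreal)" for x
    proof -
      have "T (T' u - x) = u - T x" by (simp add: linear_diff[OF lT] TT')
      then have "norm (u - T x) = norm (T' u - x)" by (metis T orthogonal_transformation_norm)
      then show ?thesis by (simp add: A_def indicator_def norm_minus_commute add.commute)
    qed
    then show ?thesis using nn_integral_lborel_translate[of "indicator A" "- T' u"] v1 by simp
  qed
  have "v * (\<integral>\<^sup>+x. f (T x) \<partial>lborel) = (\<integral>\<^sup>+y. indicator A y * (\<integral>\<^sup>+x. f (T x + y) \<partial>lborel) \<partial>lborel)"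
    using nn_integral_lborel_translate[of "\<lambda>x. f (T x)"] by (simp add: Tadd nn_integral_multc v1)
  also have "\<dots> = (\<integral>\<^sup>+y. (\<integral>\<^sup>+x. indicator A y * f (T x + y) \<partial>lborel) \<partial>lborel)"
    by (intro nn_integral_cong) (simp add: nn_integral_cmult)
  also have "\<dots> = (\<integral>\<^sup>+x. (\<integral>\<^sup>+y. indicator A y * f (T x + y) \<partial>lborel) \<partial>lborel)"
    by (rule lborel_pair.Fubini') measurable
  also have "\<dots> = (\<integral>\<^sup>+x. (\<integral>\<^sup>+u. indicator A (u - T x) * f u \<partial>lborel) \<partial>lborel)"
  proof (rule nn_integral_cong)
    fix x
    show "(\<integral>\<^sup>+y. indicator A y * f (T x + y) \<partial>lborel) = (\<integral>\<^sup>+u. indicator A (u - T x) * f u \<partial>lborel)"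
      using nn_integral_lborel_translate[of "\<lambda>u. indicator A (u - T x) * f u" "T x"] by simp
  qed
  also have "\<dots> = (\<integral>\<^sup>+u. (\<integral>\<^sup>+x. indicator A (u - T x) * f u \<partial>lborel) \<partial>lborel)"
    by (rule lborel_pair.Fubini') measurable
  also have "\<dots> = v * (\<integral>\<^sup>+u. f u \<partial>lborel)"
    by (simp add: nn_integral_multc nn_integral_cmult v2)
  finally have "v * (\<integral>\<^sup>+x. f (T x) \<partial>lborel) = v * (\<integral>\<^sup>+u. f u \<partial>lborel)" .
  moreover have "v \<noteq> \<infinity>" unfolding v_def A_def using emeasure_lborel_ball_finite[of 0 1] by (simp add: less_top)
  moreover have "v \<noteq> 0"
    unfolding v_def A_def using content_ball_pos[of 1 "0::'a"] by (auto simp: measure_def)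
  ultimately show ?thesis by (simp add: ennreal_mult_cancel_left)
qed

section \<open>Averages with respect to products of the central kernel\<close>

definition cos_measure :: "nat \<Rightarrow> real measure" where
  "cos_measure N = density lborel (\<lambda>t. ennreal (indicator {0..1} t * cos_kernel N (1 / 4) t))"

lemma sets_cos_measure [measurable_cong, simp]: "sets (cos_measure N) = sets borel"
  by (simp add: cos_measure_def)

lemma prob_space_cos_measure: "N \<ge> 1 \<Longrightarrow> prob_space (cos_measure N)"
proof (rule prob_spaceI)
  assume N: "N \<ge> 1"
  have "emeasure (cos_measure N) (space (cos_measure N)) = ennreal (integral {0..1} (cos_kernel N (1 / 4)))"
    unfolding nn_integral_01[OF continuous_on_cos_kernel[OF N] cos_kernel_nonneg[OF N]]
    by (simp add: cos_measure_def emeasure_density)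
  then show "emeasure (cos_measure N) (space (cos_measure N)) = 1"
    using integral_unique[OF has_integral_cos_kernel[OF N]] by simp
qed

lemma Bernstein_center:
  fixes Q :: "complex poly"
  assumes Q: "degree Q \<le> N" and N: "N \<ge> 1" and p: "p > 0" and \<zeta>: "norm \<zeta> \<le> 1 / (1024 * real N)"
  shows "ennreal (norm (poly Q \<zeta>) powr p) \<le>
    ennreal (3 * 8 powr p) * (\<integral>\<^sup>+t. ennreal (norm (poly Q (of_real (cos (2 * pi * t)))) powr p) \<partial>cos_measure N)"
proof -
  \<comment> \<open>\<open>1 / 4\<close> is the angle of the midpoint 0 of the interval. There the
    sine is 1 and the admissible radius is of order \<open>1 / N\<close>.\<close>
  have q: "2 * pi * (1 / 4) = pi / 2" by simp
  have "norm \<zeta> \<le> (1 + 1 / real N) / (1024 * real N)"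
    using \<zeta> by (elim order_trans) (intro divide_right_mono, auto)
  then have B: "norm (poly Q \<zeta>) powr p \<le> 3 * 8 powr p * integral {0..1} (\<lambda>t.
           cos_kernel N (1 / 4) t * norm (poly Q (of_real (cos (2 * pi * t)))) powr p)" (is "_ \<le> _ * integral _ ?f")
    by (intro Bernstein_kernel_bound(1)[OF Q N p]) (simp add: q del: mult_divide_mult_cancel_left)
  have c: "continuous_on A (\<lambda>t. norm (poly Q (of_real (cos (2 * pi * t)))) powr p)" for A
    using p by (intro continuous_intros continuous_on_powr') auto
  have "ennreal (norm (poly Q \<zeta>) powr p) \<le> ennreal (3 * 8 powr p) * ennreal (integral {0..1} ?f)"
    using B by (simp add: ennreal_mult'[symmetric] ennreal_leI)
  also have "ennreal (integral {0..1} ?f) = (\<integral>\<^sup>+t. ennreal (indicator {0..1} t * ?f t) \<partial>lborel)"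
    by (intro nn_integral_01 continuous_on_mult continuous_on_cos_kernel N c) (auto intro!: mult_nonneg_nonneg cos_kernel_nonneg N)
  also have "\<dots> = (\<integral>\<^sup>+t. ennreal (norm (poly Q (of_real (cos (2 * pi * t)))) powr p) \<partial>cos_measure N)"
    unfolding cos_measure_def
    using borel_measurable_continuous_onI[OF c]
    by (subst nn_integral_density) (auto simp: ennreal_mult'[symmetric] mult_ac cos_kernel_nonneg[OF N] intro!: nn_integral_cong)
  finally show ?thesis .
qed

text \<open>The case \<open>p = 1\<close> of the kernel bound with a kernel of mass one;
  \<open>24 = 3 * 8\<close>.\<close>

lemma Bernstein_sup:
  fixes Q :: "complex poly" and \<zeta> :: complex
  assumes Q: "degree Q \<le> N" and N: "N \<ge> 1"
    and \<zeta>: "norm (\<zeta> - of_real (cos (2 * pi * t\<^sub>0))) \<le> (\<bar>sin (2 * pi * t\<^sub>0)\<bar> + 1 / real N) / (1024 * real N)"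
    and X: "\<And>x. - 1 \<le> x \<Longrightarrow> x \<le> 1 \<Longrightarrow> norm (poly Q (of_real x)) \<le> X"
  shows "norm (poly Q \<zeta>) \<le> 24 * X"
proof -
  have "norm (poly Q \<zeta>) \<le> 24 * integral {0..1} (\<lambda>t. cos_kernel N t\<^sub>0 t * norm (poly Q (of_real (cos (2 * pi * t)))))"
    using Bernstein_kernel_bound(1)[OF Q N _ \<zeta>, of 1] by simp
  also have "integral {0..1} (\<lambda>t. cos_kernel N t\<^sub>0 t * norm (poly Q (of_real (cos (2 * pi * t)))))
      \<le> integral {0..1} (\<lambda>t. cos_kernel N t\<^sub>0 t * X)"
    by (intro integral_le integrable_continuous_interval continuous_intros continuous_on_cos_kernel N
        mult_left_mono X cos_kernel_nonneg) auto
  also have "\<dots> = X" using integral_unique[OF has_integral_cos_kernel[OF N]] by simp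
  finally show ?thesis by simp
qed

definition cos_product :: "'i set \<Rightarrow> nat \<Rightarrow> ('i \<Rightarrow> real) measure" where
  "cos_product I N = PiM I (\<lambda>_. cos_measure N)"

lemma prob_space_cos_product: "N \<ge> 1 \<Longrightarrow> prob_space (cos_product I N)"
  unfolding cos_product_def by (intro prob_space_PiM prob_space_cos_measure)

text \<open>One variable at a time is made real: with the others frozen, \<open>F\<close> is a
  univariate polynomial of degree at most \<open>N\<close>, evaluated near the centre of
  \<open>[-c, c]\<close>. Each variable costs a factor \<open>3 * 8 powr p\<close>.\<close>

lemma cpoly_cos_product_bound:
  fixes F :: "('i \<Rightarrow> complex) \<Rightarrow> complex"
  assumes "finite I" and F: "cpoly N F" and N: "N \<ge> 1" and p: "p > 0" and c: "c > 0"
    and "\<And>i. i \<in> I \<Longrightarrow> norm (\<zeta> i) \<le> c / (1024 * real N)"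
  shows "ennreal (norm (F \<zeta>) powr p) \<le> ennreal (3 * 8 powr p) ^ card I *
    (\<integral>\<^sup>+t. ennreal (norm (F (\<lambda>i. if i \<in> I then of_real (c * cos (2 * pi * t i)) else \<zeta> i)) powr p) \<partial>cos_product I N)"
  using assms(1,6)
proof (induction I rule: finite_induct)
  case empty
  then show ?case by (simp add: cos_product_def PiM_empty nn_integral_count_space_finite)
next
  case (insert j I)
  interpret prob_space "cos_measure N" using N by (rule prob_space_cos_measure)
  interpret product_sigma_finite "\<lambda>_::'i. cos_measure N" by unfold_locales
  let ?C = "ennreal (3 * 8 powr p)"
  let ?z = "\<lambda>I (t::'i \<Rightarrow> real) i. if i \<in> I then of_real (c * cos (2 * pi * t i)) else \<zeta> i"
  have step: "ennreal (norm (F (?z I t)) powr p) \<le>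
      ?C * (\<integral>\<^sup>+s. ennreal (norm (F (?z (insert j I) (t(j := s)))) powr p) \<partial>cos_measure N)" for t
  proof -
    have "\<exists>q. degree q \<le> 1 \<and> (\<forall>z. (if i = j then of_real c * z else ?z I t i) = poly q z)" for i
      by (rule exI[of _ "if i = j then [:0, of_real c:] else [:?z I t i:]"]) auto
    from cpoly_univariate[where g = "\<lambda>i z. if i = j then of_real c * z else ?z I t i", OF F this]
    obtain Q where Q: "degree Q \<le> N" "\<And>z. F (\<lambda>i. if i = j then of_real c * z else ?z I t i) = poly Q z"
      by auto
    have "norm (\<zeta> j / of_real c) \<le> 1 / (1024 * real N)"
      using insert.prems[of j] c by (simp add: norm_divide divide_le_eq mult.commute)
    from Bernstein_center[OF Q(1) N p this]
    have "ennreal (norm (F (\<lambda>i. if i = j then of_real c * (\<zeta> j / of_real c) else ?z I t i)) powr p) \<le>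
      ?C * (\<integral>\<^sup>+s. ennreal (norm (F (\<lambda>i. if i = j then of_real c * of_real (cos (2 * pi * s)) else ?z I t i)) powr p) \<partial>cos_measure N)"
      unfolding Q(2) .
    moreover have "(\<lambda>i. if i = j then of_real c * (\<zeta> j / of_real c) else ?z I t i) = ?z I t"
      using c insert.hyps by auto
    moreover have "(\<lambda>i. if i = j then of_real c * of_real (cos (2 * pi * s)) else ?z I t i) = ?z (insert j I) (t(j := s))" for s
      by auto
    ultimately show ?thesis by simp
  qed
  have zmeas: "(\<lambda>t. ennreal (norm (F (?z J t)) powr p)) \<in> borel_measurable (PiM J (\<lambda>_. cos_measure N))" for J
  proof -
    have "(\<lambda>t. F (?z J t)) \<in> borel_measurable (PiM J (\<lambda>_. cos_measure N))"
    proof (rule cpoly_measurable[OF F])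
      fix i
      show "(\<lambda>t. ?z J t i) \<in> borel_measurable (PiM J (\<lambda>_. cos_measure N))"
      proof (cases "i \<in> J")
        case True
        then have "(\<lambda>t. t i) \<in> borel_measurable (PiM J (\<lambda>_. cos_measure N))"
          using measurable_component_singleton[of i J "\<lambda>_. cos_measure N"] by simp
        then show ?thesis using True by simp
      qed simp
    qed
    then show ?thesis by measurable
  qed
  have "ennreal (norm (F \<zeta>) powr p) \<le> ?C ^ card I * (\<integral>\<^sup>+t. ennreal (norm (F (?z I t)) powr p) \<partial>cos_product I N)"
    using insert.IH insert.prems by simp
  also have "\<dots> \<le> ?C ^ card I * (\<integral>\<^sup>+t. ?C * (\<integral>\<^sup>+s. ennreal (norm (F (?z (insert j I) (t(j := s)))) powr p) \<partial>cos_measure N) \<partial>cos_product I N)"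
    by (intro mult_left_mono nn_integral_mono step) auto
  also have "\<dots> = ?C ^ card I * (?C * (\<integral>\<^sup>+t. (\<integral>\<^sup>+s. ennreal (norm (F (?z (insert j I) (t(j := s)))) powr p) \<partial>cos_measure N) \<partial>cos_product I N))"
  proof -
    have "(\<lambda>t. \<integral>\<^sup>+s. ennreal (norm (F (?z (insert j I) (t(j := s)))) powr p) \<partial>cos_measure N) \<in> borel_measurable (cos_product I N)"
      unfolding cos_product_def
      using borel_measurable_nn_integral_fst[OF measurable_compose[OF
          measurable_add_dim[of j I "\<lambda>_. cos_measure N"] zmeas[of "insert j I"]]]
      by (simp only: prod.case)
    then show ?thesis by (subst nn_integral_cmult) auto
  qed
  also have "\<dots> = ?C ^ card (insert j I) * (\<integral>\<^sup>+t. ennreal (norm (F (?z (insert j I) t)) powr p) \<partial>cos_product (insert j I) N)"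
    unfolding cos_product_def using insert.hyps zmeas[of "insert j I"]
    by (subst product_nn_integral_insert) (auto simp: mult_ac)
  finally show ?case .
qed

section \<open>Vertical segments in the cosine parametrization\<close>

definition depth_at :: "real \<Rightarrow> real \<Rightarrow> real" where
  "depth_at \<Lambda> t = \<Lambda> * (1 - cos (2 * pi * t)) / 2"

text \<open>The truncation to \<open>[-1, 1]\<close> makes the inverse of \<open>depth_at\<close> a measurable function.\<close>

definition depth_angle :: "real \<Rightarrow> real \<Rightarrow> real" where
  "depth_angle \<Lambda> h = arccos (max (- 1) (min 1 (1 - 2 * h / \<Lambda>))) / (2 * pi)"

lemma depth_at_bounds: "\<Lambda> \<ge> 0 \<Longrightarrow> 0 \<le> depth_at \<Lambda> t" "\<Lambda> \<ge> 0 \<Longrightarrow> depth_at \<Lambda> t \<le> \<Lambda>"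
proof -
  assume L: "\<Lambda> \<ge> 0"
  have "\<Lambda> * (1 - cos (2 * pi * t)) \<le> \<Lambda> * 2" using L cos_ge_minus_one[of "2 * pi * t"] by (intro mult_left_mono) auto
  then show "depth_at \<Lambda> t \<le> \<Lambda>" unfolding depth_at_def by simp
qed (simp add: depth_at_def)

lemma cos_depth_angle:
  assumes "\<Lambda> > 0" "0 \<le> h" "h \<le> \<Lambda>"
  shows "cos (2 * pi * depth_angle \<Lambda> h) = 1 - 2 * h / \<Lambda>"
proof -
  have "2 * h / \<Lambda> \<le> 2" using assms by (simp add: field_simps)
  then show ?thesis using assms by (simp add: depth_angle_def cos_arccos max_def)
qed

lemma depth_angle_depth_at:
  assumes "\<Lambda> > 0" "0 \<le> t" "t \<le> 1 / 2"
  shows "depth_angle \<Lambda> (depth_at \<Lambda> t) = t"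
proof -
  have "1 - 2 * depth_at \<Lambda> t / \<Lambda> = cos (2 * pi * t)" using assms by (simp add: depth_at_def field_simps)
  then have "max (- 1) (min 1 (1 - 2 * depth_at \<Lambda> t / \<Lambda>)) = cos (2 * pi * t)" by simp
  moreover have "arccos (cos (2 * pi * t)) = 2 * pi * t"
    by (rule arccos_cos) (use assms pi_gt_zero in \<open>auto simp: field_simps\<close>)
  ultimately show ?thesis by (simp only: depth_angle_def) simp
qed

lemma borel_measurable_depth_at [measurable]: "depth_at \<Lambda> \<in> borel_measurable borel"
  unfolding depth_at_def by measurable

lemma borel_measurable_depth_angle [measurable (raw)]:
  assumes [measurable]: "f \<in> borel_measurable M"
  shows "(\<lambda>x. depth_angle \<Lambda> (f x)) \<in> borel_measurable M"
proof -
  have "continuous_on UNIV (\<lambda>h. arccos (max (- 1) (min 1 (1 - 2 * h / \<Lambda>))))"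
    unfolding divide_inverse by (intro continuous_intros) auto
  from borel_measurable_continuous_onI[OF this] show ?thesis
    unfolding depth_angle_def by measurable
qed

lemma nn_integral_depth_at:
  fixes f :: "real \<Rightarrow> ennreal"
  assumes f: "f \<in> borel_measurable borel" and L: "\<Lambda> > 0"
  shows "(\<integral>\<^sup>+u. f u * indicator {0..\<Lambda>} u \<partial>lborel) =
    (\<integral>\<^sup>+t. f (depth_at \<Lambda> t) * ennreal (\<Lambda> * pi * sin (2 * pi * t)) * indicator {0..1/2} t \<partial>lborel)"
proof -
  have "(\<integral>\<^sup>+u. f u * indicator {depth_at \<Lambda> 0..depth_at \<Lambda> (1/2)} u \<partial>lborel) =
    (\<integral>\<^sup>+t. f (depth_at \<Lambda> t) * ennreal (\<Lambda> * pi * sin (2 * pi * t)) * indicator {0..1/2} t \<partial>lborel)"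
  proof (rule nn_integral_substitution_aux[OF f])
    show "(depth_at \<Lambda> has_real_derivative \<Lambda> * pi * sin (2 * pi * t)) (at t)" for t
      unfolding depth_at_def by (auto intro!: derivative_eq_intros simp: field_simps)
    show "continuous_on {0..1/2} (\<lambda>t. \<Lambda> * pi * sin (2 * pi * t))" by (intro continuous_intros)
    show "0 \<le> \<Lambda> * pi * sin (2 * pi * t)" if "t \<in> {0..1/2}" for t
    proof -
      have "2 * pi * t \<le> 2 * pi * (1 / 2)" using that by (intro mult_left_mono) auto
      then have "0 \<le> sin (2 * pi * t)" using that by (intro sin_ge_zero) auto
      then show ?thesis using L by simp
    qed
  qed auto
  then show ?thesis using L by (simp add: depth_at_def)
qed

text \<open>A full period traverses \<open>[0, \<Lambda>]\<close> twice, which is the origin of the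
  factor 2. Reflecting \<open>t\<close> to \<open>1 - t\<close> reduces to the half period, where
  the substitution is monotone.\<close>

lemma nn_integral_depth_at_abs:
  fixes f :: "real \<Rightarrow> ennreal"
  assumes f [measurable]: "f \<in> borel_measurable borel" and L: "\<Lambda> > 0"
  shows "ennreal (\<Lambda> * pi) * (\<integral>\<^sup>+t. f (depth_at \<Lambda> t) * ennreal (indicator {0..1} t * \<bar>sin (2 * pi * t)\<bar>) \<partial>lborel)
    \<le> 2 * (\<integral>\<^sup>+u. f u * indicator {0..\<Lambda>} u \<partial>lborel)"
proof -
  let ?g = "\<lambda>t. f (depth_at \<Lambda> t) * ennreal (indicator {0..1/2} t * \<bar>sin (2 * pi * t)\<bar>)"
  have sym: "depth_at \<Lambda> (1 - t) = depth_at \<Lambda> t" "\<bar>sin (2 * pi * (1 - t))\<bar> = \<bar>sin (2 * pi * t)\<bar>" for t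
  proof -
    have "2 * pi * (1 - t) = 2 * pi - 2 * pi * t" by (simp add: right_diff_distrib)
    then show "depth_at \<Lambda> (1 - t) = depth_at \<Lambda> t" "\<bar>sin (2 * pi * (1 - t))\<bar> = \<bar>sin (2 * pi * t)\<bar>"
      by (simp_all only: depth_at_def cos_2pi_minus sin_2pi_minus abs_minus_cancel)
  qed
  have 1: "ennreal (\<Lambda> * pi) * (\<integral>\<^sup>+t. ?g t \<partial>lborel) = (\<integral>\<^sup>+u. f u * indicator {0..\<Lambda>} u \<partial>lborel)"
  proof -
    have "ennreal (\<Lambda> * pi) * (\<integral>\<^sup>+t. ?g t \<partial>lborel) = (\<integral>\<^sup>+t. ennreal (\<Lambda> * pi) * ?g t \<partial>lborel)"
      by (rule nn_integral_cmult[symmetric]) measurable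
    also have "\<dots> = (\<integral>\<^sup>+t. f (depth_at \<Lambda> t) * ennreal (\<Lambda> * pi * sin (2 * pi * t)) * indicator {0..1/2} t \<partial>lborel)"
    proof (rule nn_integral_cong)
      fix t :: real
      have s: "0 \<le> sin (2 * pi * t)" if "t \<in> {0..1/2}"
      proof -
        have "2 * pi * t \<le> 2 * pi * (1 / 2)" using that by (intro mult_left_mono) auto
        then show ?thesis using that by (intro sin_ge_zero) auto
      qed
      show "ennreal (\<Lambda> * pi) * ?g t = f (depth_at \<Lambda> t) * ennreal (\<Lambda> * pi * sin (2 * pi * t)) * indicator {0..1/2} t"
      proof (cases "t \<in> {0..1/2}")
        case True
        then show ?thesis using s[OF True] L by (simp add: ennreal_mult' mult_ac)
      qed simp
    qed
    finally show ?thesis unfolding nn_integral_depth_at[OF f L] .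
  qed
  have 2: "(\<integral>\<^sup>+t. ?g (1 - t) \<partial>lborel) = (\<integral>\<^sup>+t. ?g t \<partial>lborel)"
    using nn_integral_real_affine[of ?g "-1" 1] by simp
  have "(\<integral>\<^sup>+t. f (depth_at \<Lambda> t) * ennreal (indicator {0..1} t * \<bar>sin (2 * pi * t)\<bar>) \<partial>lborel)
      \<le> (\<integral>\<^sup>+t. ?g t + ?g (1 - t) \<partial>lborel)"
    unfolding sym by (intro nn_integral_mono) (auto simp: indicator_def)
  also have "\<dots> = 2 * (\<integral>\<^sup>+t. ?g t \<partial>lborel)"
  proof -
    have "(\<integral>\<^sup>+t. ?g t + ?g (1 - t) \<partial>lborel) = (\<integral>\<^sup>+t. ?g t \<partial>lborel) + (\<integral>\<^sup>+t. ?g (1 - t) \<partial>lborel)"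
      by (rule nn_integral_add) measurable
    then show ?thesis unfolding 2 by (simp only: mult_2[of "\<integral>\<^sup>+t. ?g t \<partial>lborel"])
  qed
  finally have "(\<integral>\<^sup>+t. f (depth_at \<Lambda> t) * ennreal (indicator {0..1} t * \<bar>sin (2 * pi * t)\<bar>) \<partial>lborel)
      \<le> 2 * (\<integral>\<^sup>+t. ?g t \<partial>lborel)" .
  from mult_left_mono[OF this zero_le, of "ennreal (\<Lambda> * pi)"] show ?thesis
    unfolding 1[symmetric] by (simp only: mult.left_commute[of "ennreal (\<Lambda> * pi)" 2])
qed

text \<open>The integral on the right of the weighted kernel inequality at depth \<open>h\<close>,
  divided by the weight at \<open>h\<close>, without the constant.\<close>

definition vertical_average :: "nat \<Rightarrow> real \<Rightarrow> (real \<Rightarrow> ennreal) \<Rightarrow> real \<Rightarrow> ennreal" where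
  "vertical_average N \<Lambda> f h = ennreal (1 / (\<bar>sin (2 * pi * depth_angle \<Lambda> h)\<bar> + 1 / real N)) *
     (\<integral>\<^sup>+t. f (depth_at \<Lambda> t) * ennreal (indicator {0..1} t * cos_kernel N (depth_angle \<Lambda> h) t * \<bar>sin (2 * pi * t)\<bar>) \<partial>lborel)"

text \<open>The Jacobian of \<open>h = depth_at \<Lambda> s\<close> is at most
  \<open>\<Lambda> * pi\<close> times the weight in the denominator of the average. What is left is
  a kernel that has mass one in \<open>s\<close> by symmetry, and the sine in \<open>t\<close>
  restores Lebesgue measure on \<open>[0, \<Lambda>]\<close>.\<close>

lemma nn_integral_vertical_average:
  fixes f :: "real \<Rightarrow> ennreal"
  assumes f [measurable]: "f \<in> borel_measurable borel" and L: "\<Lambda> > 0" and N: "N \<ge> 1"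
  shows "(\<integral>\<^sup>+h. vertical_average N \<Lambda> f h * indicator {0..\<Lambda>} h \<partial>lborel)
    \<le> 2 * (\<integral>\<^sup>+u. f u * indicator {0..\<Lambda>} u \<partial>lborel)"
proof -
  let ?s = "\<lambda>t. \<bar>sin (2 * pi * t)\<bar>"
  have "(\<integral>\<^sup>+h. vertical_average N \<Lambda> f h * indicator {0..\<Lambda>} h \<partial>lborel) =
    (\<integral>\<^sup>+s. vertical_average N \<Lambda> f (depth_at \<Lambda> s) * ennreal (\<Lambda> * pi * sin (2 * pi * s)) * indicator {0..1/2} s \<partial>lborel)"
    unfolding vertical_average_def using L by (intro nn_integral_depth_at) measurable
  also have "\<dots> \<le> (\<integral>\<^sup>+s. ennreal (\<Lambda> * pi) * (\<integral>\<^sup>+t. (f (depth_at \<Lambda> t) * ennreal (indicator {0..1} t * ?s t)) *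
      ennreal (indicator {0..1} s * cos_kernel N t s) \<partial>lborel) \<partial>lborel)"
  proof (rule nn_integral_mono)
    fix s :: real
    show "vertical_average N \<Lambda> f (depth_at \<Lambda> s) * ennreal (\<Lambda> * pi * sin (2 * pi * s)) * indicator {0..1/2} s
      \<le> ennreal (\<Lambda> * pi) * (\<integral>\<^sup>+t. (f (depth_at \<Lambda> t) * ennreal (indicator {0..1} t * ?s t)) *
        ennreal (indicator {0..1} s * cos_kernel N t s) \<partial>lborel)"
    proof (cases "s \<in> {0..1/2}")
      case True
      then have a: "depth_angle \<Lambda> (depth_at \<Lambda> s) = s" using L by (intro depth_angle_depth_at) auto
      have "1 / (?s s + 1 / real N) * (\<Lambda> * pi * sin (2 * pi * s)) \<le> \<Lambda> * pi"
      proof -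
        have p: "0 < ?s s + 1 / real N" using N by (simp add: add_nonneg_pos)
        have "\<Lambda> * pi * sin (2 * pi * s) \<le> \<Lambda> * pi * (?s s + 1 / real N)"
          using L p N by (intro mult_left_mono) (auto intro: order_trans[OF abs_ge_self])
        then show ?thesis using p by (simp add: divide_le_eq)
      qed
      then have le: "ennreal (1 / (?s s + 1 / real N)) * ennreal (\<Lambda> * pi * sin (2 * pi * s)) \<le> ennreal (\<Lambda> * pi)"
        by (subst ennreal_mult'[symmetric]) (auto intro!: ennreal_leI)
      have "vertical_average N \<Lambda> f (depth_at \<Lambda> s) * ennreal (\<Lambda> * pi * sin (2 * pi * s)) * indicator {0..1/2} s =
        (ennreal (1 / (?s s + 1 / real N)) * ennreal (\<Lambda> * pi * sin (2 * pi * s))) *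
         (\<integral>\<^sup>+t. f (depth_at \<Lambda> t) * ennreal (indicator {0..1} t * cos_kernel N s t * ?s t) \<partial>lborel)"
        using True unfolding vertical_average_def a by (simp add: mult_ac)
      also have "\<dots> \<le> ennreal (\<Lambda> * pi) * (\<integral>\<^sup>+t. f (depth_at \<Lambda> t) * ennreal (indicator {0..1} t * cos_kernel N s t * ?s t) \<partial>lborel)"
        by (rule mult_right_mono[OF le]) simp
      also have "(\<integral>\<^sup>+t. f (depth_at \<Lambda> t) * ennreal (indicator {0..1} t * cos_kernel N s t * ?s t) \<partial>lborel)
        = (\<integral>\<^sup>+t. (f (depth_at \<Lambda> t) * ennreal (indicator {0..1} t * ?s t)) * ennreal (indicator {0..1} s * cos_kernel N t s) \<partial>lborel)"
        using True cos_kernel_nonneg[OF N]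
        by (intro nn_integral_cong) (auto simp: cos_kernel_commute[of N s] ennreal_mult' mult_ac indicator_def)
      finally show ?thesis .
    qed simp
  qed
  also have "\<dots> = ennreal (\<Lambda> * pi) * (\<integral>\<^sup>+s. (\<integral>\<^sup>+t. (f (depth_at \<Lambda> t) * ennreal (indicator {0..1} t * ?s t)) *
      ennreal (indicator {0..1} s * cos_kernel N t s) \<partial>lborel) \<partial>lborel)"
    by (rule nn_integral_cmult) measurable
  also have "(\<integral>\<^sup>+s. (\<integral>\<^sup>+t. (f (depth_at \<Lambda> t) * ennreal (indicator {0..1} t * ?s t)) *
      ennreal (indicator {0..1} s * cos_kernel N t s) \<partial>lborel) \<partial>lborel)
    = (\<integral>\<^sup>+t. (\<integral>\<^sup>+s. (f (depth_at \<Lambda> t) * ennreal (indicator {0..1} t * ?s t)) *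
      ennreal (indicator {0..1} s * cos_kernel N t s) \<partial>lborel) \<partial>lborel)"
    by (rule lborel_pair.Fubini') measurable
  also have "\<dots> = (\<integral>\<^sup>+t. f (depth_at \<Lambda> t) * ennreal (indicator {0..1} t * ?s t) \<partial>lborel)"
  proof (rule nn_integral_cong)
    fix t :: real
    have "(\<integral>\<^sup>+s. ennreal (indicator {0..1} s * cos_kernel N t s) \<partial>lborel) = 1"
      using nn_integral_01[OF continuous_on_cos_kernel[OF N] cos_kernel_nonneg[OF N], of t]
        integral_unique[OF has_integral_cos_kernel[OF N, of t]] by simp
    then show "(\<integral>\<^sup>+s. (f (depth_at \<Lambda> t) * ennreal (indicator {0..1} t * ?s t)) *
      ennreal (indicator {0..1} s * cos_kernel N t s) \<partial>lborel) = f (depth_at \<Lambda> t) * ennreal (indicator {0..1} t * ?s t)"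
      by (subst nn_integral_cmult) auto
  qed
  also have "ennreal (\<Lambda> * pi) * \<dots> \<le> 2 * (\<integral>\<^sup>+u. f u * indicator {0..\<Lambda>} u \<partial>lborel)"
    by (rule nn_integral_depth_at_abs[OF f L])
  finally show ?thesis .
qed

text \<open>The restriction to \<open>h \<le> \<Lambda> / 2\<close> keeps away from the lower end of
  the segment, where the sine vanishes again although the depth is large.\<close>

lemma sin_depth_angle_ge:
  assumes L: "0 < \<Lambda>" "\<Lambda> \<le> 2" and h: "0 \<le> h" "h \<le> \<Lambda> / 2"
  shows "sqrt h \<le> \<bar>sin (2 * pi * depth_angle \<Lambda> h)\<bar>"
proof -
  let ?a = "2 * pi * depth_angle \<Lambda> h"
  have c: "cos ?a = 1 - 2 * h / \<Lambda>" using assms by (intro cos_depth_angle) auto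
  have x: "h \<le> 2 * h / \<Lambda>" "2 * h / \<Lambda> \<le> 1" using assms mult_right_mono[of \<Lambda> 2 h] by (auto simp: field_simps)
  have "(sin ?a)\<^sup>2 = 1 - (cos ?a)\<^sup>2" by (rule sin_squared_eq)
  also have "\<dots> = (2 * h / \<Lambda>) * (2 - 2 * h / \<Lambda>)" unfolding c by algebra
  also have "\<dots> \<ge> h * 1" using x h by (intro mult_mono) auto
  finally have "sqrt h \<le> sqrt ((sin ?a)\<^sup>2)" by (intro real_sqrt_le_mono) simp
  then show ?thesis by simp
qed

text \<open>The affine map onto \<open>[-1, 1]\<close> multiplies distances by
  \<open>2 / \<Lambda>\<close>, which explains \<open>\<Lambda> / 2048\<close> against the
  \<open>1 / 1024\<close> of the one-variable bound.\<close>

lemma depth_offset_close: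
  fixes z :: complex
  assumes L: "0 < \<Lambda>" "\<Lambda> \<le> 2" and h: "0 \<le> h" "h \<le> \<Lambda> / 2" and N: "N \<ge> 1"
    and z: "norm z \<le> \<Lambda> * (sqrt h + 1 / real N) / (2048 * real N)"
  shows "norm ((1 - 2 * (of_real h + z) / of_real \<Lambda>) - of_real (cos (2 * pi * depth_angle \<Lambda> h)))
    \<le> (\<bar>sin (2 * pi * depth_angle \<Lambda> h)\<bar> + 1 / real N) / (1024 * real N)"
proof -
  have c: "cos (2 * pi * depth_angle \<Lambda> h) = 1 - 2 * h / \<Lambda>" using assms by (intro cos_depth_angle) auto
  have "(1 - 2 * (of_real h + z) / of_real \<Lambda>) - of_real (cos (2 * pi * depth_angle \<Lambda> h)) = - (2 * z / of_real \<Lambda>)"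
    unfolding c by (simp add: add_divide_distrib distrib_left)
  then have "norm ((1 - 2 * (of_real h + z) / of_real \<Lambda>) - of_real (cos (2 * pi * depth_angle \<Lambda> h))) = 2 * norm z / \<Lambda>"
    using L by (simp add: norm_divide norm_mult)
  also have "\<dots> \<le> 2 * (\<Lambda> * (sqrt h + 1 / real N) / (2048 * real N)) / \<Lambda>"
    using L z by (intro divide_right_mono mult_left_mono) auto
  also have "\<dots> = (sqrt h + 1 / real N) / (1024 * real N)" using L by simp
  also have "\<dots> \<le> (\<bar>sin (2 * pi * depth_angle \<Lambda> h)\<bar> + 1 / real N) / (1024 * real N)"
    using sin_depth_angle_ge[OF L h] by (intro divide_right_mono) auto
  finally show ?thesis .
qed

lemma depth_reparametrization:
  fixes q :: "complex poly"
  assumes "degree q \<le> N" and "\<Lambda> > 0"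
  obtains Q where "degree Q \<le> N" and "\<And>u. poly Q (1 - 2 * u / of_real \<Lambda>) = poly q u"
    and "\<And>t. poly Q (of_real (cos (2 * pi * t))) = poly q (of_real (depth_at \<Lambda> t))"
proof
  let ?l = "[:of_real (\<Lambda> / 2), - of_real (\<Lambda> / 2):] :: complex poly"
  have "degree (q \<circ>\<^sub>p ?l) \<le> degree q * degree ?l" by (rule degree_pcompose_le)
  also have "\<dots> \<le> N" using assms(1) by (simp add: le_trans[OF mult_le_mono2[of _ 1]])
  finally show "degree (q \<circ>\<^sub>p ?l) \<le> N" .
  show "poly (q \<circ>\<^sub>p ?l) (1 - 2 * u / of_real \<Lambda>) = poly q u" for u
    using assms(2) by (simp add: poly_pcompose field_simps)
  show "poly (q \<circ>\<^sub>p ?l) (of_real (cos (2 * pi * t))) = poly q (of_real (depth_at \<Lambda> t))" for t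
    by (simp add: poly_pcompose depth_at_def algebra_simps diff_divide_distrib)
qed

lemma vertical_average_bound:
  fixes q :: "complex poly"
  assumes L: "0 < \<Lambda>" "\<Lambda> \<le> 2" and h: "0 \<le> h" "h \<le> \<Lambda> / 2" and N: "N \<ge> 1" and q: "degree q \<le> N" and p: "p > 0"
    and z: "norm z \<le> \<Lambda> * (sqrt h + 1 / real N) / (2048 * real N)"
  shows "ennreal (norm (poly q (of_real h + z)) powr p)
    \<le> ennreal (36 * 8 powr p) * vertical_average N \<Lambda> (\<lambda>u. ennreal (norm (poly q (of_real u)) powr p)) h"
proof -
  obtain Q where Q: "degree Q \<le> N" "\<And>u. poly Q (1 - 2 * u / of_real \<Lambda>) = poly q u"
    and Qc: "\<And>t. poly Q (of_real (cos (2 * pi * t))) = poly q (of_real (depth_at \<Lambda> t))"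
    using depth_reparametrization[OF q L(1)] by blast
  let ?a = "depth_angle \<Lambda> h"
  let ?s = "\<lambda>t. \<bar>sin (2 * pi * t)\<bar>"
  let ?f = "\<lambda>t. norm (poly q (of_real (depth_at \<Lambda> t))) powr p"
  let ?k = "\<lambda>t. cos_kernel N ?a t * (?f t * ?s t)"
  have pos: "0 < ?s ?a + 1 / real N" using N by (simp add: add_nonneg_pos)
  have B: "norm (poly q (of_real h + z)) powr p * (?s ?a + 1 / real N) \<le> 36 * 8 powr p * integral {0..1} ?k"
    using Bernstein_kernel_bound(2)[OF Q(1) N p depth_offset_close[OF L h N z]] unfolding Qc Q(2) .
  then have "norm (poly q (of_real h + z)) powr p \<le> (1 / (?s ?a + 1 / real N)) * (36 * 8 powr p * integral {0..1} ?k)"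
    using pos by (simp add: field_simps)
  then have "ennreal (norm (poly q (of_real h + z)) powr p)
      \<le> ennreal ((1 / (?s ?a + 1 / real N)) * (36 * 8 powr p * integral {0..1} ?k))" by (rule ennreal_leI)
  also have "\<dots> = ennreal (36 * 8 powr p) * (ennreal (1 / (?s ?a + 1 / real N)) * ennreal (integral {0..1} ?k))"
    using pos by (simp add: ennreal_mult'[symmetric] mult_ac)
  also have "ennreal (integral {0..1} ?k) = (\<integral>\<^sup>+t. ennreal (indicator {0..1} t * ?k t) \<partial>lborel)"
  proof (rule nn_integral_01)
    show "continuous_on {0..1} ?k"
      unfolding depth_at_def using p
      by (intro continuous_intros continuous_on_cos_kernel N continuous_on_powr') auto
    show "0 \<le> ?k t" for t by (intro mult_nonneg_nonneg cos_kernel_nonneg N) auto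
  qed
  also have "\<dots> = (\<integral>\<^sup>+t. ennreal (?f t) * ennreal (indicator {0..1} t * cos_kernel N ?a t * ?s t) \<partial>lborel)"
    by (simp add: ennreal_mult'[symmetric] mult_ac)
  finally show ?thesis unfolding vertical_average_def .
qed

lemma vertical_sup_bound:
  fixes q :: "complex poly"
  assumes L: "0 < \<Lambda>" "\<Lambda> \<le> 2" and h: "0 \<le> h" "h \<le> \<Lambda> / 2" and N: "N \<ge> 1" and q: "degree q \<le> N"
    and z: "norm z \<le> \<Lambda> * (sqrt h + 1 / real N) / (2048 * real N)"
    and X: "\<And>u. 0 \<le> u \<Longrightarrow> u \<le> \<Lambda> \<Longrightarrow> norm (poly q (of_real u)) \<le> X"
  shows "norm (poly q (of_real h + z)) \<le> 24 * X"
proof -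
  obtain Q where Q: "degree Q \<le> N" "\<And>u. poly Q (1 - 2 * u / of_real \<Lambda>) = poly q u"
    and Qc: "\<And>t. poly Q (of_real (cos (2 * pi * t))) = poly q (of_real (depth_at \<Lambda> t))"
    using depth_reparametrization[OF q L(1)] by blast
  have "norm (poly Q (of_real x)) \<le> X" if "- 1 \<le> x" "x \<le> 1" for x
  proof -
    have "poly Q (of_real x) = poly q (of_real (\<Lambda> * (1 - x) / 2))"
      using Q(2)[of "of_real (\<Lambda> * (1 - x) / 2)"] L by simp
    moreover have "\<Lambda> * (1 - x) \<le> \<Lambda> * 2" using that L by (intro mult_left_mono) auto
    ultimately show ?thesis using that L X[of "\<Lambda> * (1 - x) / 2"] by simp
  qed
  from Bernstein_sup[OF Q(1) N depth_offset_close[OF L h N z] this] show ?thesis unfolding Q(2) .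
qed

section \<open>Boundary charts\<close>

definition grad :: "('a::euclidean_space \<Rightarrow> real) \<Rightarrow> 'a \<Rightarrow> 'a" where
  "grad g x = (\<Sum>b\<in>Basis. dir_deriv b g x *\<^sub>R b)"

lemma frechet_derivative_eq_sum_dir_deriv:
  assumes "g differentiable (at x)"
  shows "frechet_derivative g (at x) v = (\<Sum>b\<in>Basis. (v \<bullet> b) * dir_deriv b g x)"
proof -
  have l: "linear (frechet_derivative g (at x))" by (rule linear_frechet_derivative[OF assms])
  have "frechet_derivative g (at x) v = frechet_derivative g (at x) (\<Sum>b\<in>Basis. (v \<bullet> b) *\<^sub>R b)"
    by (simp add: euclidean_representation)
  also have "\<dots> = (\<Sum>b\<in>Basis. (v \<bullet> b) * dir_deriv b g x)"
    by (simp add: linear_sum[OF l] linear_scale[OF l] dir_deriv_def)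
  finally show ?thesis .
qed

lemma has_derivative_grad:
  assumes "g differentiable (at x)"
  shows "(g has_derivative (\<lambda>v. grad g x \<bullet> v)) (at x)"
proof -
  have "frechet_derivative g (at x) = (\<lambda>v. grad g x \<bullet> v)"
    by (auto simp: fun_eq_iff frechet_derivative_eq_sum_dir_deriv[OF assms] grad_def inner_commute[of "sum _ _"]
        inner_sum_right mult.commute)
  then show ?thesis using assms frechet_derivative_works by metis
qed

text \<open>The mean value inequality for each first partial derivative gives one factor of the
  dimension, and summing over the components of the gradient gives the other.\<close>

lemma C2_function_grad_Lipschitz:
  fixes g :: "'a::euclidean_space \<Rightarrow> real"
  assumes g: "C2_function g"
    and M: "\<And>b c y. b \<in> Basis \<Longrightarrow> c \<in> Basis \<Longrightarrow> \<bar>dir_deriv b (dir_deriv c g) y\<bar> \<le> M"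
  shows "norm (grad g x - grad g y) \<le> (real DIM('a))\<^sup>2 * M * norm (x - y)"
proof -
  have comp: "\<bar>dir_deriv c g x - dir_deriv c g y\<bar> \<le> real DIM('a) * M * norm (x - y)" if c: "c \<in> Basis" for c
  proof -
    have d: "dir_deriv c g differentiable (at z)" for z using g c unfolding C2_function_def by blast
    have "norm (dir_deriv c g x - dir_deriv c g y) \<le> real DIM('a) * M * norm (x - y)"
    proof (rule differentiable_bound[OF convex_UNIV])
      show "(dir_deriv c g has_derivative frechet_derivative (dir_deriv c g) (at z)) (at z)" for z
        using d frechet_derivative_works by blast
      show "onorm (frechet_derivative (dir_deriv c g) (at z)) \<le> real DIM('a) * M" for z
      proof (rule onorm_le)
        fix v :: 'a
        have "norm (frechet_derivative (dir_deriv c g) (at z) v) \<le> (\<Sum>b\<in>Basis. norm ((v \<bullet> b) * dir_deriv b (dir_deriv c g) z))"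
          unfolding frechet_derivative_eq_sum_dir_deriv[OF d] by (rule norm_sum)
        also have "\<dots> \<le> (\<Sum>b\<in>(Basis::'a set). norm v * M)"
          by (intro sum_mono) (auto simp: abs_mult intro!: mult_mono M c Basis_le_norm)
        finally show "norm (frechet_derivative (dir_deriv c g) (at z) v) \<le> real DIM('a) * M * norm v"
          by (simp add: mult_ac)
      qed
    qed auto
    then show ?thesis by simp
  qed
  have "norm (grad g x - grad g y) = norm (\<Sum>b\<in>Basis. (dir_deriv b g x - dir_deriv b g y) *\<^sub>R b)"
    by (simp add: grad_def sum_subtractf scaleR_diff_left)
  also have "\<dots> \<le> (\<Sum>b\<in>(Basis::'a set). real DIM('a) * M * norm (x - y))"
    by (intro sum_norm_le) (simp add: comp)
  finally show ?thesis by (simp add: power2_eq_square mult_ac)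
qed

text \<open>One chart together with the quantitative data of its graph. The bound on the second
  derivatives appears as a Lipschitz constant \<open>K\<close> of the gradient, the form in which
  Taylor estimates use it.\<close>

locale boundary_chart =
  fixes \<Omega> U :: "('a::euclidean_space \<times> real) set" and T :: "'a \<times> real \<Rightarrow> 'a \<times> real" and a :: "'a \<times> real"
    and g :: "'a \<Rightarrow> real" and K :: real
  assumes T: "orthogonal_transformation T" and open_U: "open U" and bounded_\<Omega>: "bounded \<Omega>" and closed_\<Omega>: "closed \<Omega>"
    and g_deriv: "\<And>x. (g has_derivative (\<lambda>v. grad g x \<bullet> v)) (at x)"
    and K_pos: "K > 0" and grad_Lipschitz: "\<And>x y. norm (grad g x - grad g y) \<le> K * norm (x - y)"
    and chart: "\<Omega> \<inter> U = {x \<in> U. snd (T x + a) \<le> g (fst (T x + a))}"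
begin

definition base :: "'a \<times> real \<Rightarrow> 'a" where "base x = fst (T x + a)"
text \<open>The signed distance to the graph along the last chart axis. Unlike the distance to the
  frontier, it is affine along vertical lines.\<close>

definition depth :: "'a \<times> real \<Rightarrow> real" where "depth x = g (base x) - snd (T x + a)"
definition T' :: "'a \<times> real \<Rightarrow> 'a \<times> real" where "T' = inv T"

lemma T_T' [simp]: "T (T' x) = x" and T'_T [simp]: "T' (T x) = x"
  using orthogonal_transformation_bij[OF T] by (auto simp: T'_def bij_is_surj surj_f_inv_f bij_is_inj)

lemma orthogonal_T': "orthogonal_transformation T'"
  unfolding T'_def by (rule orthogonal_transformation_inv[OF T])

lemma linear_T: "linear T" and linear_T': "linear T'"
  using T orthogonal_T' by (auto intro: orthogonal_transformation_linear)

lemma bounded_linear_T: "bounded_linear T" and bounded_linear_T': "bounded_linear T'"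
  using linear_T linear_T' by (auto simp: linear_conv_bounded_linear)

lemma norm_T [simp]: "norm (T x) = norm x" and norm_T' [simp]: "norm (T' x) = norm x"
  using T orthogonal_T' unfolding orthogonal_transformation by blast+

lemma inner_T: "T x \<bullet> T y = x \<bullet> y"
  using T unfolding orthogonal_transformation_def by blast

lemma base_add: "base (x + v) = base x + fst (T v)"
  by (simp add: base_def linear_add[OF linear_T])

lemma depth_add: "depth (x + v) = depth x + (g (base x + fst (T v)) - g (base x)) - snd (T v)"
  unfolding depth_def base_add by (simp add: linear_add[OF linear_T])

lemma depth_up: "depth (x + t *\<^sub>R T' (0, 1)) = depth x - t"
  by (simp add: depth_add linear_scale[OF linear_T] zero_prod_def[symmetric])

lemma norm_base_diff: "norm (base x - base y) \<le> norm (x - y)"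
proof -
  have "base x - base y = fst (T (x - y))" by (simp add: base_def linear_diff[OF linear_T])
  then show ?thesis using norm_fst_le[of "fst (T (x - y))" "snd (T (x - y))"] by simp
qed

lemma continuous_on_g: "continuous_on A g"
  using g_deriv by (meson continuous_at_imp_continuous_on has_derivative_continuous)

lemma continuous_on_T: "continuous_on A T" and continuous_on_T': "continuous_on A T'"
  using bounded_linear_T bounded_linear_T' by (auto intro: linear_continuous_on)

lemma continuous_on_base: "continuous_on A base"
  unfolding base_def by (intro continuous_intros continuous_on_T)

lemma continuous_on_depth: "continuous_on A depth"
  unfolding depth_def
  by (intro continuous_intros continuous_on_T continuous_on_compose2[OF continuous_on_g[of UNIV] continuous_on_base]) auto

lemma continuous_on_grad: "continuous_on A (grad g)"
proof (rule continuous_on_subset)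
  show "continuous_on UNIV (grad g)"
    unfolding continuous_on_iff
  proof safe
    fix x :: 'a and e :: real assume e: "e > 0"
    show "\<exists>d>0. \<forall>x'\<in>UNIV. dist x' x < d \<longrightarrow> dist (grad g x') (grad g x) < e"
    proof (intro exI[of _ "e / K"] conjI ballI impI)
      fix x' assume "dist x' x < e / K"
      then have "K * norm (x' - x) < e" using K_pos by (simp add: dist_norm field_simps)
      then show "dist (grad g x') (grad g x) < e" using grad_Lipschitz[of x' x] by (simp add: dist_norm)
    qed (use e K_pos in auto)
  qed
qed simp

lemma in_\<Omega>_iff: "x \<in> U \<Longrightarrow> x \<in> \<Omega> \<longleftrightarrow> depth x \<ge> 0"
  using chart by (auto simp: depth_def base_def)

text \<open>The mean value inequality is applied to \<open>g\<close> minus its linear part at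
  \<open>x\<close>; the gradient of this difference is at most \<open>K * norm s\<close> on the
  segment.\<close>

lemma Taylor_g: "\<bar>g (x + s) - g x - grad g x \<bullet> s\<bar> \<le> K * (norm s)\<^sup>2"
proof -
  let ?G = "\<lambda>y. g y - grad g x \<bullet> y"
  have "norm (?G (x + s) - ?G x) \<le> (K * norm s) * norm (x + s - x)"
  proof (rule differentiable_bound[OF convex_closed_segment[of x "x + s"]])
    show "(?G has_derivative (\<lambda>v. grad g y \<bullet> v - grad g x \<bullet> v)) (at y within closed_segment x (x + s))" for y
      by (intro has_derivative_diff has_derivative_inner_right has_derivative_ident has_derivative_at_withinI[OF g_deriv])
    show "onorm (\<lambda>v. grad g y \<bullet> v - grad g x \<bullet> v) \<le> K * norm s" if "y \<in> closed_segment x (x + s)" for y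
    proof (rule onorm_le)
      fix v :: 'a
      have "norm (grad g y \<bullet> v - grad g x \<bullet> v) \<le> norm (grad g y - grad g x) * norm v"
        using Cauchy_Schwarz_ineq2[of "grad g y - grad g x" v] by (simp add: inner_diff_left)
      also have "\<dots> \<le> (K * norm s) * norm v"
      proof (rule mult_right_mono)
        have "norm (y - x) \<le> norm s" using segment_bound1[OF that] by simp
        then show "norm (grad g y - grad g x) \<le> K * norm s"
          using grad_Lipschitz[of y x] K_pos by (meson mult_left_mono less_imp_le order_trans)
      qed simp
      finally show "norm (grad g y \<bullet> v - grad g x \<bullet> v) \<le> K * norm s * norm v" .
    qed
  qed auto
  then show ?thesis by (simp add: inner_add_right power2_eq_square algebra_simps)
qed

text \<open>Positive depth is an open condition and gives interior points. From a point of depth 0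
  every small step up the last chart axis leaves \<open>\<Omega>\<close>, so such a point is not
  interior.\<close>

lemma frontier_iff:
  assumes x: "x \<in> U"
  shows "x \<in> frontier \<Omega> \<longleftrightarrow> depth x = 0"
proof
  assume f: "x \<in> frontier \<Omega>"
  then have "x \<in> \<Omega>" using closed_\<Omega> by (auto simp: frontier_def)
  then have "depth x \<ge> 0" using in_\<Omega>_iff x by simp
  moreover have "\<not> depth x > 0"
  proof
    assume "depth x > 0"
    moreover have "open (U \<inter> {y. 0 < depth y})"
      by (intro open_Int open_U open_Collect_less continuous_on_const continuous_on_depth)
    moreover have "U \<inter> {y. 0 < depth y} \<subseteq> \<Omega>" using in_\<Omega>_iff by auto
    ultimately have "x \<in> interior \<Omega>" using x interiorI[of "U \<inter> {y. 0 < depth y}" x \<Omega>] by simp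
    then show False using f by (simp add: frontier_def)
  qed
  ultimately show "depth x = 0" by simp
next
  assume d: "depth x = 0"
  then have "x \<in> \<Omega>" using in_\<Omega>_iff x by simp
  moreover have "x \<notin> interior \<Omega>"
  proof
    assume "x \<in> interior \<Omega>"
    then have "x \<in> interior \<Omega> \<inter> U" using x by simp
    then obtain e where e: "e > 0" "ball x e \<subseteq> interior \<Omega> \<inter> U"
      using open_Int[OF open_interior open_U] openE by blast
    let ?y = "x + (e / 2) *\<^sub>R T' (0, 1)"
    have "?y \<in> ball x e" using e by (simp add: dist_norm)
    then have "?y \<in> interior \<Omega> \<inter> U" using e(2) by blast
    then have "?y \<in> \<Omega>" "?y \<in> U" using interior_subset by auto
    then have "depth ?y \<ge> 0" using in_\<Omega>_iff by blast
    then show False using depth_up[of x "e / 2"] d e(1) by simp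
  qed
  ultimately show "x \<in> frontier \<Omega>" using closure_subset by (auto simp: frontier_def)
qed

section \<open>Tangent vectors and normals in a chart\<close>

lemma depth_has_derivative:
  "(depth has_derivative (\<lambda>v. grad g (base x) \<bullet> fst (T v) - snd (T v))) (at x)"
proof -
  have b: "(base has_derivative (\<lambda>v. fst (T v))) (at x)"
    unfolding base_def
    by (auto intro!: derivative_eq_intros bounded_linear_imp_has_derivative[OF bounded_linear_T])
  have "((\<lambda>x. snd (T x + a)) has_derivative (\<lambda>v. snd (T v))) (at x)"
    by (auto intro!: derivative_eq_intros bounded_linear_imp_has_derivative[OF bounded_linear_T])
  with has_derivative_compose[OF b g_deriv] show ?thesis
    unfolding depth_def by (intro has_derivative_diff) auto
qed

text \<open>The upward normal \<open>(- grad g, 1)\<close> of the graph, normalized and rotated back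
  to the original coordinates; the domain lies below the graph.\<close>

definition chart_normal :: "'a \<times> real \<Rightarrow> 'a \<times> real" where
  "chart_normal x = (1 / sqrt (1 + (norm (grad g (base x)))\<^sup>2)) *\<^sub>R T' (- grad g (base x), 1)"

lemma norm_chart_normal: "norm (chart_normal x) = 1"
proof -
  have "0 < 1 + (norm (grad g (base x)))\<^sup>2" by (simp add: add_pos_nonneg)
  moreover have "norm (- grad g (base x), 1::real) = sqrt (1 + (norm (grad g (base x)))\<^sup>2)"
    by (simp add: norm_Pair add.commute)
  ultimately show ?thesis by (simp add: chart_normal_def)
qed

lemma inner_T'_normal: "v \<bullet> T' (- grad g (base x), 1) = snd (T v) - grad g (base x) \<bullet> fst (T v)"
proof -
  have "v \<bullet> T' (- grad g (base x), 1) = T v \<bullet> (- grad g (base x), 1)"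
    using inner_T[of v "T' (- grad g (base x), 1)"] by simp
  also have "\<dots> = snd (T v) - grad g (base x) \<bullet> fst (T v)"
    by (cases "T v") (simp add: inner_commute)
  finally show ?thesis .
qed

lemma orthogonal_chart_normal_iff:
  "v \<bullet> chart_normal x = 0 \<longleftrightarrow> snd (T v) = grad g (base x) \<bullet> fst (T v)"
proof -
  have "0 < 1 + (norm (grad g (base x)))\<^sup>2" by (simp add: add_pos_nonneg)
  then show ?thesis by (simp add: chart_normal_def inner_T'_normal)
qed

text \<open>The frontier is locally the zero set of \<open>depth\<close>: differentiating
  \<open>depth\<close> along a curve gives one inclusion, lifting a line in the base to the graph
  gives the other.\<close>

lemma tangent_vectors_chart:
  assumes x: "x \<in> U" "x \<in> frontier \<Omega>"
  shows "tangent_vectors (frontier \<Omega>) x = {v. v \<bullet> chart_normal x = 0}"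
proof (intro equalityI subsetI)
  fix v assume "v \<in> tangent_vectors (frontier \<Omega>) x"
  then obtain \<gamma> where \<gamma>: "\<gamma> 0 = x" "\<forall>\<^sub>F t in nhds (0::real). \<gamma> t \<in> frontier \<Omega>" "(\<gamma> has_vector_derivative v) (at 0)"
    unfolding tangent_vectors_def by blast
  have "(\<gamma> \<longlongrightarrow> x) (nhds 0)"
    using has_vector_derivative_continuous[OF \<gamma>(3)] \<gamma>(1) by (simp add: isCont_def tendsto_nhds_iff continuous_at)
  then have "\<forall>\<^sub>F t in nhds 0. \<gamma> t \<in> U" using open_U x(1) by (rule topological_tendstoD)
  with \<gamma>(2) have ev0: "\<forall>\<^sub>F t in nhds 0. depth (\<gamma> t) = 0"
    by eventually_elim (simp add: frontier_iff)
  then have ev: "\<forall>\<^sub>F t in at 0. depth (\<gamma> t) = 0"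
    unfolding eventually_at_filter by (rule eventually_mono) simp
  from ev0 have ev0: "depth (\<gamma> 0) = 0" by (rule eventually_nhds_x_imp_x)
  have "((\<lambda>t. depth (\<gamma> t)) has_derivative (\<lambda>t. grad g (base x) \<bullet> fst (T (t *\<^sub>R v)) - snd (T (t *\<^sub>R v)))) (at 0)"
    using has_derivative_compose[OF \<gamma>(3)[unfolded has_vector_derivative_def] depth_has_derivative] \<gamma>(1) by simp
  then have "((\<lambda>t. 0) has_derivative (\<lambda>t. grad g (base x) \<bullet> fst (T (t *\<^sub>R v)) - snd (T (t *\<^sub>R v)))) (at (0::real))"
    by (rule has_derivative_transform_eventually[OF _ ev]) (use ev0 in auto)
  then have "(\<lambda>t. grad g (base x) \<bullet> fst (T (t *\<^sub>R v)) - snd (T (t *\<^sub>R v))) = (\<lambda>t. 0)"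
    by (rule has_derivative_unique) (rule has_derivative_const)
  from fun_cong[OF this, of 1] show "v \<in> {v. v \<bullet> chart_normal x = 0}"
    by (simp add: orthogonal_chart_normal_iff)
next
  fix v assume "v \<in> {v. v \<bullet> chart_normal x = 0}"
  then have v: "snd (T v) = grad g (base x) \<bullet> fst (T v)" by (simp add: orthogonal_chart_normal_iff)
  define \<gamma> where "\<gamma> t = x + T' (t *\<^sub>R fst (T v), g (base x + t *\<^sub>R fst (T v)) - g (base x))" for t :: real
  have \<gamma>0: "\<gamma> 0 = x" by (simp add: \<gamma>_def linear_0[OF linear_T'] zero_prod_def[symmetric])
  have lin: "((\<lambda>t. base x + t *\<^sub>R fst (T v)) has_derivative (\<lambda>t. t *\<^sub>R fst (T v))) (at 0)"
    by (auto intro!: derivative_eq_intros)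
  have "((\<lambda>t. g (base x + t *\<^sub>R fst (T v))) has_derivative (\<lambda>t. grad g (base x) \<bullet> (t *\<^sub>R fst (T v)))) (at 0)"
    using has_derivative_compose[OF lin g_deriv] by simp
  then have "((\<lambda>t. (t *\<^sub>R fst (T v), g (base x + t *\<^sub>R fst (T v)) - g (base x))) has_derivative
      (\<lambda>t. (t *\<^sub>R fst (T v), grad g (base x) \<bullet> (t *\<^sub>R fst (T v))))) (at 0)"
    by (auto intro!: derivative_eq_intros)
  then have "(\<gamma> has_derivative (\<lambda>t. T' (t *\<^sub>R fst (T v), grad g (base x) \<bullet> (t *\<^sub>R fst (T v))))) (at 0)"
    unfolding \<gamma>_def by (auto intro!: derivative_eq_intros bounded_linear.has_derivative[OF bounded_linear_T'])
  moreover have "T' (t *\<^sub>R fst (T v), grad g (base x) \<bullet> (t *\<^sub>R fst (T v))) = t *\<^sub>R v" for t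
  proof -
    have "(t *\<^sub>R fst (T v), grad g (base x) \<bullet> (t *\<^sub>R fst (T v))) = t *\<^sub>R T v"
      using v by (simp add: prod_eq_iff)
    then show ?thesis by (simp add: linear_scale[OF linear_T'])
  qed
  ultimately have \<gamma>': "(\<gamma> has_vector_derivative v) (at 0)" by (simp add: has_vector_derivative_def)
  have "(\<gamma> \<longlongrightarrow> x) (nhds 0)"
    using has_vector_derivative_continuous[OF \<gamma>'] \<gamma>0 by (simp add: isCont_def tendsto_nhds_iff continuous_at)
  then have "\<forall>\<^sub>F t in nhds 0. \<gamma> t \<in> U" using open_U x(1) by (rule topological_tendstoD)
  moreover have "depth (\<gamma> t) = 0" for t
    using x frontier_iff by (simp add: \<gamma>_def depth_add)
  ultimately have "\<forall>\<^sub>F t in nhds 0. \<gamma> t \<in> frontier \<Omega>"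
    by (auto elim!: eventually_mono simp: frontier_iff)
  then show "v \<in> tangent_vectors (frontier \<Omega>) x"
    unfolding tangent_vectors_def using \<gamma>0 \<gamma>' by blast
qed

text \<open>Orthogonality to the tangent hyperplane leaves two unit vectors. Along
  \<open>chart_normal x\<close> the depth has negative derivative and the ray leaves
  \<open>\<Omega>\<close>; along the opposite vector it enters. Hence the description in
  \<open>outer_normal\<close> determines a unique vector.\<close>

lemma is_unit_outer_normal_chart_iff:
  assumes x: "x \<in> U" "x \<in> frontier \<Omega>"
  shows "is_unit_outer_normal \<Omega> x \<nu> \<longleftrightarrow> \<nu> = chart_normal x"
proof -
  let ?D = "\<lambda>v. grad g (base x) \<bullet> fst (T v) - snd (T v)"
  let ?c = "sqrt (1 + (norm (grad g (base x)))\<^sup>2)"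
  have c: "?c > 0" by (simp add: add_pos_nonneg)
  have d0: "depth x = 0" using x frontier_iff by simp
  have Dn: "?D (chart_normal x) < 0"
  proof -
    have "chart_normal x = (1 / ?c) *\<^sub>R T' (- grad g (base x), 1)" by (simp add: chart_normal_def)
    then have "T (chart_normal x) = (1 / ?c) *\<^sub>R (- grad g (base x), 1)" by (simp add: linear_scale[OF linear_T])
    then have "?D (chart_normal x) = - (1 / ?c) * (1 + (norm (grad g (base x)))\<^sup>2)"
      by (simp add: power2_norm_eq_inner add_divide_distrib)
    also have "\<dots> < 0" using c by (simp add: add_pos_nonneg)
    finally show ?thesis .
  qed
  have line: "((\<lambda>t. depth (x + t *\<^sub>R v)) has_real_derivative ?D v) (at 0)" for v
  proof -
    have l: "((\<lambda>t. x + t *\<^sub>R v) has_derivative (\<lambda>t. t *\<^sub>R v)) (at (0::real))" by (auto intro!: derivative_eq_intros)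
    have "((\<lambda>t. depth (x + t *\<^sub>R v)) has_derivative (\<lambda>t. ?D (t *\<^sub>R v))) (at 0)"
      using has_derivative_compose[OF l, of depth ?D] depth_has_derivative[of x] by simp
    then show ?thesis
      by (rule has_derivative_imp_has_field_derivative) (simp add: linear_scale[OF linear_T] algebra_simps)
  qed
  have inU: "\<forall>\<^sub>F t in at_right 0. x + t *\<^sub>R v \<in> U" for v
  proof -
    have "((\<lambda>t. x + t *\<^sub>R v) \<longlongrightarrow> x + 0 *\<^sub>R v) (at_right 0)" by (intro tendsto_intros)
    then show ?thesis using open_U x(1) by (intro topological_tendstoD) auto
  qed
  have neg: "\<forall>\<^sub>F t in at_right 0. x + t *\<^sub>R v \<notin> \<Omega>" if D: "?D v < 0" for v
  proof -
    obtain e where e: "e > 0" "\<And>h. 0 < h \<Longrightarrow> h < e \<Longrightarrow> depth (x + (0 + h) *\<^sub>R v) < depth (x + 0 *\<^sub>R v)"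
      using DERIV_neg_dec_right[OF line D] by auto
    then have "\<forall>\<^sub>F t in at_right 0. depth (x + t *\<^sub>R v) < 0"
      unfolding eventually_at_right_field using d0 by (intro exI[of _ e]) auto
    with inU[of v] show ?thesis by eventually_elim (simp add: in_\<Omega>_iff)
  qed
  have pos: "\<forall>\<^sub>F t in at_right 0. x + t *\<^sub>R v \<in> \<Omega>" if D: "?D v > 0" for v
  proof -
    obtain e where e: "e > 0" "\<And>h. 0 < h \<Longrightarrow> h < e \<Longrightarrow> depth (x + 0 *\<^sub>R v) < depth (x + (0 + h) *\<^sub>R v)"
      using DERIV_pos_inc_right[OF line D] by auto
    then have "\<forall>\<^sub>F t in at_right 0. depth (x + t *\<^sub>R v) > 0"
      unfolding eventually_at_right_field using d0 by (intro exI[of _ e]) auto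
    with inU[of v] show ?thesis by eventually_elim (simp add: in_\<Omega>_iff)
  qed
  show ?thesis
  proof
    assume \<nu>: "is_unit_outer_normal \<Omega> x \<nu>"
    let ?N = "chart_normal x"
    have nn: "?N \<bullet> ?N = 1" using norm_chart_normal[of x] by (simp add: dot_square_norm)
    \<comment> \<open>\<open>w\<close> is the tangential part of \<open>\<nu>\<close>. Being
      tangent, it is orthogonal to \<open>\<nu>\<close> and therefore to itself.\<close>
    define w where "w = \<nu> - (\<nu> \<bullet> ?N) *\<^sub>R ?N"
    have "w \<bullet> ?N = 0" by (simp add: w_def inner_diff_left nn)
    then have "w \<bullet> \<nu> = 0"
      using \<nu> tangent_vectors_chart[OF x] unfolding is_unit_outer_normal_def by blast
    then have "w \<bullet> w = 0"
      using \<open>w \<bullet> ?N = 0\<close> by (simp add: w_def inner_diff_right)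
    then have \<nu>N: "\<nu> = (\<nu> \<bullet> ?N) *\<^sub>R ?N" by (simp add: w_def)
    have "norm \<nu> = 1" using \<nu> by (simp add: is_unit_outer_normal_def)
    then have "\<bar>\<nu> \<bullet> ?N\<bar> = 1" using \<nu>N norm_chart_normal[of x] by (metis mult.right_neutral norm_scaleR)
    moreover have "\<nu> \<bullet> ?N \<noteq> - 1"
    proof
      assume "\<nu> \<bullet> ?N = - 1"
      then have "\<nu> = - ?N" using \<nu>N by simp
      then have "?D \<nu> > 0" using Dn by (simp add: linear_neg[OF linear_T])
      from pos[OF this] have "\<forall>\<^sub>F t in at_right (0::real). x + t *\<^sub>R \<nu> \<in> \<Omega>" .
      moreover have "\<forall>\<^sub>F t in at_right (0::real). x + t *\<^sub>R \<nu> \<notin> \<Omega>"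
        using \<nu> unfolding is_unit_outer_normal_def by blast
      ultimately have "\<forall>\<^sub>F t in at_right (0::real). False" by eventually_elim blast
      then show False by (simp add: trivial_limit_at_right_real eventually_False)
    qed
    ultimately have "\<nu> \<bullet> ?N = 1" by linarith
    then show "\<nu> = ?N" using \<nu>N by simp
  next
    assume "\<nu> = chart_normal x"
    then show "is_unit_outer_normal \<Omega> x \<nu>"
      unfolding is_unit_outer_normal_def tangent_vectors_chart[OF x]
      using norm_chart_normal neg[OF Dn] by auto
  qed
qed

lemma outer_normal_chart: "x \<in> U \<Longrightarrow> x \<in> frontier \<Omega> \<Longrightarrow> outer_normal \<Omega> x = chart_normal x"
  by (simp add: outer_normal_def is_unit_outer_normal_chart_iff)

lemma continuous_on_outer_normal: "continuous_on (frontier \<Omega> \<inter> U) (outer_normal \<Omega>)"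
proof -
  have "continuous_on (frontier \<Omega> \<inter> U) (\<lambda>x. (1 / sqrt (1 + (norm (grad g (base x)))\<^sup>2)) *\<^sub>R T' (- grad g (base x), 1))"
  proof -
    have c: "continuous_on A (\<lambda>x. grad g (base x))" for A
      by (rule continuous_on_compose2[OF continuous_on_grad[of UNIV] continuous_on_base]) auto
    have nz: "sqrt (1 + (norm (grad g (base x)))\<^sup>2) \<noteq> 0" for x
      by (metis add_pos_nonneg less_irrefl real_sqrt_gt_0_iff zero_le_power2 zero_less_one)
    show ?thesis
      by (intro continuous_intros c continuous_on_compose2[OF continuous_on_T'[of UNIV]]) (use nz in auto)
  qed
  then show ?thesis
    by (rule continuous_on_cong[THEN iffD1, rotated 2]) (auto simp: outer_normal_chart chart_normal_def)
qed

end

lemma vertical_average_cong: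
  assumes "\<Lambda> \<ge> 0" and "\<And>u. 0 \<le> u \<Longrightarrow> u \<le> \<Lambda> \<Longrightarrow> f u = f' u"
  shows "vertical_average N \<Lambda> f h = vertical_average N \<Lambda> f' h"
proof -
  have "f (depth_at \<Lambda> t) = f' (depth_at \<Lambda> t)" for t
    using assms depth_at_bounds[of \<Lambda> t] by blast
  then show ?thesis by (simp add: vertical_average_def)
qed

lemma nn_integral_lborel_reflect:
  fixes f :: "real \<Rightarrow> ennreal"
  assumes "f \<in> borel_measurable borel"
  shows "(\<integral>\<^sup>+x. f (c - x) \<partial>lborel) = (\<integral>\<^sup>+x. f x \<partial>lborel)"
  using nn_integral_real_affine[OF assms, of "- 1" c] by simp

lemma nn_integral_lborel_pair:
  fixes f :: "'a::euclidean_space \<times> 'b::euclidean_space \<Rightarrow> ennreal"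
  assumes "f \<in> borel_measurable borel"
  shows "(\<integral>\<^sup>+x. f x \<partial>lborel) = (\<integral>\<^sup>+u. (\<integral>\<^sup>+v. f (u, v) \<partial>lborel) \<partial>lborel)"
  using lborel.nn_integral_fst[of f lborel] assms by (simp add: lborel_prod)

section \<open>Parabolic shears and vertical averages in a chart\<close>

context boundary_chart
begin

lemma borel_measurable_base [measurable]: "base \<in> borel_measurable borel"
  and borel_measurable_depth [measurable]: "depth \<in> borel_measurable borel"
  and borel_measurable_grad [measurable]: "grad g \<in> borel_measurable borel"
  and borel_measurable_T' [measurable]: "T' \<in> borel_measurable borel"
  and borel_measurable_g [measurable]: "g \<in> borel_measurable borel"
  by (intro borel_measurable_continuous_onI continuous_on_base continuous_on_depth continuous_on_grad continuous_on_T'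
      continuous_on_g)+

text \<open>The quadratic term bends the tangent plane into \<open>\<Omega>\<close>, so that the depth does not decrease along the parabola.\<close>

definition parabola :: "'a \<times> real \<Rightarrow> 'a \<Rightarrow> 'a \<times> real" where
  "parabola x s = x + T' (s, grad g (base x) \<bullet> s - K * (norm s)\<^sup>2)"

text \<open>The Taylor remainder of \<open>g\<close> is at most \<open>K * (norm s)\<^sup>2\<close>
  in absolute value, and the bend adds exactly this quantity to the depth, so the total change is
  nonnegative.\<close>

lemma depth_parabola:
  "depth x \<le> depth (parabola x s)" "depth (parabola x s) \<le> depth x + 2 * K * (norm s)\<^sup>2"
proof -
  have "depth (parabola x s) = depth x + (g (base x + s) - g (base x) - grad g (base x) \<bullet> s) + K * (norm s)\<^sup>2"
    by (simp add: parabola_def depth_add)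
  then show "depth x \<le> depth (parabola x s)" "depth (parabola x s) \<le> depth x + 2 * K * (norm s)\<^sup>2"
    using Taylor_g[of "base x" s] by (auto simp: abs_le_iff)
qed

lemma norm_parabola_diff:
  assumes "norm (grad g (base x)) \<le> L"
  shows "norm (parabola x s - x) \<le> norm s * (1 + L) + K * (norm s)\<^sup>2"
proof -
  have "norm (parabola x s - x) = norm (s, grad g (base x) \<bullet> s - K * (norm s)\<^sup>2)" by (simp add: parabola_def)
  also have "\<dots> \<le> norm s + norm (grad g (base x) \<bullet> s - K * (norm s)\<^sup>2)" by (rule norm_Pair_le)
  also have "norm (grad g (base x) \<bullet> s - K * (norm s)\<^sup>2) \<le> norm (grad g (base x)) * norm s + K * (norm s)\<^sup>2"
    using Cauchy_Schwarz_ineq2[of "grad g (base x)" s] K_pos by (simp add: abs_le_iff) (smt (verit) mult_nonneg_nonneg zero_le_power2)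
  also have "\<dots> \<le> L * norm s + K * (norm s)\<^sup>2" using assms by (intro add_right_mono mult_right_mono) auto
  finally show ?thesis by (simp add: algebra_simps)
qed

lemma base_T' : "base (T' (y - a)) = fst y" and depth_T': "depth (T' (y - a)) = g (fst y) - snd y"
  by (simp_all add: depth_def base_def)

lemma nn_integral_chart:
  fixes W :: "'a \<times> real \<Rightarrow> ennreal"
  assumes W [measurable]: "W \<in> borel_measurable borel"
  shows "(\<integral>\<^sup>+x. W x \<partial>lborel) = (\<integral>\<^sup>+u. (\<integral>\<^sup>+v. W (T' ((u, v) - a)) \<partial>lborel) \<partial>lborel)"
proof -
  have "(\<integral>\<^sup>+x. W x \<partial>lborel) = (\<integral>\<^sup>+y. W (T' y) \<partial>lborel)"
    by (rule nn_integral_lborel_orthogonal[OF orthogonal_T' W, symmetric])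
  also have "\<dots> = (\<integral>\<^sup>+y. W (T' (y - a)) \<partial>lborel)"
    using nn_integral_lborel_translate[of "\<lambda>y. W (T' y)" "- a"] by simp
  also have "\<dots> = (\<integral>\<^sup>+u. (\<integral>\<^sup>+v. W (T' ((u, v) - a)) \<partial>lborel) \<partial>lborel)"
    by (rule nn_integral_lborel_pair) measurable
  finally show ?thesis .
qed

text \<open>In chart coordinates the map adds to the last coordinate a quantity that depends only on
  the base point \<open>u\<close> and the fixed \<open>s\<close>, and shifts \<open>u\<close> by
  \<open>s\<close>. Tonelli's theorem reduces this to two translations.\<close>

lemma nn_integral_parabola:
  fixes W :: "'a \<times> real \<Rightarrow> ennreal"
  assumes W [measurable]: "W \<in> borel_measurable borel"
  shows "(\<integral>\<^sup>+x. W (parabola x s) \<partial>lborel) = (\<integral>\<^sup>+x. W x \<partial>lborel)"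
proof -
  have eq: "parabola (T' ((u, v) - a)) s = T' ((s + u, (grad g u \<bullet> s - K * (norm s)\<^sup>2) + v) - a)" for u v
  proof -
    have "(u, v) - a + (s, grad g u \<bullet> s - K * (norm s)\<^sup>2) = (s + u, (grad g u \<bullet> s - K * (norm s)\<^sup>2) + v) - a"
      by (simp add: prod_eq_iff)
    then show ?thesis unfolding parabola_def base_T' by (simp only: linear_add[OF linear_T', symmetric] fst_conv)
  qed
  have "(\<integral>\<^sup>+x. W (parabola x s) \<partial>lborel) = (\<integral>\<^sup>+u. (\<integral>\<^sup>+v. W (parabola (T' ((u, v) - a)) s) \<partial>lborel) \<partial>lborel)"
    unfolding parabola_def by (rule nn_integral_chart) measurable
  also have "\<dots> = (\<integral>\<^sup>+u. (\<integral>\<^sup>+v. W (T' ((s + u, v) - a)) \<partial>lborel) \<partial>lborel)"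
    unfolding eq by (intro nn_integral_cong nn_integral_lborel_translate) measurable
  also have "\<dots> = (\<integral>\<^sup>+u. (\<integral>\<^sup>+v. W (T' ((u, v) - a)) \<partial>lborel) \<partial>lborel)"
    by (rule nn_integral_lborel_translate) measurable
  finally show ?thesis using nn_integral_chart[OF W] by simp
qed

text \<open>The function is averaged over the vertical line through \<open>x\<close>, parametrized
  by depth, so within one line the value depends on the depth of \<open>x\<close> alone. The
  indicator selects the upper half of the segment, where the vertical bound holds.\<close>

definition vertical_term :: "nat \<Rightarrow> real \<Rightarrow> ('a \<times> real \<Rightarrow> ennreal) \<Rightarrow> 'a \<times> real \<Rightarrow> ennreal" where
  "vertical_term n \<Lambda> F x = indicator {0..\<Lambda> / 2} (depth x) *
     vertical_average n \<Lambda> (\<lambda>u. F (x + (depth x - u) *\<^sub>R T' (0, 1))) (depth x)"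

lemma borel_measurable_vertical_term [measurable]:
  assumes [measurable]: "F \<in> borel_measurable borel"
  shows "vertical_term n \<Lambda> F \<in> borel_measurable borel"
  unfolding vertical_term_def vertical_average_def by measurable

text \<open>On each vertical line the substitution \<open>h = g u - v\<close> turns the last
  coordinate into depth, and the one-dimensional estimate for \<open>vertical_average\<close>
  applies.\<close>

lemma nn_integral_vertical_term:
  assumes F [measurable]: "F \<in> borel_measurable borel" and n: "n \<ge> 1" and L: "\<Lambda> > 0"
  shows "(\<integral>\<^sup>+x. vertical_term n \<Lambda> F x \<partial>lborel) \<le> 2 * (\<integral>\<^sup>+x. F x \<partial>lborel)"
proof -
  let ?F = "\<lambda>u w. F (T' ((u, g u - w) - a))"
  have eq: "vertical_term n \<Lambda> F (T' ((u, v) - a)) =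
      indicator {0..\<Lambda> / 2} (g u - v) * vertical_average n \<Lambda> (?F u) (g u - v)" for u v
  proof -
    have "T' ((u, v) - a) + (g u - v - w) *\<^sub>R T' (0, 1) = T' ((u, g u - w) - a)" for w
    proof -
      have "(u, v) - a + (g u - v - w) *\<^sub>R (0, 1) = (u, g u - w) - a" by (simp add: prod_eq_iff)
      then show ?thesis by (simp only: linear_add[OF linear_T', symmetric] linear_scale[OF linear_T', symmetric])
    qed
    then show ?thesis by (simp add: vertical_term_def depth_T')
  qed
  have "(\<integral>\<^sup>+x. vertical_term n \<Lambda> F x \<partial>lborel) = (\<integral>\<^sup>+u. (\<integral>\<^sup>+v. vertical_term n \<Lambda> F (T' ((u, v) - a)) \<partial>lborel) \<partial>lborel)"
    by (rule nn_integral_chart) measurable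
  also have "\<dots> = (\<integral>\<^sup>+u. (\<integral>\<^sup>+h. indicator {0..\<Lambda> / 2} h * vertical_average n \<Lambda> (?F u) h \<partial>lborel) \<partial>lborel)"
    unfolding eq by (intro nn_integral_cong nn_integral_lborel_reflect) (simp add: vertical_average_def)
  also have "\<dots> \<le> (\<integral>\<^sup>+u. 2 * (\<integral>\<^sup>+w. ?F u w \<partial>lborel) \<partial>lborel)"
  proof (rule nn_integral_mono)
    fix u
    have "(\<integral>\<^sup>+h. indicator {0..\<Lambda> / 2} h * vertical_average n \<Lambda> (?F u) h \<partial>lborel)
        \<le> (\<integral>\<^sup>+h. vertical_average n \<Lambda> (?F u) h * indicator {0..\<Lambda>} h \<partial>lborel)"
      using L by (intro nn_integral_mono) (auto simp: indicator_def)
    also have "\<dots> \<le> 2 * (\<integral>\<^sup>+w. ?F u w * indicator {0..\<Lambda>} w \<partial>lborel)"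
      by (rule nn_integral_vertical_average[OF _ L n]) measurable
    also have "\<dots> \<le> 2 * (\<integral>\<^sup>+w. ?F u w \<partial>lborel)"
      by (intro mult_left_mono nn_integral_mono) (auto simp: indicator_def)
    finally show "(\<integral>\<^sup>+h. indicator {0..\<Lambda> / 2} h * vertical_average n \<Lambda> (?F u) h \<partial>lborel) \<le> 2 * (\<integral>\<^sup>+w. ?F u w \<partial>lborel)" .
  qed
  also have "\<dots> = 2 * (\<integral>\<^sup>+u. (\<integral>\<^sup>+w. ?F u w \<partial>lborel) \<partial>lborel)"
    by (rule nn_integral_cmult) measurable
  also have "(\<integral>\<^sup>+u. (\<integral>\<^sup>+w. ?F u w \<partial>lborel) \<partial>lborel) = (\<integral>\<^sup>+u. (\<integral>\<^sup>+v. F (T' ((u, v) - a)) \<partial>lborel) \<partial>lborel)"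
    by (intro nn_integral_cong nn_integral_lborel_reflect) measurable
  also have "\<dots> = (\<integral>\<^sup>+x. F x \<partial>lborel)" by (rule nn_integral_chart[symmetric, OF F])
  finally show ?thesis .
qed

end

definition cos_vector :: "real \<Rightarrow> ('a::euclidean_space \<Rightarrow> real) \<Rightarrow> 'a" where
  "cos_vector c \<theta> = (\<Sum>i\<in>Basis. (c * cos (2 * pi * \<theta> i)) *\<^sub>R i)"

lemma inner_cos_vector: "i \<in> Basis \<Longrightarrow> cos_vector c \<theta> \<bullet> i = c * cos (2 * pi * \<theta> i)"
  by (simp add: cos_vector_def)

lemma norm_cos_vector:
  assumes "c \<ge> 0"
  shows "norm (cos_vector c \<theta> :: 'a::euclidean_space) \<le> real DIM('a) * c"
proof -
  have "norm (cos_vector c \<theta> :: 'a) \<le> (\<Sum>i\<in>(Basis::'a set). c)"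
    unfolding cos_vector_def using assms by (intro sum_norm_le) (auto simp: abs_mult mult_left_le)
  then show ?thesis by simp
qed

lemma borel_measurable_cos_vector [measurable]:
  "cos_vector c \<in> borel_measurable (cos_product (Basis :: 'a::euclidean_space set) N)"
proof -
  have "(\<lambda>\<theta>. \<theta> i) \<in> borel_measurable (cos_product (Basis :: 'a set) N)" if "i \<in> Basis" for i :: 'a
    unfolding cos_product_def
    by (subst measurable_cong_sets[OF refl sets_cos_measure[symmetric]]) (rule measurable_component_singleton[OF that])
  then show ?thesis unfolding cos_vector_def by (intro borel_measurable_sum) (auto intro!: borel_measurable_scaleR)
qed

text \<open>For fixed angles the integral of \<open>W\<close> is unchanged by \<open>S\<close>, and
  the angles have total mass one. Abstracting \<open>S\<close> covers both translations in the
  interior and parabolas near the boundary.\<close>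

lemma nn_integral_cos_product_average:
  fixes W :: "'b::euclidean_space \<Rightarrow> ennreal" and S :: "'b \<Rightarrow> 'a::euclidean_space \<Rightarrow> 'b"
  assumes [measurable]: "W \<in> borel_measurable borel" "(\<lambda>x. S (fst x) (snd x)) \<in> borel_measurable borel"
    and N: "N \<ge> 1" and S: "\<And>s. (\<integral>\<^sup>+x. W (S x s) \<partial>lborel) = (\<integral>\<^sup>+x. W x \<partial>lborel)"
  shows "(\<lambda>x. \<integral>\<^sup>+\<theta>. W (S x (cos_vector c \<theta>)) \<partial>cos_product Basis N) \<in> borel_measurable borel"
    and "(\<integral>\<^sup>+x. (\<integral>\<^sup>+\<theta>. W (S x (cos_vector c \<theta>)) \<partial>cos_product Basis N) \<partial>lborel) = (\<integral>\<^sup>+x. W x \<partial>lborel)"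
proof -
  interpret C: prob_space "cos_product (Basis :: 'a set) N" using N by (rule prob_space_cos_product)
  interpret pair_sigma_finite "cos_product (Basis :: 'a set) N" "lborel :: 'b measure" by unfold_locales
  have 1: "(\<lambda>x. W (S (fst x) (snd x))) \<in> borel_measurable (borel \<Otimes>\<^sub>M borel)"
    unfolding borel_prod by measurable
  have 2: "(\<lambda>x. (fst x, cos_vector c (snd x))) \<in> lborel \<Otimes>\<^sub>M cos_product (Basis :: 'a set) N \<rightarrow>\<^sub>M borel \<Otimes>\<^sub>M borel"
    by measurable
  have m: "(\<lambda>x. W (S (fst x) (cos_vector c (snd x)))) \<in> borel_measurable (lborel \<Otimes>\<^sub>M cos_product Basis N)"
    using measurable_compose[OF 2 1] by simp
  have m': "(\<lambda>x. W (S (snd x) (cos_vector c (fst x)))) \<in> borel_measurable (cos_product Basis N \<Otimes>\<^sub>M lborel)"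
    using measurable_compose[OF measurable_pair_swap' m] by (simp add: split_def)
  show "(\<lambda>x. \<integral>\<^sup>+\<theta>. W (S x (cos_vector c \<theta>)) \<partial>cos_product Basis N) \<in> borel_measurable borel"
    using C.borel_measurable_nn_integral_fst[OF m] by simp
  have "(\<integral>\<^sup>+x. (\<integral>\<^sup>+\<theta>. W (S x (cos_vector c \<theta>)) \<partial>cos_product Basis N) \<partial>lborel) =
      (\<integral>\<^sup>+\<theta>. (\<integral>\<^sup>+x. W (S x (cos_vector c \<theta>)) \<partial>lborel) \<partial>cos_product Basis N)"
    using Fubini'[of "\<lambda>\<theta> x. W (S x (cos_vector c \<theta>))"] m' by (simp add: split_def)
  also have "\<dots> = (\<integral>\<^sup>+x. W x \<partial>lborel)"
    unfolding S by (simp add: C.emeasure_space_1)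
  finally show "(\<integral>\<^sup>+x. (\<integral>\<^sup>+\<theta>. W (S x (cos_vector c \<theta>)) \<partial>cos_product Basis N) \<partial>lborel) = (\<integral>\<^sup>+x. W x \<partial>lborel)" .
qed

lemma ccoords_add: "ccoords (x + y) b = ccoords x b + ccoords y b"
  and ccoords_scaleR: "ccoords (r *\<^sub>R x) b = of_real r * ccoords x b"
  and ccoords_sum: "ccoords (\<Sum>i\<in>A. h i) b = (\<Sum>i\<in>A. ccoords (h i) b)"
  and ccoords_diff: "ccoords (x - y) b = ccoords x b - ccoords y b"
  by (auto simp: ccoords_def inner_add_left inner_sum_left inner_diff_left)

section \<open>Complex offsets in chart coordinates\<close>

context boundary_chart
begin

lemma T'_Pair: "T' (s, y) = (\<Sum>i\<in>Basis. (s \<bullet> i) *\<^sub>R T' (i, 0)) + y *\<^sub>R T' (0, 1)"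
proof -
  have "(s, y) = (\<Sum>i\<in>Basis. (s \<bullet> i) *\<^sub>R (i, 0)) + y *\<^sub>R (0, 1)"
    by (simp add: prod_eq_iff fst_sum snd_sum euclidean_representation)
  then show ?thesis
    by (simp only: linear_add[OF linear_T'] linear_sum[OF linear_T'] linear_scale[OF linear_T'] o_def)
qed

text \<open>The complexified endpoint of the parabola, with a further offset \<open>t\<close>
  counted downwards, in the sense of depth. The sum of the squares of the \<open>s i\<close>
  replaces the squared norm, because it is polynomial in complex \<open>s\<close>.\<close>

definition chart_offset :: "'a \<times> real \<Rightarrow> complex \<Rightarrow> ('a \<Rightarrow> complex) \<Rightarrow> 'a \<times> real \<Rightarrow> complex" where
  "chart_offset x t s = (\<lambda>b. ccoords x b + (\<Sum>i\<in>Basis. s i * ccoords (T' (i, 0)) b) +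
     ((\<Sum>i\<in>Basis. s i * of_real (grad g (base x) \<bullet> i)) - of_real K * (\<Sum>i\<in>Basis. (s i)\<^sup>2) - t) * ccoords (T' (0, 1)) b)"

lemma chart_offset_real:
  "chart_offset x t (\<lambda>i. of_real (s \<bullet> i)) = (\<lambda>b. ccoords (parabola x s) b - t * ccoords (T' (0, 1)) b)"
proof
  fix b :: "'a \<times> real"
  have n: "(norm s)\<^sup>2 = (\<Sum>i\<in>Basis. (s \<bullet> i)\<^sup>2)"
    unfolding power2_norm_eq_inner by (subst euclidean_inner) (simp add: power2_eq_square)
  have i: "grad g (base x) \<bullet> s = (\<Sum>i\<in>Basis. (s \<bullet> i) * (grad g (base x) \<bullet> i))"
    by (simp add: euclidean_inner[of "grad g (base x)" s] mult.commute)
  show "chart_offset x t (\<lambda>i. of_real (s \<bullet> i)) b = ccoords (parabola x s) b - t * ccoords (T' (0, 1)) b"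
    unfolding parabola_def T'_Pair[of s] n i
    by (simp add: chart_offset_def ccoords_add ccoords_diff ccoords_sum ccoords_scaleR algebra_simps)
qed

text \<open>The quadratic bend doubles the degree; this is why the kernels in the parabola
  parameters have order \<open>n * 2\<close>.\<close>

lemma cpoly_chart_offset:
  assumes "cpoly n F"
  shows "cpoly (n * 2) (\<lambda>s. F (chart_offset x t s))"
proof -
  have "cpoly 2 (\<lambda>s. chart_offset x t s b)" for b
    unfolding chart_offset_def diff_conv_add_uminus
    by (intro cpoly.add cpoly_sum cpoly.const cpoly.mult[of 2 _ 0 _ 2] cpoly.mult[of 1 _ 0 _ 2] cpoly_power[of 1] cpoly.var
        cpoly.mult[of 0 _ 2 _ 2, OF cpoly.const, of _ "- of_real K", simplified]) auto
  then show ?thesis by (rule cpoly_compose[OF assms])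
qed

text \<open>A single point \<open>x\<close> of a chart is fixed. \<open>small1\<close> keeps the
  parabolas in the upper half of the depth range, \<open>small2\<close> keeps the vertical segments
  through them in the chart, and \<open>t\<close> is restricted on the scale that belongs to the
  depth of \<open>x\<close>.\<close>

context
  fixes n :: nat and F :: "('a \<times> real \<Rightarrow> complex) \<Rightarrow> complex" and f :: "'a \<times> real \<Rightarrow> real"
    and x :: "'a \<times> real" and \<delta> L c \<Lambda> :: real and t :: complex
  assumes F: "cpoly n F" and f: "complexifies F f" and n: "n \<ge> 1"
    and x: "x \<in> \<Omega>" "ball x \<delta> \<subseteq> U" and \<delta>: "\<delta> > 0" and L: "norm (grad g (base x)) \<le> L"
    and c: "c > 0" and \<Lambda>: "0 < \<Lambda>" "\<Lambda> \<le> 2"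
    and small1: "depth x + 2 * K * (real DIM('a) * c)\<^sup>2 \<le> \<Lambda> / 2"
    and small2: "real DIM('a) * c * (1 + L) + K * (real DIM('a) * c)\<^sup>2 + \<Lambda> < \<delta>"
    and t: "norm t \<le> \<Lambda> * (sqrt (depth x) + 1 / real n) / (2048 * real n)"
begin

lemma depth_x: "depth x \<ge> 0"
proof -
  have "x \<in> U" using x(2) \<delta> centre_in_ball by blast
  then show ?thesis using x(1) in_\<Omega>_iff by simp
qed

lemma parabola_small:
  assumes s: "norm s \<le> real DIM('a) * c"
  shows "0 \<le> depth (parabola x s)" and "depth (parabola x s) \<le> \<Lambda> / 2" and "depth x \<le> depth (parabola x s)"
    and "0 \<le> u \<Longrightarrow> u \<le> \<Lambda> \<Longrightarrow> parabola x s + (depth (parabola x s) - u) *\<^sub>R T' (0, 1) \<in> \<Omega>"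
proof -
  let ?y = "parabola x s"
  have s2: "(norm s)\<^sup>2 \<le> (real DIM('a) * c)\<^sup>2" using s by (intro power_mono) auto
  have Ks: "K * (norm s)\<^sup>2 \<le> K * (real DIM('a) * c)\<^sup>2" using s2 K_pos by (intro mult_left_mono) auto
  show d1: "depth x \<le> depth ?y" by (rule depth_parabola)
  then show d0: "0 \<le> depth ?y" using depth_x by simp
  show d2: "depth ?y \<le> \<Lambda> / 2" using depth_parabola(2)[of x s] small1 Ks by simp
  assume u: "0 \<le> u" "u \<le> \<Lambda>"
  let ?z = "?y + (depth ?y - u) *\<^sub>R T' (0, 1)"
  have "L \<ge> 0" using L norm_ge_zero order_trans by blast
  have "norm (?z - x) \<le> norm (?y - x) + norm ((depth ?y - u) *\<^sub>R T' (0, 1))"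
    using norm_triangle_ineq[of "?y - x" "(depth ?y - u) *\<^sub>R T' (0, 1)"] by (simp add: algebra_simps)
  also have "norm (?y - x) \<le> norm s * (1 + L) + K * (norm s)\<^sup>2" by (rule norm_parabola_diff[OF L])
  also have "\<dots> \<le> real DIM('a) * c * (1 + L) + K * (real DIM('a) * c)\<^sup>2"
    using Ks s \<open>L \<ge> 0\<close> by (intro add_mono mult_right_mono) auto
  also have "norm ((depth ?y - u) *\<^sub>R T' (0, 1)) \<le> \<Lambda>"
    using u d0 d2 by (simp add: abs_le_iff)
  finally have "norm (?z - x) < \<delta>" using small2 by simp
  then have "?z \<in> U" using x(2) by (auto simp: dist_norm norm_minus_commute)
  moreover have "depth ?z = u" by (simp add: depth_up)
  ultimately show "?z \<in> \<Omega>" using u in_\<Omega>_iff by simp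
qed

text \<open>The variable of \<open>q\<close> is depth: its origin is the point \<open>?top\<close>
  of depth 0, and the line is followed downwards, complex displacements \<open>h\<close>
  included.\<close>

lemma vertical_poly:
  obtains q where "degree q \<le> n"
    and "\<And>h. poly q (of_real (depth y) + h) = F (\<lambda>b. ccoords y b - h * ccoords (T' (0, 1)) b)"
    and "\<And>u. poly q (of_real u) = of_real (f (y + (depth y - u) *\<^sub>R T' (0, 1)))"
proof -
  let ?top = "y + depth y *\<^sub>R T' (0, 1)"
  have "\<exists>q. degree q \<le> 1 \<and> (\<forall>z. ccoords ?top b - z * ccoords (T' (0, 1)) b = poly q z)" for b
    by (rule exI[of _ "[:ccoords ?top b, - ccoords (T' (0, 1)) b:]"]) auto
  from cpoly_univariate[where g = "\<lambda>b z. ccoords ?top b - z * ccoords (T' (0, 1)) b", OF F this]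
  obtain q where q: "degree q \<le> n" "\<And>z. F (\<lambda>b. ccoords ?top b - z * ccoords (T' (0, 1)) b) = poly q z" by auto
  show ?thesis
  proof (rule that[OF q(1)])
    fix h :: complex
    have "(\<lambda>b. ccoords ?top b - (of_real (depth y) + h) * ccoords (T' (0, 1)) b) = (\<lambda>b. ccoords y b - h * ccoords (T' (0, 1)) b)"
      unfolding fun_eq_iff by (simp add: ccoords_add ccoords_diff ccoords_scaleR algebra_simps)
    then show "poly q (of_real (depth y) + h) = F (\<lambda>b. ccoords y b - h * ccoords (T' (0, 1)) b)"
      using q(2)[of "of_real (depth y) + h"] by simp
  next
    fix u :: real
    have "(\<lambda>b. ccoords ?top b - of_real u * ccoords (T' (0, 1)) b) = ccoords (y + (depth y - u) *\<^sub>R T' (0, 1))"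
      unfolding fun_eq_iff by (simp add: ccoords_add ccoords_diff ccoords_scaleR algebra_simps)
    then show "poly q (of_real u) = of_real (f (y + (depth y - u) *\<^sub>R T' (0, 1)))"
      using q(2)[of "of_real u"] f[unfolded complexifies_def, rule_format, of "y + (depth y - u) *\<^sub>R T' (0, 1)"] by simp
  qed
qed

text \<open>Because the depth does not decrease along the parabola, the disc for \<open>t\<close> at
  \<open>x\<close> is contained in the one at the parabola point.\<close>

lemma vertical_offset_bound:
  assumes s: "norm s \<le> real DIM('a) * c" and p: "p > 0"
  shows "ennreal (norm (F (\<lambda>b. ccoords (parabola x s) b - t * ccoords (T' (0, 1)) b)) powr p) \<le> ennreal (36 * 8 powr p) *
      vertical_term n \<Lambda> (\<lambda>y. ennreal (\<bar>f y\<bar> powr p) * indicator \<Omega> y) (parabola x s)"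
    and "(\<And>y. y \<in> \<Omega> \<Longrightarrow> \<bar>f y\<bar> \<le> X) \<Longrightarrow> norm (F (\<lambda>b. ccoords (parabola x s) b - t * ccoords (T' (0, 1)) b)) \<le> 24 * X"
proof -
  let ?y = "parabola x s"
  note small = parabola_small[OF s]
  obtain q where q: "degree q \<le> n"
    and q1: "\<And>h. poly q (of_real (depth ?y) + h) = F (\<lambda>b. ccoords ?y b - h * ccoords (T' (0, 1)) b)"
    and q2: "\<And>u. poly q (of_real u) = of_real (f (?y + (depth ?y - u) *\<^sub>R T' (0, 1)))"
    by (rule vertical_poly[of ?y]) blast
  have "\<Lambda> * (sqrt (depth x) + 1 / real n) / (2048 * real n) \<le> \<Lambda> * (sqrt (depth ?y) + 1 / real n) / (2048 * real n)"
    using small(3) \<Lambda> by (intro divide_right_mono mult_left_mono add_right_mono real_sqrt_le_mono) auto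
  with t have t': "norm t \<le> \<Lambda> * (sqrt (depth ?y) + 1 / real n) / (2048 * real n)" by linarith
  have "ennreal (norm (poly q (of_real (depth ?y) + t)) powr p) \<le> ennreal (36 * 8 powr p) *
      vertical_average n \<Lambda> (\<lambda>u. ennreal (norm (poly q (of_real u)) powr p)) (depth ?y)"
    by (rule vertical_average_bound[OF \<Lambda> small(1,2) n q p t'])
  also have "vertical_average n \<Lambda> (\<lambda>u. ennreal (norm (poly q (of_real u)) powr p)) (depth ?y) =
      vertical_term n \<Lambda> (\<lambda>y. ennreal (\<bar>f y\<bar> powr p) * indicator \<Omega> y) ?y"
    unfolding vertical_term_def using small \<Lambda>
    by (subst vertical_average_cong[where f' = "\<lambda>u. ennreal (norm (poly q (of_real u)) powr p)"]) (auto simp: q2)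
  finally show "ennreal (norm (F (\<lambda>b. ccoords ?y b - t * ccoords (T' (0, 1)) b)) powr p) \<le> ennreal (36 * 8 powr p) *
      vertical_term n \<Lambda> (\<lambda>y. ennreal (\<bar>f y\<bar> powr p) * indicator \<Omega> y) ?y" unfolding q1 .
  assume X: "\<And>y. y \<in> \<Omega> \<Longrightarrow> \<bar>f y\<bar> \<le> X"
  have "norm (poly q (of_real (depth ?y) + t)) \<le> 24 * X"
    by (rule vertical_sup_bound[OF \<Lambda> small(1,2) n q t']) (use small(4) X in \<open>auto simp: q2\<close>)
  then show "norm (F (\<lambda>b. ccoords ?y b - t * ccoords (T' (0, 1)) b)) \<le> 24 * X" unfolding q1 .
qed

text \<open>The parabola parameters are made real first, for fixed complex \<open>t\<close>. Each
  real choice gives a point of \<open>\<Omega>\<close> from which only the vertical offset is still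
  complex, and the vertical bound removes it. The supremum version uses exponent 1 and total mass
  one.\<close>

lemma chart_offset_bound:
  assumes s: "\<And>i. i \<in> Basis \<Longrightarrow> norm (s i) \<le> c / (1024 * real (n * 2))" and p: "p > 0"
  shows "ennreal (norm (F (chart_offset x t s)) powr p) \<le> ennreal (3 * 8 powr p) ^ DIM('a) * (ennreal (36 * 8 powr p) *
      (\<integral>\<^sup>+\<theta>. vertical_term n \<Lambda> (\<lambda>y. ennreal (\<bar>f y\<bar> powr p) * indicator \<Omega> y) (parabola x (cos_vector c \<theta>))
        \<partial>cos_product Basis (n * 2)))"
    and "(\<And>y. y \<in> \<Omega> \<Longrightarrow> \<bar>f y\<bar> \<le> X) \<Longrightarrow> norm (F (chart_offset x t s)) \<le> 24 ^ DIM('a) * (24 * X)"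
proof -
  define N where "N = n * 2"
  have N: "N \<ge> 1" using n by (simp add: N_def)
  let ?z = "\<lambda>(\<theta> :: 'a \<Rightarrow> real) i. if i \<in> Basis then complex_of_real (c * cos (2 * pi * \<theta> i)) else s i"
  let ?v = "\<lambda>\<theta>. cos_vector c \<theta> :: 'a"
  have Fz: "F (chart_offset x t (?z \<theta>)) = F (\<lambda>b. ccoords (parabola x (?v \<theta>)) b - t * ccoords (T' (0, 1)) b)" for \<theta>
  proof -
    have "chart_offset x t (?z \<theta>) = chart_offset x t (\<lambda>i. of_real (?v \<theta> \<bullet> i))"
      by (auto simp: chart_offset_def fun_eq_iff inner_cos_vector cong: sum.cong)
    then show ?thesis by (simp only: chart_offset_real)
  qed
  have v: "norm (?v \<theta>) \<le> real DIM('a) * c" for \<theta> by (rule norm_cos_vector) (use c in simp)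
  have B: "ennreal (norm (F (chart_offset x t s)) powr q) \<le> ennreal (3 * 8 powr q) ^ DIM('a) *
    (\<integral>\<^sup>+\<theta>. ennreal (norm (F (\<lambda>b. ccoords (parabola x (?v \<theta>)) b - t * ccoords (T' (0, 1)) b)) powr q) \<partial>cos_product Basis N)"
    if "q > 0" for q
    using cpoly_cos_product_bound[OF finite_Basis cpoly_chart_offset[OF F, of x t] _ that c, of s] s N
    unfolding Fz N_def by simp
  have [measurable]: "f \<in> borel_measurable borel"
  proof -
    have "(f has_derivative (\<lambda>v. Re (cderiv (ccoords v) F (ccoords y)))) (at y)" for y
      by (rule complexifies_has_derivative[OF F f])
    then have "continuous_on UNIV f" by (meson continuous_at_imp_continuous_on has_derivative_continuous)
    then show ?thesis by (rule borel_measurable_continuous_onI)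
  qed
  have [measurable]: "\<Omega> \<in> sets borel" using closed_\<Omega> by simp
  let ?W = "vertical_term n \<Lambda> (\<lambda>y. ennreal (\<bar>f y\<bar> powr p) * indicator \<Omega> y)"
  have m: "(\<lambda>\<theta>. ?W (parabola x (?v \<theta>))) \<in> borel_measurable (cos_product Basis N)"
    unfolding parabola_def by measurable
  have "(\<integral>\<^sup>+\<theta>. ennreal (norm (F (\<lambda>b. ccoords (parabola x (?v \<theta>)) b - t * ccoords (T' (0, 1)) b)) powr p) \<partial>cos_product Basis N)
      \<le> (\<integral>\<^sup>+\<theta>. ennreal (36 * 8 powr p) * ?W (parabola x (?v \<theta>)) \<partial>cos_product Basis N)"
    by (intro nn_integral_mono vertical_offset_bound(1) v p)
  also have "\<dots> = ennreal (36 * 8 powr p) * (\<integral>\<^sup>+\<theta>. ?W (parabola x (?v \<theta>)) \<partial>cos_product Basis N)"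
    by (rule nn_integral_cmult[OF m])
  finally show "ennreal (norm (F (chart_offset x t s)) powr p) \<le> ennreal (3 * 8 powr p) ^ DIM('a) * (ennreal (36 * 8 powr p) *
      (\<integral>\<^sup>+\<theta>. ?W (parabola x (?v \<theta>)) \<partial>cos_product Basis (n * 2)))"
    using order_trans[OF B[OF p] mult_left_mono] unfolding N_def by simp
  assume X: "\<And>y. y \<in> \<Omega> \<Longrightarrow> \<bar>f y\<bar> \<le> X"
  have X0: "X \<ge> 0" using X[OF x(1)] by simp
  have "(\<integral>\<^sup>+\<theta>. ennreal (norm (F (\<lambda>b. ccoords (parabola x (?v \<theta>)) b - t * ccoords (T' (0, 1)) b)) powr 1) \<partial>cos_product Basis N)
      \<le> (\<integral>\<^sup>+\<theta>. ennreal (24 * X) \<partial>cos_product (Basis :: 'a set) N)"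
    using vertical_offset_bound(2)[OF v zero_less_one X] by (intro nn_integral_mono) (simp add: ennreal_leI)
  also have "\<dots> = ennreal (24 * X)"
    using prob_space.emeasure_space_1[OF prob_space_cos_product[OF N, of "Basis :: 'a set"]] by simp
  finally have "ennreal (norm (F (chart_offset x t s))) \<le> ennreal (3 * 8 powr 1) ^ DIM('a) * ennreal (24 * X)"
    using order_trans[OF B[OF zero_less_one] mult_left_mono] by simp
  also have "\<dots> = ennreal (24 ^ DIM('a) * (24 * X))"
    by (subst ennreal_power, simp, subst ennreal_mult'[symmetric]) (use X0 in auto)
  finally show "norm (F (chart_offset x t s)) \<le> 24 ^ DIM('a) * (24 * X)"
    using X0 by (simp add: ennreal_le_iff)
qed

end

end

section \<open>Bounds on pieces of the domain\<close>

text \<open>All derivatives entering \<open>max_deriv\<close> at \<open>\<xi>\<close> are controlled, via Cauchy's inequalities, by the values of the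
  complexified polynomial on this set.\<close>

definition deriv_box :: "'a::euclidean_space set \<Rightarrow> nat \<Rightarrow> real \<Rightarrow> real \<Rightarrow> 'a \<Rightarrow> ('a \<Rightarrow> complex) set" where
  "deriv_box \<Omega> n \<mu> \<rho> \<xi> = {(\<lambda>b. ccoords \<xi> b + z * ccoords \<tau> b + w * ccoords (outer_normal \<Omega> \<eta>) b) | z w \<tau> \<eta>.
     \<eta> \<in> near_boundary \<Omega> n \<mu> \<xi> \<and> \<tau> \<in> unit_tangents \<Omega> \<eta> \<and>
     norm z \<le> \<rho> / real n \<and> norm w \<le> \<rho> * phi \<Omega> n \<xi> / real n}"

lemma phi_ge: "1 / real n \<le> phi \<Omega> n \<xi>"
  by (simp add: phi_def infdist_nonneg)

lemma deriv_box_mono: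
  assumes "\<rho> \<le> \<rho>'"
  shows "deriv_box \<Omega> n \<mu> \<rho> \<xi> \<subseteq> deriv_box \<Omega> n \<mu> \<rho>' \<xi>"
proof -
  have "0 \<le> phi \<Omega> n \<xi>" using phi_ge[of n \<Omega> \<xi>] by (metis order_trans of_nat_0_le_iff divide_nonneg_nonneg zero_le_one)
  then have "\<rho> * phi \<Omega> n \<xi> / real n \<le> \<rho>' * phi \<Omega> n \<xi> / real n" "\<rho> / real n \<le> \<rho>' / real n"
    using assms by (auto intro!: divide_right_mono mult_right_mono)
  then show ?thesis unfolding deriv_box_def by (blast intro: order_trans)
qed

lemma unit_tangents_nonempty:
  fixes \<eta> :: "'a::euclidean_space"
  assumes "DIM('a) \<ge> 2"
  shows "unit_tangents \<Omega> \<eta> \<noteq> {}"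
proof -
  obtain y where y: "y \<noteq> 0" "orthogonal (outer_normal \<Omega> \<eta>) y"
    using orthogonal_to_vector_exists[OF assms] by blast
  then have "(1 / norm y) *\<^sub>R y \<in> unit_tangents \<Omega> \<eta>"
    by (simp add: unit_tangents_def orthogonal_def inner_commute)
  then show ?thesis by blast
qed

text \<open>Cauchy's inequality produces
  \<open>(n / \<rho>) ^ (r + j + l) / \<phi> ^ (j + l)\<close>. The weight \<open>\<phi> ^ j\<close>
  cancels \<open>j\<close> of the denominators, and each of the other \<open>l\<close> factors
  \<open>1 / \<phi>\<close> is at most \<open>n\<close> by \<open>phi_ge\<close>.\<close>

lemma max_deriv_bound:
  fixes f :: "'a::euclidean_space \<Rightarrow> real"
  assumes dim: "DIM('a) \<ge> 2" and F: "cpoly N F" and f: "complexifies F f" and n: "n \<ge> 1" and \<rho>: "0 < \<rho>"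
    and X0: "X \<ge> 0" and X: "\<And>\<zeta>. \<zeta> \<in> deriv_box \<Omega> n \<mu> \<rho> \<xi> \<Longrightarrow> norm (F \<zeta>) \<le> X"
  shows "\<bar>phi \<Omega> n \<xi> ^ j * max_deriv \<Omega> n \<mu> r (j + l) f \<xi>\<bar>
    \<le> fact r * fact (j + l) / \<rho> ^ (r + (j + l)) * real n ^ (r + j + 2 * l) * X"
proof -
  define \<phi> where "\<phi> = phi \<Omega> n \<xi>"
  have n0: "real n > 0" using n by simp
  have \<phi>: "1 / real n \<le> \<phi>" unfolding \<phi>_def by (rule phi_ge)
  then have \<phi>0: "\<phi> > 0" using n0 by (smt (verit) divide_pos_pos)
  define B where "B = fact r * fact (j + l) * X / ((\<rho> / real n) ^ r * (\<rho> * \<phi> / real n) ^ (j + l))"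
  have B0: "B \<ge> 0" unfolding B_def using X0 \<rho> n0 \<phi>0 by simp
  let ?d = "\<lambda>\<eta> \<tau>. \<bar>(dir_deriv \<tau> ^^ r) ((dir_deriv (outer_normal \<Omega> \<eta>) ^^ (j + l)) f) \<xi>\<bar>"
  have dB: "?d \<eta> \<tau> \<le> B" if "\<eta> \<in> near_boundary \<Omega> n \<mu> \<xi>" "\<tau> \<in> unit_tangents \<Omega> \<eta>" for \<eta> \<tau>
    unfolding B_def
  proof (rule dir_deriv_Cauchy[OF F f])
    fix z w :: complex
    assume "norm z \<le> \<rho> / real n" "norm w \<le> \<rho> * \<phi> / real n"
    then show "norm (F (\<lambda>b. ccoords \<xi> b + z * ccoords \<tau> b + w * ccoords (outer_normal \<Omega> \<eta>) b)) \<le> X"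
      using that unfolding \<phi>_def by (intro X) (unfold deriv_box_def, blast)
  qed (use \<rho> n0 \<phi>0 in auto)
  \<comment> \<open>A real supremum is controlled only over a nonempty index set with bounded
    values; the dimension hypothesis supplies a unit tangent vector.\<close>
  have S: "0 \<le> (SUP \<tau>\<in>unit_tangents \<Omega> \<eta>. ?d \<eta> \<tau>) \<and> (SUP \<tau>\<in>unit_tangents \<Omega> \<eta>. ?d \<eta> \<tau>) \<le> B"
    if \<eta>: "\<eta> \<in> near_boundary \<Omega> n \<mu> \<xi>" for \<eta>
  proof -
    obtain \<tau> where \<tau>: "\<tau> \<in> unit_tangents \<Omega> \<eta>" using unit_tangents_nonempty[OF dim] by blast
    have "bdd_above (?d \<eta> ` unit_tangents \<Omega> \<eta>)" using dB[OF \<eta>] by (auto intro!: bdd_aboveI)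
    then have "?d \<eta> \<tau> \<le> (SUP \<tau>\<in>unit_tangents \<Omega> \<eta>. ?d \<eta> \<tau>)" using \<tau> by (intro cSUP_upper)
    moreover have "(SUP \<tau>\<in>unit_tangents \<Omega> \<eta>. ?d \<eta> \<tau>) \<le> B" using \<tau> dB[OF \<eta>] by (intro cSUP_least) auto
    ultimately show ?thesis by (meson abs_ge_zero order_trans)
  qed
  have md: "0 \<le> max_deriv \<Omega> n \<mu> r (j + l) f \<xi> \<and> max_deriv \<Omega> n \<mu> r (j + l) f \<xi> \<le> B"
  proof (cases "near_boundary \<Omega> n \<mu> \<xi> = {}")
    case False
    then obtain \<eta> where \<eta>: "\<eta> \<in> near_boundary \<Omega> n \<mu> \<xi>" by blast
    let ?S = "\<lambda>\<eta>. SUP \<tau>\<in>unit_tangents \<Omega> \<eta>. ?d \<eta> \<tau>"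
    have "bdd_above (?S ` near_boundary \<Omega> n \<mu> \<xi>)" using S by (auto intro!: bdd_aboveI)
    then have "?S \<eta> \<le> (SUP \<eta>\<in>near_boundary \<Omega> n \<mu> \<xi>. ?S \<eta>)" using \<eta> by (intro cSUP_upper)
    moreover have "(SUP \<eta>\<in>near_boundary \<Omega> n \<mu> \<xi>. ?S \<eta>) \<le> B" using \<eta> S by (rule_tac cSUP_least) auto
    ultimately show ?thesis using S[OF \<eta>] False by (auto simp: max_deriv_def)
  qed (use B0 in \<open>simp add: max_deriv_def\<close>)
  have "\<bar>\<phi> ^ j * max_deriv \<Omega> n \<mu> r (j + l) f \<xi>\<bar> = \<phi> ^ j * max_deriv \<Omega> n \<mu> r (j + l) f \<xi>"
    using md \<phi>0 by simp
  also have "\<dots> \<le> \<phi> ^ j * B" using md \<phi>0 by (intro mult_left_mono) auto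
  also have "\<dots> = fact r * fact (j + l) / \<rho> ^ (r + (j + l)) * (real n ^ (r + j + l) * (1 / \<phi>) ^ l) * X"
    using \<phi>0 n0 \<rho> unfolding B_def by (simp add: power_add power_mult_distrib power_divide field_simps)
  also have "\<dots> \<le> fact r * fact (j + l) / \<rho> ^ (r + (j + l)) * real n ^ (r + j + 2 * l) * X"
  proof (intro mult_right_mono[OF mult_left_mono])
    have "1 / \<phi> \<le> real n" using \<phi> \<phi>0 n0 by (simp add: field_simps)
    then have "(1 / \<phi>) ^ l \<le> real n ^ l" using \<phi>0 by (intro power_mono) auto
    then have "real n ^ (r + j + l) * (1 / \<phi>) ^ l \<le> real n ^ (r + j + l) * real n ^ l" by (intro mult_left_mono) auto
    also have "\<dots> = real n ^ (r + j + 2 * l)" by (simp add: mult_2 add.assoc flip: power_add)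
    finally show "real n ^ (r + j + l) * (1 / \<phi>) ^ l \<le> real n ^ (r + j + 2 * l)" .
  qed (use X0 \<rho> in auto)
  finally show ?thesis unfolding \<phi>_def .
qed

text \<open>A measurable majorant \<open>k\<close> stands in for the supremum over the box. It lives
  on the whole space, because it is built from measure preserving maps of the whole space.\<close>

definition box_Lp_bound :: "'a::euclidean_space set \<Rightarrow> real \<Rightarrow> real \<Rightarrow> 'a set \<Rightarrow> real \<Rightarrow> real \<Rightarrow> bool" where
  "box_Lp_bound \<Omega> \<mu> \<rho> A p C \<longleftrightarrow> (\<forall>n\<ge>1. \<forall>F f. cpoly n F \<longrightarrow> complexifies F f \<longrightarrow>
     (\<exists>k. k \<in> borel_measurable borel \<and>
        (\<forall>\<xi>\<in>A. \<forall>\<zeta>\<in>deriv_box \<Omega> n \<mu> \<rho> \<xi>. ennreal (norm (F \<zeta>) powr p) \<le> k \<xi>) \<and>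
        (\<integral>\<^sup>+x. k x \<partial>lborel) \<le> ennreal C * (\<integral>\<^sup>+y. ennreal (\<bar>f y\<bar> powr p) * indicator \<Omega> y \<partial>lborel)))"

definition box_sup_bound :: "'a::euclidean_space set \<Rightarrow> real \<Rightarrow> real \<Rightarrow> 'a set \<Rightarrow> real \<Rightarrow> bool" where
  "box_sup_bound \<Omega> \<mu> \<rho> A C \<longleftrightarrow> (\<forall>n\<ge>1. \<forall>F f X. cpoly n F \<longrightarrow> complexifies F f \<longrightarrow> X \<ge> 0 \<longrightarrow> (\<forall>y\<in>\<Omega>. \<bar>f y\<bar> \<le> X) \<longrightarrow>
     (\<forall>\<xi>\<in>A. \<forall>\<zeta>\<in>deriv_box \<Omega> n \<mu> \<rho> \<xi>. norm (F \<zeta>) \<le> C * X))"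

text \<open>The box size \<open>\<rho>\<close> is common to all exponents, so that finitely many
  pieces can share the minimum of their sizes; only the constant may depend on
  \<open>p\<close>.\<close>

definition good_piece :: "'a::euclidean_space set \<Rightarrow> real \<Rightarrow> 'a set \<Rightarrow> bool" where
  "good_piece \<Omega> \<mu> A \<longleftrightarrow> (\<exists>\<rho>>0. (\<forall>p>0. \<exists>C\<ge>0. box_Lp_bound \<Omega> \<mu> \<rho> A p C) \<and> (\<exists>C\<ge>0. box_sup_bound \<Omega> \<mu> \<rho> A C))"

lemma box_bounds_mono:
  assumes "\<rho>' \<le> \<rho>" and "A' \<subseteq> A"
  shows "box_Lp_bound \<Omega> \<mu> \<rho> A p C \<Longrightarrow> box_Lp_bound \<Omega> \<mu> \<rho>' A' p C"
    and "box_sup_bound \<Omega> \<mu> \<rho> A C \<Longrightarrow> box_sup_bound \<Omega> \<mu> \<rho>' A' C"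
proof -
  have sub: "\<zeta> \<in> deriv_box \<Omega> n \<mu> \<rho> \<xi>" if "\<zeta> \<in> deriv_box \<Omega> n \<mu> \<rho>' \<xi>" for n \<xi> \<zeta>
    using deriv_box_mono[OF assms(1)] that by blast
  show "box_sup_bound \<Omega> \<mu> \<rho> A C \<Longrightarrow> box_sup_bound \<Omega> \<mu> \<rho>' A' C"
    unfolding box_sup_bound_def using sub assms(2) by (meson subsetD)
  assume L: "box_Lp_bound \<Omega> \<mu> \<rho> A p C"
  show "box_Lp_bound \<Omega> \<mu> \<rho>' A' p C"
    unfolding box_Lp_bound_def
  proof (intro allI impI)
    fix n F and f :: "'a \<Rightarrow> real" assume "1 \<le> n" "cpoly n F" "complexifies F f"
    then obtain k where "k \<in> borel_measurable borel"
      "\<forall>\<xi>\<in>A. \<forall>\<zeta>\<in>deriv_box \<Omega> n \<mu> \<rho> \<xi>. ennreal (norm (F \<zeta>) powr p) \<le> k \<xi>"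
      "(\<integral>\<^sup>+x. k x \<partial>lborel) \<le> ennreal C * (\<integral>\<^sup>+y. ennreal (\<bar>f y\<bar> powr p) * indicator \<Omega> y \<partial>lborel)"
      using L unfolding box_Lp_bound_def by meson
    then show "\<exists>k. k \<in> borel_measurable borel \<and>
        (\<forall>\<xi>\<in>A'. \<forall>\<zeta>\<in>deriv_box \<Omega> n \<mu> \<rho>' \<xi>. ennreal (norm (F \<zeta>) powr p) \<le> k \<xi>) \<and>
        (\<integral>\<^sup>+x. k x \<partial>lborel) \<le> ennreal C * (\<integral>\<^sup>+y. ennreal (\<bar>f y\<bar> powr p) * indicator \<Omega> y \<partial>lborel)"
      using sub assms(2) by (intro exI[of _ k]) blast
  qed
qed

lemma good_piece_mono: "good_piece \<Omega> \<mu> A \<Longrightarrow> B \<subseteq> A \<Longrightarrow> good_piece \<Omega> \<mu> B"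
  unfolding good_piece_def using box_bounds_mono[OF order_refl] by meson

lemma box_Lp_bound_Un:
  assumes A: "box_Lp_bound \<Omega> \<mu> \<rho> A p C" "C \<ge> 0" and B: "box_Lp_bound \<Omega> \<mu> \<rho> B p C'" "C' \<ge> 0"
  shows "box_Lp_bound \<Omega> \<mu> \<rho> (A \<union> B) p (C + C')"
  unfolding box_Lp_bound_def
proof (intro allI impI)
  fix n F and f :: "'a \<Rightarrow> real" assume hyps: "1 \<le> n" "cpoly n F" "complexifies F f"
  let ?I = "\<integral>\<^sup>+y. ennreal (\<bar>f y\<bar> powr p) * indicator \<Omega> y \<partial>lborel"
  obtain k where k [measurable]: "k \<in> borel_measurable borel"
    and k1: "\<forall>\<xi>\<in>A. \<forall>\<zeta>\<in>deriv_box \<Omega> n \<mu> \<rho> \<xi>. ennreal (norm (F \<zeta>) powr p) \<le> k \<xi>"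
    and k2: "(\<integral>\<^sup>+x. k x \<partial>lborel) \<le> ennreal C * ?I"
    using A(1) hyps unfolding box_Lp_bound_def by meson
  obtain k' where k' [measurable]: "k' \<in> borel_measurable borel"
    and k'1: "\<forall>\<xi>\<in>B. \<forall>\<zeta>\<in>deriv_box \<Omega> n \<mu> \<rho> \<xi>. ennreal (norm (F \<zeta>) powr p) \<le> k' \<xi>"
    and k'2: "(\<integral>\<^sup>+x. k' x \<partial>lborel) \<le> ennreal C' * ?I"
    using B(1) hyps unfolding box_Lp_bound_def by meson
  show "\<exists>k. k \<in> borel_measurable borel \<and>
      (\<forall>\<xi>\<in>A \<union> B. \<forall>\<zeta>\<in>deriv_box \<Omega> n \<mu> \<rho> \<xi>. ennreal (norm (F \<zeta>) powr p) \<le> k \<xi>) \<and>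
      (\<integral>\<^sup>+x. k x \<partial>lborel) \<le> ennreal (C + C') * ?I"
  proof (intro exI[of _ "\<lambda>x. k x + k' x"] conjI ballI)
    show "ennreal (norm (F \<zeta>) powr p) \<le> k \<xi> + k' \<xi>" if "\<xi> \<in> A \<union> B" "\<zeta> \<in> deriv_box \<Omega> n \<mu> \<rho> \<xi>" for \<xi> \<zeta>
    proof (cases "\<xi> \<in> A")
      case True
      then have "ennreal (norm (F \<zeta>) powr p) \<le> k \<xi>" using k1 that(2) by blast
      then show ?thesis by (rule add_increasing2[rotated]) simp
    next
      case False
      then have "ennreal (norm (F \<zeta>) powr p) \<le> k' \<xi>" using k'1 that by blast
      then show ?thesis by (rule add_increasing[rotated]) simp
    qed
    have "(\<integral>\<^sup>+x. k x + k' x \<partial>lborel) = (\<integral>\<^sup>+x. k x \<partial>lborel) + (\<integral>\<^sup>+x. k' x \<partial>lborel)"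
      by (rule nn_integral_add) measurable
    also have "\<dots> \<le> ennreal C * ?I + ennreal C' * ?I" by (rule add_mono[OF k2 k'2])
    also have "\<dots> = ennreal (C + C') * ?I" using A(2) B(2) by (simp add: ennreal_plus distrib_right)
    finally show "(\<integral>\<^sup>+x. k x + k' x \<partial>lborel) \<le> ennreal (C + C') * ?I" .
  qed measurable
qed

lemma good_piece_Un:
  assumes "good_piece \<Omega> \<mu> A" and "good_piece \<Omega> \<mu> B"
  shows "good_piece \<Omega> \<mu> (A \<union> B)"
proof -
  obtain \<rho> D where A: "\<rho> > 0" "\<And>p. p > 0 \<Longrightarrow> \<exists>C\<ge>0. box_Lp_bound \<Omega> \<mu> \<rho> A p C" "D \<ge> 0" "box_sup_bound \<Omega> \<mu> \<rho> A D"
    using assms(1) unfolding good_piece_def by blast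
  obtain \<rho>' D' where B: "\<rho>' > 0" "\<And>p. p > 0 \<Longrightarrow> \<exists>C\<ge>0. box_Lp_bound \<Omega> \<mu> \<rho>' B p C" "D' \<ge> 0" "box_sup_bound \<Omega> \<mu> \<rho>' B D'"
    using assms(2) unfolding good_piece_def by blast
  let ?\<rho> = "min \<rho> \<rho>'"
  have "\<exists>C\<ge>0. box_Lp_bound \<Omega> \<mu> ?\<rho> (A \<union> B) p C" if p: "p > 0" for p
  proof -
    obtain C C' where "C \<ge> 0" "box_Lp_bound \<Omega> \<mu> \<rho> A p C" "C' \<ge> 0" "box_Lp_bound \<Omega> \<mu> \<rho>' B p C'"
      using A(2)[OF p] B(2)[OF p] by blast
    then have "box_Lp_bound \<Omega> \<mu> ?\<rho> (A \<union> B) p (C + C')"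
      by (intro box_Lp_bound_Un box_bounds_mono(1)[of ?\<rho> \<rho> A A] box_bounds_mono(1)[of ?\<rho> \<rho>' B B]) auto
    then show ?thesis using \<open>C \<ge> 0\<close> \<open>C' \<ge> 0\<close> by (intro exI[of _ "C + C'"]) simp
  qed
  moreover have "box_sup_bound \<Omega> \<mu> ?\<rho> (A \<union> B) (max D D')"
  proof -
    have A': "box_sup_bound \<Omega> \<mu> ?\<rho> A D" and B': "box_sup_bound \<Omega> \<mu> ?\<rho> B D'"
      using A(4) B(4) by (auto intro: box_bounds_mono(2)[rotated 2])
    show ?thesis unfolding box_sup_bound_def
    proof (intro allI impI ballI)
      fix n F f X \<xi> \<zeta>
      assume h: "1 \<le> n" "cpoly n F" "complexifies F f" "0 \<le> X" "\<forall>y\<in>\<Omega>. \<bar>f y\<bar> \<le> X"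
        and \<xi>: "\<xi> \<in> A \<union> B" "\<zeta> \<in> deriv_box \<Omega> n \<mu> ?\<rho> \<xi>"
      have "norm (F \<zeta>) \<le> D * X \<or> norm (F \<zeta>) \<le> D' * X"
        using A'[unfolded box_sup_bound_def, rule_format, OF h(1-4) h(5)[rule_format] _ \<xi>(2)]
          B'[unfolded box_sup_bound_def, rule_format, OF h(1-4) h(5)[rule_format] _ \<xi>(2)] \<xi>(1) by blast
      moreover have "D * X \<le> max D D' * X" "D' * X \<le> max D D' * X"
        using h(4) by (auto intro: mult_right_mono)
      ultimately show "norm (F \<zeta>) \<le> max D D' * X" by linarith
    qed
  qed
  ultimately show ?thesis unfolding good_piece_def using A(1,3) B(1)
    by (intro exI[of _ ?\<rho>]) (auto intro!: exI[of _ "max D D'"])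
qed

lemma good_piece_UN:
  assumes "finite I" and "\<And>i. i \<in> I \<Longrightarrow> good_piece \<Omega> \<mu> (A i)"
  shows "good_piece \<Omega> \<mu> (\<Union>i\<in>I. A i)"
  using assms
proof (induction I rule: finite_induct)
  case empty
  have "box_Lp_bound \<Omega> \<mu> 1 {} p 0" for p
    unfolding box_Lp_bound_def by (auto intro!: exI[of _ "\<lambda>_. 0"])
  moreover have "box_sup_bound \<Omega> \<mu> 1 {} 0" by (simp add: box_sup_bound_def)
  ultimately show ?case unfolding good_piece_def by (metis order_refl zero_less_one Union_empty image_empty)
next
  case (insert i I)
  then show ?case by (simp add: good_piece_Un)
qed

lemma phi_bounded:
  assumes "bounded \<Omega>"
  shows "\<exists>\<Phi>\<ge>1. \<forall>n\<ge>1. \<forall>x\<in>\<Omega>. phi \<Omega> n x \<le> \<Phi>"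
proof -
  obtain B where B: "\<And>x. x \<in> \<Omega> \<Longrightarrow> infdist x (frontier \<Omega>) \<le> B"
  proof (cases "frontier \<Omega> = {}")
    case True
    then show ?thesis using that[of 0] by (simp add: infdist_def)
  next
    case False
    then obtain a where a: "a \<in> frontier \<Omega>" by blast
    obtain B where "\<And>x. x \<in> \<Omega> \<Longrightarrow> dist a x \<le> B" using assms bounded_any_center[of \<Omega> a] by auto
    then show ?thesis using that[of B] infdist_le[OF a] by (metis dist_commute order_trans)
  qed
  have "phi \<Omega> n x \<le> sqrt \<bar>B\<bar> + 1" if "n \<ge> 1" "x \<in> \<Omega>" for n x
  proof -
    have "infdist x (frontier \<Omega>) \<le> \<bar>B\<bar>" using B[OF that(2)] by simp
    moreover have "1 / real n \<le> 1" using that(1) by simp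
    ultimately show ?thesis unfolding phi_def by (intro add_mono real_sqrt_le_mono)
  qed
  then show ?thesis by (intro exI[of _ "sqrt \<bar>B\<bar> + 1"]) auto
qed

text \<open>A ball around \<open>x\<close> that leaves \<open>S\<close> would meet the frontier by
  connectedness, at distance less than \<open>\<epsilon>\<close> from \<open>x\<close>.\<close>

lemma ball_subset_of_infdist_frontier:
  assumes x: "x \<in> S" and \<epsilon>: "\<epsilon> \<le> infdist x (frontier S)"
  shows "ball x \<epsilon> \<subseteq> (S :: 'a::euclidean_space set)"
proof (rule ccontr)
  assume "\<not> ball x \<epsilon> \<subseteq> S"
  then have "ball x \<epsilon> - S \<noteq> {}" by blast
  then have "ball x \<epsilon> \<noteq> {}" by blast
  then have "x \<in> ball x \<epsilon>" by (simp add: not_le)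
  then have "ball x \<epsilon> \<inter> S \<noteq> {}" using x by blast
  then obtain z where "z \<in> ball x \<epsilon>" "z \<in> frontier S"
    using connected_Int_frontier[OF connected_ball] \<open>ball x \<epsilon> - S \<noteq> {}\<close> by blast
  then show False using infdist_le[of z "frontier S" x] \<epsilon> by simp
qed

lemma complexifies_continuous:
  assumes "cpoly n F" and "complexifies F f"
  shows "continuous_on A f"
  using complexifies_has_derivative[OF assms] by (meson continuous_at_imp_continuous_on has_derivative_continuous)

text \<open>At distance \<open>\<epsilon>\<close> from the frontier all directions are alike: a cube
  of fixed size around \<open>\<xi>\<close> lies in \<open>\<Omega>\<close>, and since
  \<open>\<phi>\<close> is at most \<open>\<Phi>\<close> the derivative box has size of order
  \<open>1 / n\<close> in every coordinate.\<close>

lemma interior_good_piece: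
  fixes \<Omega> :: "'a::euclidean_space set"
  assumes \<Omega>: "closed \<Omega>" and \<epsilon>: "\<epsilon> > 0" and \<Phi>: "\<Phi> \<ge> 1" "\<And>n x. n \<ge> 1 \<Longrightarrow> x \<in> \<Omega> \<Longrightarrow> phi \<Omega> n x \<le> \<Phi>"
    and normal: "\<And>\<eta>. \<eta> \<in> frontier \<Omega> \<Longrightarrow> norm (outer_normal \<Omega> \<eta>) = 1"
  shows "good_piece \<Omega> \<mu> {x \<in> \<Omega>. \<epsilon> \<le> infdist x (frontier \<Omega>)}"
proof -
  define A where "A = {x \<in> \<Omega>. \<epsilon> \<le> infdist x (frontier \<Omega>)}"
  \<comment> \<open>Every \<open>cos_vector c \<theta>\<close> then has norm at most
    \<open>\<epsilon> / 2\<close>, and \<open>\<rho>\<close> makes each complex coordinate of a box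
    offset at most \<open>c / (1024 n)\<close>.\<close>
  define c where "c = \<epsilon> / (2 * real DIM('a))"
  define \<rho> where "\<rho> = c / (1024 * (1 + \<Phi>))"
  have c: "c > 0" unfolding c_def using \<epsilon> by simp
  have \<rho>: "\<rho> > 0" unfolding \<rho>_def using c \<Phi> by simp
  have inside: "\<xi> + cos_vector c \<theta> \<in> \<Omega>" if "\<xi> \<in> A" for \<xi> \<theta>
  proof -
    have "norm (cos_vector c \<theta> :: 'a) \<le> real DIM('a) * c" using c by (intro norm_cos_vector) simp
    also have "\<dots> < \<epsilon>" using \<epsilon> by (simp add: c_def)
    finally have "\<xi> + cos_vector c \<theta> \<in> ball \<xi> \<epsilon>" by (simp add: dist_norm)
    then show ?thesis using that ball_subset_of_infdist_frontier[of \<xi> \<Omega> \<epsilon>] by (auto simp: A_def)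
  qed
  have key: "ennreal (norm (F \<zeta>) powr p) \<le> ennreal (3 * 8 powr p) ^ DIM('a) *
      (\<integral>\<^sup>+\<theta>. ennreal (\<bar>f (\<xi> + cos_vector c \<theta>)\<bar> powr p) \<partial>cos_product Basis n)"
    if n: "n \<ge> 1" and F: "cpoly n F" and f: "complexifies F f" and p: "p > 0" and \<xi>: "\<xi> \<in> A"
      and \<zeta>: "\<zeta> \<in> deriv_box \<Omega> n \<mu> \<rho> \<xi>" for n F f p \<xi> \<zeta>
  proof -
    obtain z w \<tau> \<eta> where \<zeta>eq: "\<zeta> = (\<lambda>b. ccoords \<xi> b + z * ccoords \<tau> b + w * ccoords (outer_normal \<Omega> \<eta>) b)"
      and \<eta>: "\<eta> \<in> near_boundary \<Omega> n \<mu> \<xi>" and \<tau>: "\<tau> \<in> unit_tangents \<Omega> \<eta>"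
      and z: "norm z \<le> \<rho> / real n" and w: "norm w \<le> \<rho> * phi \<Omega> n \<xi> / real n"
      using \<zeta> unfolding deriv_box_def by blast
    let ?\<nu> = "outer_normal \<Omega> \<eta>"
    define s where "s i = z * ccoords \<tau> i + w * ccoords ?\<nu> i" for i
    let ?G = "\<lambda>s. F (\<lambda>b. ccoords \<xi> b + (\<Sum>i\<in>Basis. s i * ccoords i b))"
    have rep: "(\<Sum>i\<in>Basis. ccoords y i * ccoords i b) = ccoords y b" for y b :: 'a
    proof -
      have "(\<Sum>i\<in>Basis. ccoords y i * ccoords i b) = ccoords (\<Sum>i\<in>Basis. (y \<bullet> i) *\<^sub>R i) b"
        unfolding ccoords_sum ccoords_scaleR by (simp add: ccoords_def)
      then show ?thesis by (simp only: euclidean_representation)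
    qed
    have "(\<Sum>i\<in>Basis. s i * ccoords i b) = z * ccoords \<tau> b + w * ccoords ?\<nu> b" for b
    proof -
      have "(\<Sum>i\<in>Basis. s i * ccoords i b) =
          z * (\<Sum>i\<in>Basis. ccoords \<tau> i * ccoords i b) + w * (\<Sum>i\<in>Basis. ccoords ?\<nu> i * ccoords i b)"
        by (simp add: s_def sum_distrib_left sum.distrib algebra_simps)
      then show ?thesis by (simp only: rep)
    qed
    then have Gs: "?G s = F \<zeta>" by (simp add: \<zeta>eq add.assoc)
    have G: "cpoly n ?G"
    proof -
      have "cpoly 1 (\<lambda>s. ccoords \<xi> b + (\<Sum>i\<in>Basis. s i * ccoords i b))" for b
        by (intro cpoly.add cpoly.const cpoly_sum cpoly.mult[OF cpoly.var[of 1] cpoly.const[of 0]]) auto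
      from cpoly_compose[OF F this] show ?thesis by simp
    qed
    have unit: "norm \<tau> = 1" "norm ?\<nu> = 1"
      using \<tau> \<eta> normal by (auto simp: unit_tangents_def near_boundary_def)
    have "norm (s i) \<le> c / (1024 * real n)" if "i \<in> Basis" for i
    proof -
      have "norm (ccoords \<tau> i) \<le> 1" "norm (ccoords ?\<nu> i) \<le> 1"
        using Basis_le_norm[OF that, of \<tau>] Basis_le_norm[OF that, of ?\<nu>] unit by (auto simp: ccoords_def)
      then have "norm (s i) \<le> norm z * 1 + norm w * 1"
        unfolding s_def by (intro order_trans[OF norm_triangle_ineq] add_mono) (auto simp: norm_mult intro!: mult_left_le)
      also have "\<dots> \<le> \<rho> / real n + \<rho> * \<Phi> / real n"
      proof -
        have "\<rho> * phi \<Omega> n \<xi> / real n \<le> \<rho> * \<Phi> / real n"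
          using \<Phi>(2)[OF n] \<xi> \<rho> by (intro divide_right_mono mult_left_mono) (auto simp: A_def)
        then show ?thesis using z w by simp
      qed
      also have "\<dots> = \<rho> * (1 + \<Phi>) / real n" by (simp add: add_divide_distrib algebra_simps)
      also have "\<rho> * (1 + \<Phi>) = c / 1024" using \<Phi> by (simp add: \<rho>_def field_simps)
      also have "c / 1024 / real n = c / (1024 * real n)" by simp
      finally show ?thesis .
    qed
    from cpoly_cos_product_bound[OF finite_Basis G n p c this]
    have "ennreal (norm (?G s) powr p) \<le> ennreal (3 * 8 powr p) ^ DIM('a) * (\<integral>\<^sup>+\<theta>. ennreal (norm (?G
        (\<lambda>i. if i \<in> Basis then of_real (c * cos (2 * pi * \<theta> i)) else s i)) powr p) \<partial>cos_product Basis n)"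
      by simp
    moreover have "norm (?G (\<lambda>i. if i \<in> Basis then of_real (c * cos (2 * pi * \<theta> i)) else s i)) = \<bar>f (\<xi> + cos_vector c \<theta>)\<bar>" for \<theta>
    proof -
      have "(\<lambda>b. ccoords \<xi> b + (\<Sum>i\<in>Basis. (if i \<in> Basis then of_real (c * cos (2 * pi * \<theta> i)) else s i) * ccoords i b)) =
          ccoords (\<xi> + cos_vector c \<theta>)"
        by (simp add: fun_eq_iff ccoords_add cos_vector_def ccoords_sum ccoords_scaleR cong: sum.cong)
      then show ?thesis using f by (metis complexifies_def norm_of_real)
    qed
    ultimately show ?thesis unfolding Gs by simp
  qed
  have "box_Lp_bound \<Omega> \<mu> \<rho> A p ((3 * 8 powr p) ^ DIM('a))" if p: "p > 0" for p
    unfolding box_Lp_bound_def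
  proof (intro allI impI)
    fix n F and f :: "'a \<Rightarrow> real" assume h: "1 \<le> n" "cpoly n F" "complexifies F f"
    let ?C = "ennreal (3 * 8 powr p) ^ DIM('a)"
    let ?W = "\<lambda>y. ennreal (\<bar>f y\<bar> powr p) * indicator \<Omega> y"
    let ?k = "\<lambda>\<xi>. \<integral>\<^sup>+\<theta>. ?W (\<xi> + cos_vector c \<theta>) \<partial>cos_product Basis n"
    have [measurable]: "f \<in> borel_measurable borel"
      by (rule borel_measurable_continuous_onI[OF complexifies_continuous[OF h(2,3)]])
    have [measurable]: "\<Omega> \<in> sets borel" using \<Omega> by simp
    have W: "?W \<in> borel_measurable borel" by measurable
    have tr: "(\<integral>\<^sup>+x. ?W (x + s) \<partial>lborel) = (\<integral>\<^sup>+x. ?W x \<partial>lborel)" for s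
      using nn_integral_lborel_translate[OF W, of s] by (simp add: add.commute)
    have pm: "(\<lambda>x. fst x + snd x) \<in> borel_measurable (borel :: ('a \<times> 'a) measure)"
      by (intro borel_measurable_continuous_onI continuous_intros)
    note av = nn_integral_cos_product_average[of ?W "(+)", OF W pm h(1) tr, of c]
    show "\<exists>k. k \<in> borel_measurable borel \<and>
      (\<forall>\<xi>\<in>A. \<forall>\<zeta>\<in>deriv_box \<Omega> n \<mu> \<rho> \<xi>. ennreal (norm (F \<zeta>) powr p) \<le> k \<xi>) \<and>
      (\<integral>\<^sup>+x. k x \<partial>lborel) \<le> ennreal ((3 * 8 powr p) ^ DIM('a)) * (\<integral>\<^sup>+y. ?W y \<partial>lborel)"
    proof (intro exI[of _ "\<lambda>\<xi>. ?C * ?k \<xi>"] conjI ballI)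
      show "(\<lambda>\<xi>. ?C * ?k \<xi>) \<in> borel_measurable borel" using av(1) by measurable
      show "ennreal (norm (F \<zeta>) powr p) \<le> ?C * ?k \<xi>" if "\<xi> \<in> A" "\<zeta> \<in> deriv_box \<Omega> n \<mu> \<rho> \<xi>" for \<xi> \<zeta>
        using key[OF h p that] inside[OF that(1)] by simp
      have "(\<integral>\<^sup>+\<xi>. ?C * ?k \<xi> \<partial>lborel) = ?C * (\<integral>\<^sup>+\<xi>. ?k \<xi> \<partial>lborel)"
        by (rule nn_integral_cmult) (use av(1) in simp)
      then show "(\<integral>\<^sup>+\<xi>. ?C * ?k \<xi> \<partial>lborel) \<le> ennreal ((3 * 8 powr p) ^ DIM('a)) * (\<integral>\<^sup>+y. ?W y \<partial>lborel)"
        by (simp add: av(2) ennreal_power)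
    qed
  qed
  moreover have "box_sup_bound \<Omega> \<mu> \<rho> A (24 ^ DIM('a))"
    unfolding box_sup_bound_def
  proof (intro allI impI ballI)
    fix n F and f :: "'a \<Rightarrow> real" and X \<xi> \<zeta>
    assume h: "1 \<le> n" "cpoly n F" "complexifies F f" "0 \<le> X" "\<forall>y\<in>\<Omega>. \<bar>f y\<bar> \<le> X"
      and \<xi>: "\<xi> \<in> A" "\<zeta> \<in> deriv_box \<Omega> n \<mu> \<rho> \<xi>"
    have "(\<integral>\<^sup>+\<theta>. ennreal (\<bar>f (\<xi> + cos_vector c \<theta>)\<bar> powr 1) \<partial>cos_product Basis n)
        \<le> (\<integral>\<^sup>+\<theta>. ennreal X \<partial>cos_product (Basis :: 'a set) n)"
      using h(5) inside[OF \<xi>(1)] by (intro nn_integral_mono) (simp add: ennreal_leI)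
    also have "\<dots> = ennreal X"
      using prob_space.emeasure_space_1[OF prob_space_cos_product[OF h(1), of "Basis :: 'a set"]] by simp
    finally have "ennreal (norm (F \<zeta>)) \<le> ennreal (3 * 8 powr 1) ^ DIM('a) * ennreal X"
      using order_trans[OF key[OF h(1-3) zero_less_one \<xi>] mult_left_mono] by simp
    also have "\<dots> = ennreal (24 ^ DIM('a) * X)"
      by (subst ennreal_power, simp, subst ennreal_mult'[symmetric]) (use h(4) in auto)
    finally show "norm (F \<zeta>) \<le> 24 ^ DIM('a) * X" using h(4) by (simp add: ennreal_le_iff)
  qed
  ultimately show ?thesis unfolding good_piece_def A_def[symmetric] using \<rho>
    by (intro exI[of _ \<rho>]) (meson zero_le_power zero_le_numeral mult_nonneg_nonneg powr_ge_zero)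
qed

section \<open>Comparing derivative boxes with chart offsets\<close>

context boundary_chart
begin

text \<open>For \<open>\<eta>\<close> closer than \<open>\<delta>\<close> to \<open>x\<close> the
  slopes of the graph over \<open>\<eta>\<close> and over \<open>x\<close> differ by at most
  \<open>K\<close> times the distance, which is at most \<open>\<mu> \<phi>\<close>. Otherwise
  \<open>\<delta> \<le> \<mu> \<phi>\<close>, and the trivial bound \<open>L + 1\<close> is itself
  at most a multiple of \<open>\<phi>\<close>.\<close>

lemma tangential_deviation:
  assumes x: "ball x \<delta> \<subseteq> U" and \<delta>: "\<delta> > 0" and L: "norm (grad g (base x)) \<le> L"
    and \<eta>: "\<eta> \<in> frontier \<Omega>" "norm (\<eta> - x) \<le> \<mu> * \<phi>" and \<tau>: "\<tau> \<in> unit_tangents \<Omega> \<eta>"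
  shows "\<bar>grad g (base x) \<bullet> fst (T \<tau>) - snd (T \<tau>)\<bar> \<le> (K * \<mu> + (L + 1) * \<mu> / \<delta>) * \<phi>"
proof -
  have n\<tau>: "norm (T \<tau>) = 1" using \<tau> by (simp add: unit_tangents_def)
  have f1: "norm (fst (T \<tau>)) \<le> 1" "\<bar>snd (T \<tau>)\<bar> \<le> 1"
    using norm_fst_le[of "fst (T \<tau>)" "snd (T \<tau>)"] norm_snd_le[of "snd (T \<tau>)" "fst (T \<tau>)"] n\<tau> by auto
  have L0: "L \<ge> 0" using L norm_ge_zero order_trans by blast
  have \<mu>\<phi>: "\<mu> * \<phi> \<ge> 0" using \<eta>(2) norm_ge_zero order_trans by blast
  have split: "(K * \<mu> + (L + 1) * \<mu> / \<delta>) * \<phi> = K * (\<mu> * \<phi>) + (L + 1) * (\<mu> * \<phi>) / \<delta>"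
    by (simp add: algebra_simps)
  show ?thesis
  proof (cases "norm (\<eta> - x) < \<delta>")
    case True
    then have \<eta>U: "\<eta> \<in> U" using x by (auto simp: dist_norm norm_minus_commute)
    have "\<tau> \<bullet> chart_normal \<eta> = 0"
      using \<tau> outer_normal_chart[OF \<eta>U \<eta>(1)] by (simp add: unit_tangents_def)
    then have s: "snd (T \<tau>) = grad g (base \<eta>) \<bullet> fst (T \<tau>)" by (simp add: orthogonal_chart_normal_iff)
    have "\<bar>grad g (base x) \<bullet> fst (T \<tau>) - snd (T \<tau>)\<bar> = \<bar>(grad g (base x) - grad g (base \<eta>)) \<bullet> fst (T \<tau>)\<bar>"
      by (simp add: s inner_diff_left)
    also have "\<dots> \<le> norm (grad g (base x) - grad g (base \<eta>)) * norm (fst (T \<tau>))"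
      by (rule Cauchy_Schwarz_ineq2)
    also have "\<dots> \<le> norm (grad g (base x) - grad g (base \<eta>)) * 1" using f1 by (intro mult_left_mono) auto
    also have "\<dots> \<le> K * norm (base x - base \<eta>)" using grad_Lipschitz by simp
    also have "\<dots> \<le> K * (\<mu> * \<phi>)"
      using norm_base_diff[of x \<eta>] \<eta>(2) K_pos by (intro mult_left_mono) (auto simp: norm_minus_commute)
    also have "\<dots> \<le> K * (\<mu> * \<phi>) + (L + 1) * (\<mu> * \<phi>) / \<delta>" using L0 \<mu>\<phi> \<delta> by simp
    finally show ?thesis unfolding split .
  next
    case False
    have "\<bar>grad g (base x) \<bullet> fst (T \<tau>) - snd (T \<tau>)\<bar> \<le> norm (grad g (base x)) * norm (fst (T \<tau>)) + \<bar>snd (T \<tau>)\<bar>"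
      using Cauchy_Schwarz_ineq2[of "grad g (base x)" "fst (T \<tau>)"] by simp
    also have "\<dots> \<le> L * 1 + 1" using f1 L L0 by (intro add_mono mult_mono) auto
    also have "\<dots> \<le> (L + 1) * (\<mu> * \<phi>) / \<delta>"
    proof -
      have "\<delta> \<le> \<mu> * \<phi>" using False \<eta>(2) by simp
      then have "(L + 1) * \<delta> \<le> (L + 1) * (\<mu> * \<phi>)" using L0 by (intro mult_left_mono) auto
      then show ?thesis using \<delta> by (simp add: field_simps)
    qed
    also have "\<dots> \<le> K * (\<mu> * \<phi>) + (L + 1) * (\<mu> * \<phi>) / \<delta>" using K_pos \<mu>\<phi> by simp
    finally show ?thesis unfolding split .
  qed
qed

text \<open>The point is compared with a nearest frontier point, which lies in the same chart and
  has depth 0; Taylor's formula bounds the difference of the depths.\<close>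

lemma depth_le_of_infdist:
  assumes x: "x \<in> \<Omega>" "ball x \<delta> \<subseteq> U" and \<epsilon>: "infdist x (frontier \<Omega>) \<le> \<epsilon>" "\<epsilon> < \<delta>" "\<epsilon> \<le> 1" "0 < \<epsilon>"
    and L: "norm (grad g (base x)) \<le> L"
  shows "depth x \<le> (1 + L + K) * \<epsilon>"
proof -
  have "frontier \<Omega> \<noteq> {}"
    using frontier_not_empty[of \<Omega>] x(1) bounded_\<Omega> not_bounded_UNIV by blast
  then obtain \<eta> where \<eta>: "\<eta> \<in> frontier \<Omega>" "infdist x (frontier \<Omega>) = dist x \<eta>"
    using infdist_attains_inf[OF frontier_closed] by blast
  then have d: "norm (\<eta> - x) \<le> \<epsilon>" using \<epsilon> by (simp add: dist_norm norm_minus_commute)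
  then have "\<eta> \<in> U" using x(2) \<epsilon> by (auto simp: dist_norm norm_minus_commute)
  then have d0: "depth \<eta> = 0" using \<eta>(1) frontier_iff by simp
  let ?v = "\<eta> - x"
  let ?s = "fst (T ?v)"
  have s: "norm ?s \<le> \<epsilon>" "\<bar>snd (T ?v)\<bar> \<le> \<epsilon>"
    using norm_fst_le[of ?s "snd (T ?v)"] norm_snd_le[of "snd (T ?v)" ?s] d by auto
  have "depth \<eta> = depth x + (g (base x + ?s) - g (base x)) - snd (T ?v)"
    using depth_add[of x ?v] by simp
  then have "depth x \<le> \<bar>g (base x + ?s) - g (base x)\<bar> + \<bar>snd (T ?v)\<bar>" using d0 by linarith
  also have "\<bar>g (base x + ?s) - g (base x)\<bar> \<le> \<bar>grad g (base x) \<bullet> ?s\<bar> + K * (norm ?s)\<^sup>2"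
    using Taylor_g[of "base x" ?s] by linarith
  also have "\<bar>grad g (base x) \<bullet> ?s\<bar> \<le> norm (grad g (base x)) * norm ?s" by (rule Cauchy_Schwarz_ineq2)
  also have "\<dots> \<le> L * \<epsilon>" using L s order_trans[OF norm_ge_zero L] by (intro mult_mono) auto
  also have "K * (norm ?s)\<^sup>2 \<le> K * \<epsilon>"
  proof -
    have "(norm ?s)\<^sup>2 \<le> \<epsilon>\<^sup>2" using s by (intro power_mono) auto
    also have "\<dots> \<le> \<epsilon>" using \<epsilon> by (simp add: power2_eq_square mult_left_le)
    finally show ?thesis using K_pos by (intro mult_left_mono) auto
  qed
  finally show ?thesis using s(2) by (simp add: algebra_simps)
qed

text \<open>The point of the graph straight above \<open>x\<close> is a frontier point at distance
  \<open>depth x\<close>. This is what bounds \<open>\<phi>\<close> by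
  \<open>sqrt (depth x) + 1 / n\<close>.\<close>

lemma infdist_le_depth:
  assumes x: "x \<in> \<Omega>" "ball x \<delta> \<subseteq> U" "\<delta> > 0" and d: "depth x < \<delta>"
  shows "infdist x (frontier \<Omega>) \<le> depth x"
proof -
  have "x \<in> U" using x centre_in_ball by blast
  then have d0: "depth x \<ge> 0" using in_\<Omega>_iff x(1) by simp
  let ?y = "x + depth x *\<^sub>R T' (0, 1)"
  have dist: "dist x ?y = depth x" using d0 by (simp add: dist_norm)
  then have "?y \<in> U" using x(2) d by auto
  moreover have "depth ?y = 0" by (simp add: depth_up)
  ultimately have "?y \<in> frontier \<Omega>" by (simp add: frontier_iff)
  from infdist_le[OF this, of x] show ?thesis unfolding dist .
qed

text \<open>The base components of the displacement become the parabola parameters \<open>s\<close>.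
  The offset \<open>t\<close> collects what the parabola leaves over vertically: the deviation of
  both directions from its tangent plane, and the bend.\<close>

lemma box_to_chart_offset:
  assumes "\<zeta> = (\<lambda>b. ccoords x b + z * ccoords \<tau> b + w * ccoords \<nu> b)"
  defines "s \<equiv> (\<lambda>i. z * of_real (fst (T \<tau>) \<bullet> i) + w * of_real (fst (T \<nu>) \<bullet> i))"
  defines "t \<equiv> z * of_real (grad g (base x) \<bullet> fst (T \<tau>) - snd (T \<tau>)) + w * of_real (grad g (base x) \<bullet> fst (T \<nu>) - snd (T \<nu>))
    - of_real K * (\<Sum>i\<in>Basis. (s i)\<^sup>2)"
  shows "\<zeta> = chart_offset x t s"
proof
  fix b
  have v: "ccoords v b = (\<Sum>i\<in>Basis. of_real (fst (T v) \<bullet> i) * ccoords (T' (i, 0)) b) + of_real (snd (T v)) * ccoords (T' (0, 1)) b" for v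
  proof -
    have "ccoords v b = ccoords (T' (fst (T v), snd (T v))) b" by simp
    also have "\<dots> = (\<Sum>i\<in>Basis. of_real (fst (T v) \<bullet> i) * ccoords (T' (i, 0)) b) + of_real (snd (T v)) * ccoords (T' (0, 1)) b"
      unfolding T'_Pair[of "fst (T v)" "snd (T v)"] by (simp only: ccoords_add ccoords_sum ccoords_scaleR)
    finally show ?thesis .
  qed
  have G: "of_real (grad g (base x) \<bullet> u) = (\<Sum>i\<in>Basis. of_real (u \<bullet> i) * complex_of_real (grad g (base x) \<bullet> i))" for u
    by (simp add: euclidean_inner[of "grad g (base x)" u] mult.commute)
  have 1: "(\<Sum>i\<in>Basis. s i * ccoords (T' (i, 0)) b) =
      z * (\<Sum>i\<in>Basis. of_real (fst (T \<tau>) \<bullet> i) * ccoords (T' (i, 0)) b) + w * (\<Sum>i\<in>Basis. of_real (fst (T \<nu>) \<bullet> i) * ccoords (T' (i, 0)) b)"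
    by (simp add: s_def sum_distrib_left sum.distrib algebra_simps)
  have 2: "(\<Sum>i\<in>Basis. s i * of_real (grad g (base x) \<bullet> i)) =
      z * of_real (grad g (base x) \<bullet> fst (T \<tau>)) + w * of_real (grad g (base x) \<bullet> fst (T \<nu>))"
    unfolding G[of "fst (T \<tau>)"] G[of "fst (T \<nu>)"] by (simp add: s_def sum_distrib_left sum.distrib algebra_simps)
  show "\<zeta> b = chart_offset x t s b"
    unfolding assms(1) chart_offset_def 1 2 t_def v[of \<tau>] v[of \<nu>] by (simp add: algebra_simps)
qed

end

context boundary_chart
begin

lemma grad_bounded: "\<exists>L\<ge>0. \<forall>x\<in>\<Omega>. norm (grad g (base x)) \<le> L"
proof -
  have "continuous_on \<Omega> (\<lambda>x. grad g (base x))"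
    by (rule continuous_on_compose2[OF continuous_on_grad[of UNIV] continuous_on_base]) auto
  moreover have "compact \<Omega>" using bounded_\<Omega> closed_\<Omega> by (simp add: compact_eq_bounded_closed)
  ultimately have "bounded ((\<lambda>x. grad g (base x)) ` \<Omega>)"
    by (intro compact_imp_bounded compact_continuous_image)
  then obtain B where "\<forall>x\<in>\<Omega>. norm (grad g (base x)) \<le> B" unfolding bounded_iff by blast
  then show ?thesis by (intro exI[of _ "max 0 B"]) (auto simp: le_max_iff_disj)
qed

text \<open>All three contributions to \<open>t\<close> are of order
  \<open>\<rho> \<phi> / n\<close>: the tangential one because the deviation is at most
  \<open>B \<phi>\<close>, the normal one because \<open>w\<close> has that size, and the bend
  because \<open>s\<close> is of order \<open>1 / n\<close> and
  \<open>1 / n \<le> \<phi>\<close>.\<close>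

lemma box_coefficient_bounds:
  fixes z w :: complex
  assumes n: "n \<ge> 1" and \<tau>: "norm \<tau> = 1" and \<nu>: "norm \<nu> = 1" and L: "norm (grad g (base x)) \<le> L"
    and \<phi>: "1 / real n \<le> \<phi>" "\<phi> \<le> \<Phi>" and \<rho>: "0 < \<rho>" "\<rho> \<le> 1"
    and z: "norm z \<le> \<rho> / real n" and w: "norm w \<le> \<rho> * \<phi> / real n"
    and B: "\<bar>grad g (base x) \<bullet> fst (T \<tau>) - snd (T \<tau>)\<bar> \<le> B * \<phi>"
  defines "s \<equiv> (\<lambda>i. z * of_real (fst (T \<tau>) \<bullet> i) + w * of_real (fst (T \<nu>) \<bullet> i))"
  shows "i \<in> Basis \<Longrightarrow> norm (s i) \<le> \<rho> * (1 + \<Phi>) / real n"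
    and "norm (z * of_real (grad g (base x) \<bullet> fst (T \<tau>) - snd (T \<tau>)) + w * of_real (grad g (base x) \<bullet> fst (T \<nu>) - snd (T \<nu>))
      - of_real K * (\<Sum>i\<in>Basis. (s i)\<^sup>2)) \<le> \<rho> * (B + (1 + L) + K * real DIM('a) * (1 + \<Phi>)\<^sup>2) * \<phi> / real n"
proof -
  have n0: "real n > 0" using n by simp
  have \<phi>0: "\<phi> > 0" using \<phi>(1) n0 by (smt (verit) divide_pos_pos)
  have fs: "norm (fst (T v)) \<le> 1" "\<bar>snd (T v)\<bar> \<le> 1" if "norm v = 1" for v
    using norm_fst_le[of "fst (T v)" "snd (T v)"] norm_snd_le[of "snd (T v)" "fst (T v)"] that by auto
  have si: "norm (s i) \<le> \<rho> * (1 + \<Phi>) / real n" if "i \<in> Basis" for i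
  proof -
    have "\<bar>fst (T \<tau>) \<bullet> i\<bar> \<le> 1" "\<bar>fst (T \<nu>) \<bullet> i\<bar> \<le> 1"
      using Basis_le_norm[OF that, of "fst (T \<tau>)"] Basis_le_norm[OF that, of "fst (T \<nu>)"] fs \<tau> \<nu> by (meson order_trans)+
    then have "norm (s i) \<le> norm z + norm w"
      unfolding s_def by (intro order_trans[OF norm_triangle_ineq] add_mono) (auto simp: norm_mult intro!: mult_left_le)
    also have "\<dots> \<le> \<rho> / real n + \<rho> * \<Phi> / real n"
    proof -
      have "\<rho> * \<phi> / real n \<le> \<rho> * \<Phi> / real n" using \<phi>(2) \<rho> by (intro divide_right_mono mult_left_mono) auto
      then show ?thesis using z w by linarith
    qed
    also have "\<dots> = \<rho> * (1 + \<Phi>) / real n" by (simp add: add_divide_distrib distrib_left)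
    finally show ?thesis .
  qed
  then show "i \<in> Basis \<Longrightarrow> norm (s i) \<le> \<rho> * (1 + \<Phi>) / real n" .
  let ?e = "\<rho> * \<phi> / real n"
  have e0: "?e \<ge> 0" using \<rho> \<phi>0 by simp
  have 1: "norm (z * of_real (grad g (base x) \<bullet> fst (T \<tau>) - snd (T \<tau>))) \<le> ?e * B"
  proof -
    have "norm z * \<bar>grad g (base x) \<bullet> fst (T \<tau>) - snd (T \<tau>)\<bar> \<le> (\<rho> / real n) * (B * \<phi>)"
      using z B \<rho> by (intro mult_mono) auto
    then show ?thesis unfolding norm_mult norm_of_real by (simp add: mult_ac)
  qed
  have 2: "norm (w * of_real (grad g (base x) \<bullet> fst (T \<nu>) - snd (T \<nu>))) \<le> ?e * (1 + L)"
  proof -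
    have "\<bar>grad g (base x) \<bullet> fst (T \<nu>) - snd (T \<nu>)\<bar> \<le> norm (grad g (base x)) * norm (fst (T \<nu>)) + \<bar>snd (T \<nu>)\<bar>"
      using Cauchy_Schwarz_ineq2[of "grad g (base x)" "fst (T \<nu>)"] by linarith
    also have "\<dots> \<le> L * 1 + 1"
      using fs[OF \<nu>] L order_trans[OF norm_ge_zero L] by (intro add_mono mult_mono) auto
    finally have "norm w * \<bar>grad g (base x) \<bullet> fst (T \<nu>) - snd (T \<nu>)\<bar> \<le> ?e * (1 + L)"
      using w e0 by (intro mult_mono) auto
    then show ?thesis unfolding norm_mult norm_of_real .
  qed
  have 3: "norm (of_real K * (\<Sum>i\<in>Basis. (s i)\<^sup>2)) \<le> ?e * (K * real DIM('a) * (1 + \<Phi>)\<^sup>2)"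
  proof -
    have sq: "(\<rho> * (1 + \<Phi>) / real n)\<^sup>2 \<le> ?e * (1 + \<Phi>)\<^sup>2"
    proof -
      have "(\<rho> * (1 + \<Phi>) / real n)\<^sup>2 = (\<rho> / real n * (\<rho> * (1 / real n))) * (1 + \<Phi>)\<^sup>2"
        by (simp add: power2_eq_square)
      also have "\<dots> \<le> (\<rho> / real n * (1 * \<phi>)) * (1 + \<Phi>)\<^sup>2"
        using \<rho> \<phi> \<phi>0 by (intro mult_right_mono mult_left_mono mult_mono) auto
      finally show ?thesis by simp
    qed
    have "norm (\<Sum>i\<in>Basis. (s i)\<^sup>2) \<le> (\<Sum>i\<in>(Basis::'a set). ?e * (1 + \<Phi>)\<^sup>2)"
    proof (rule sum_norm_le)
      fix i :: 'a assume "i \<in> Basis"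
      then have "(norm (s i))\<^sup>2 \<le> (\<rho> * (1 + \<Phi>) / real n)\<^sup>2" using si by (intro power_mono) auto
      then show "norm ((s i)\<^sup>2) \<le> ?e * (1 + \<Phi>)\<^sup>2" using sq by (simp add: norm_power)
    qed
    then have "K * norm (\<Sum>i\<in>Basis. (s i)\<^sup>2) \<le> K * (real DIM('a) * (?e * (1 + \<Phi>)\<^sup>2))"
      using K_pos by (intro mult_left_mono) auto
    then show ?thesis using K_pos by (simp add: norm_mult mult_ac)
  qed
  have "norm (z * of_real (grad g (base x) \<bullet> fst (T \<tau>) - snd (T \<tau>)) + w * of_real (grad g (base x) \<bullet> fst (T \<nu>) - snd (T \<nu>))
      - of_real K * (\<Sum>i\<in>Basis. (s i)\<^sup>2)) \<le> ?e * B + ?e * (1 + L) + ?e * (K * real DIM('a) * (1 + \<Phi>)\<^sup>2)"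
    by (intro order_trans[OF norm_triangle_ineq4] add_mono order_trans[OF norm_triangle_ineq] 1 2 3)
  also have "\<dots> = \<rho> * (B + (1 + L) + K * real DIM('a) * (1 + \<Phi>)\<^sup>2) * \<phi> / real n"
    by (simp add: algebra_simps add_divide_distrib)
  finally show "norm (z * of_real (grad g (base x) \<bullet> fst (T \<tau>) - snd (T \<tau>)) + w * of_real (grad g (base x) \<bullet> fst (T \<nu>) - snd (T \<nu>))
      - of_real K * (\<Sum>i\<in>Basis. (s i)\<^sup>2)) \<le> \<dots>" .
qed

lemma near_good_piece:
  assumes \<delta>: "\<delta> > 0" and \<mu>: "\<mu> > 0" and \<Phi>: "\<Phi> \<ge> 1" "\<And>n x. n \<ge> 1 \<Longrightarrow> x \<in> \<Omega> \<Longrightarrow> phi \<Omega> n x \<le> \<Phi>"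
    and normal: "\<And>\<eta>. \<eta> \<in> frontier \<Omega> \<Longrightarrow> norm (outer_normal \<Omega> \<eta>) = 1"
  shows "\<exists>\<epsilon>>0. good_piece \<Omega> \<mu> {x \<in> \<Omega>. ball x \<delta> \<subseteq> U \<and> infdist x (frontier \<Omega>) \<le> \<epsilon>}"
proof -
  obtain L where L0: "L \<ge> 0" and L: "\<And>x. x \<in> \<Omega> \<Longrightarrow> norm (grad g (base x)) \<le> L" using grad_bounded by blast
  define d where "d = real DIM('a)"
  have d1: "d \<ge> 1" unfolding d_def using DIM_positive[where 'a='a] by (simp add: Suc_le_eq)
  define P where "P = d * (1 + L) + K * d\<^sup>2"
  have "d * (1 + L) > 0" "K * d\<^sup>2 > 0" using d1 L0 K_pos by (auto intro!: mult_pos_pos)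
  then have P: "P > 0" unfolding P_def by simp
  \<comment> \<open>At most 2 for the comparison of the sine with the square root of the depth, and
    at most \<open>\<delta> / 4\<close> to keep the vertical segments in the chart.\<close>
  define \<Lambda> where "\<Lambda> = min 2 (\<delta> / 4)"
  have \<Lambda>: "0 < \<Lambda>" "\<Lambda> \<le> 2" "\<Lambda> \<le> \<delta> / 4" using \<delta> by (auto simp: \<Lambda>_def)
  \<comment> \<open>\<open>\<delta> / (2 P)\<close> bounds the displacement along a parabola by
    \<open>\<delta> / 2\<close>, and \<open>\<Lambda> / (8 K d\<^sup>2)\<close> bounds its gain in
    depth by \<open>\<Lambda> / 4\<close>; \<open>c \<le> 1\<close> lets \<open>c\<^sup>2\<close> be
    replaced by \<open>c\<close>.\<close>
  define c where "c = min 1 (min (\<delta> / (2 * P)) (\<Lambda> / (8 * K * d\<^sup>2)))"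
  have c: "0 < c" "c \<le> 1" "c \<le> \<delta> / (2 * P)" "c \<le> \<Lambda> / (8 * K * d\<^sup>2)"
    using \<delta> P \<Lambda> K_pos d1 by (auto simp: c_def)
  have cc: "c\<^sup>2 \<le> c" using c by (simp add: power2_eq_square mult_left_le)
  have K1: "2 * K * (d * c)\<^sup>2 \<le> \<Lambda> / 4"
  proof -
    have "2 * K * (d * c)\<^sup>2 = 2 * K * d\<^sup>2 * c\<^sup>2" by (simp add: power_mult_distrib)
    also have "\<dots> \<le> 2 * K * d\<^sup>2 * c" using cc K_pos by (intro mult_left_mono) auto
    also have "\<dots> \<le> \<Lambda> / 4" using c(4) K_pos d1 by (simp add: field_simps)
    finally show ?thesis .
  qed
  have K2: "d * c * (1 + L) + K * (d * c)\<^sup>2 + \<Lambda> < \<delta>"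
  proof -
    have "K * d\<^sup>2 * c\<^sup>2 \<le> K * d\<^sup>2 * c" using cc K_pos by (intro mult_left_mono) auto
    then have "d * c * (1 + L) + K * (d * c)\<^sup>2 \<le> c * P" by (simp add: P_def power_mult_distrib algebra_simps)
    also have "\<dots> \<le> \<delta> / 2" using c(3) P by (simp add: field_simps)
    finally show ?thesis using \<Lambda> \<delta> by simp
  qed
  \<comment> \<open>This makes the depth of \<open>x\<close> at most \<open>\<Lambda> / 4\<close>.
    With a gain of at most \<open>\<Lambda> / 4\<close> along the parabola, the depth stays in the
    upper half.\<close>
  define \<epsilon> where "\<epsilon> = min 1 (min (\<delta> / 2) (\<Lambda> / (4 * (1 + L + K))))"
  have \<epsilon>: "0 < \<epsilon>" "\<epsilon> \<le> 1" "\<epsilon> < \<delta>" "(1 + L + K) * \<epsilon> \<le> \<Lambda> / 4"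
  proof -
    have "\<epsilon> \<le> \<delta> / 2" "\<epsilon> \<le> \<Lambda> / (4 * (1 + L + K))"
      unfolding \<epsilon>_def by (rule min.coboundedI2, rule min.cobounded1) (rule min.coboundedI2, rule min.cobounded2)
    note e = this
    show "\<epsilon> < \<delta>" using e(1) \<delta> by linarith
    have "4 * (1 + L + K) > 0" using L0 K_pos by simp
    then have "\<epsilon> * (4 * (1 + L + K)) \<le> \<Lambda>" using e(2) by (simp only: pos_le_divide_eq)
    then show "(1 + L + K) * \<epsilon> \<le> \<Lambda> / 4" by (simp add: algebra_simps)
  qed (use \<delta> \<Lambda> L0 K_pos in \<open>auto simp: \<epsilon>_def\<close>)
  define B where "B = K * \<mu> + (L + 1) * \<mu> / \<delta>"
  define C1 where "C1 = B + (1 + L) + K * d * (1 + \<Phi>)\<^sup>2"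
  have C1: "C1 > 0"
  proof -
    have "B > 0" unfolding B_def using K_pos \<mu> L0 \<delta> by (intro add_pos_nonneg mult_pos_pos) auto
    then show ?thesis unfolding C1_def using L0 K_pos d1 by (simp add: add_pos_nonneg)
  qed
  \<comment> \<open>The two quotients fit \<open>s\<close> and \<open>t\<close> into their
    admissible discs. For \<open>s\<close> the denominator is \<open>1024 * 2\<close>, since the
    parabola doubles the degree.\<close>
  define \<rho> where "\<rho> = min 1 (min (c / (2048 * (1 + \<Phi>))) (\<Lambda> / (2048 * C1)))"
  have \<rho>: "0 < \<rho>" "\<rho> \<le> 1" using c \<Phi> C1 \<Lambda> by (auto simp: \<rho>_def)
  have \<rho>c: "\<rho> * (1 + \<Phi>) \<le> c / 2048"
  proof -
    have "\<rho> \<le> c / (2048 * (1 + \<Phi>))" by (simp add: \<rho>_def)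
    then show ?thesis using \<Phi> by (simp add: field_simps)
  qed
  have \<rho>C: "\<rho> * C1 \<le> \<Lambda> / 2048"
  proof -
    have "\<rho> \<le> \<Lambda> / (2048 * C1)" by (simp add: \<rho>_def)
    then show ?thesis using C1 by (simp add: field_simps)
  qed
  define A where "A = {x \<in> \<Omega>. ball x \<delta> \<subseteq> U \<and> infdist x (frontier \<Omega>) \<le> \<epsilon>}"
  have depthA: "depth x \<le> \<Lambda> / 4" if "x \<in> A" for x
  proof -
    have "x \<in> \<Omega>" "ball x \<delta> \<subseteq> U" "infdist x (frontier \<Omega>) \<le> \<epsilon>" using that by (auto simp: A_def)
    from depth_le_of_infdist[OF this \<epsilon>(3,2,1) L[OF this(1)]] \<epsilon>(4) show ?thesis by linarith
  qed
  have offset: "\<exists>t s. \<zeta> = chart_offset x t s \<and> (\<forall>i\<in>Basis. norm (s i) \<le> c / (1024 * real (n * 2))) \<and>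
      norm t \<le> \<Lambda> * (sqrt (depth x) + 1 / real n) / (2048 * real n)"
    if x: "x \<in> A" and n: "n \<ge> 1" and \<zeta>: "\<zeta> \<in> deriv_box \<Omega> n \<mu> \<rho> x" for x n \<zeta>
  proof -
    have x\<Omega>: "x \<in> \<Omega>" and xU: "ball x \<delta> \<subseteq> U" using x by (auto simp: A_def)
    obtain z w \<tau> \<eta> where \<zeta>eq: "\<zeta> = (\<lambda>b. ccoords x b + z * ccoords \<tau> b + w * ccoords (outer_normal \<Omega> \<eta>) b)"
      and \<eta>: "\<eta> \<in> near_boundary \<Omega> n \<mu> x" and \<tau>: "\<tau> \<in> unit_tangents \<Omega> \<eta>"
      and z: "norm z \<le> \<rho> / real n" and w: "norm w \<le> \<rho> * phi \<Omega> n x / real n"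
      using \<zeta> unfolding deriv_box_def by blast
    have \<eta>': "\<eta> \<in> frontier \<Omega>" "norm (\<eta> - x) \<le> \<mu> * phi \<Omega> n x" using \<eta> by (auto simp: near_boundary_def)
    have \<tau>1: "norm \<tau> = 1" using \<tau> by (simp add: unit_tangents_def)
    have dev: "\<bar>grad g (base x) \<bullet> fst (T \<tau>) - snd (T \<tau>)\<bar> \<le> B * phi \<Omega> n x"
      unfolding B_def by (rule tangential_deviation[OF xU \<delta> L[OF x\<Omega>] \<eta>' \<tau>])
    note b = box_coefficient_bounds[OF n \<tau>1 normal[OF \<eta>'(1)] L[OF x\<Omega>] phi_ge \<Phi>(2)[OF n x\<Omega>] \<rho> z w dev]
    have n0: "real n > 0" using n by simp
    have ph: "phi \<Omega> n x \<le> sqrt (depth x) + 1 / real n"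
      using infdist_le_depth[OF x\<Omega> xU \<delta>] depthA[OF x] \<Lambda> \<delta> by (simp add: phi_def)
    have "\<rho> * C1 * phi \<Omega> n x / real n \<le> \<Lambda> / 2048 * (sqrt (depth x) + 1 / real n) / real n"
      using \<rho>C ph \<Lambda> order_trans[OF _ phi_ge[of n \<Omega> x], of 0] by (intro divide_right_mono mult_mono) auto
    then have t: "\<rho> * C1 * phi \<Omega> n x / real n \<le> \<Lambda> * (sqrt (depth x) + 1 / real n) / (2048 * real n)"
      by (simp add: field_simps)
    have "\<rho> * (1 + \<Phi>) / real n \<le> c / 2048 / real n" using \<rho>c by (intro divide_right_mono) auto
    then have s: "\<rho> * (1 + \<Phi>) / real n \<le> c / (1024 * real (n * 2))" by (simp add: field_simps)
    show ?thesis
      using box_to_chart_offset[OF \<zeta>eq] order_trans[OF b(1) s] order_trans[OF b(2)[folded d_def, folded C1_def] t]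
      by blast
  qed
  have d2: "depth x + 2 * K * (real DIM('a) * c)\<^sup>2 \<le> \<Lambda> / 2" if "x \<in> A" for x
    using depthA[OF that] K1 unfolding d_def by linarith
  have "box_Lp_bound \<Omega> \<mu> \<rho> A p ((3 * 8 powr p) ^ DIM('a) * (36 * 8 powr p * 2))" if p: "p > 0" for p
    unfolding box_Lp_bound_def
  proof (intro allI impI)
    fix n F and f :: "'a \<times> real \<Rightarrow> real" assume h: "1 \<le> n" "cpoly n F" "complexifies F f"
    let ?W = "\<lambda>y. ennreal (\<bar>f y\<bar> powr p) * indicator \<Omega> y"
    let ?V = "vertical_term n \<Lambda> ?W"
    let ?k = "\<lambda>x. \<integral>\<^sup>+\<theta>. ?V (parabola x (cos_vector c \<theta>)) \<partial>cos_product Basis (n * 2)"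
    let ?C = "ennreal (3 * 8 powr p) ^ DIM('a)"
    let ?C' = "ennreal (36 * 8 powr p)"
    have [measurable]: "f \<in> borel_measurable borel"
      by (rule borel_measurable_continuous_onI[OF complexifies_continuous[OF h(2,3)]])
    have [measurable]: "\<Omega> \<in> sets borel" using closed_\<Omega> by simp
    have W: "?W \<in> borel_measurable borel" by measurable
    have V: "?V \<in> borel_measurable borel" by (rule borel_measurable_vertical_term[OF W])
    have pm: "(\<lambda>x. parabola (fst x) (snd x)) \<in> borel_measurable (borel :: (('a \<times> real) \<times> 'a) measure)"
      unfolding parabola_def
      by (intro borel_measurable_continuous_onI continuous_intros continuous_on_compose2[OF continuous_on_T'[of UNIV]]
          continuous_on_compose2[OF continuous_on_grad[of UNIV]] continuous_on_compose2[OF continuous_on_base[of UNIV]]) auto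
    have n2: "n * 2 \<ge> 1" using h(1) by simp
    note av = nn_integral_cos_product_average[OF V pm n2 nn_integral_parabola[OF V], of c]
    show "\<exists>k. k \<in> borel_measurable borel \<and>
      (\<forall>\<xi>\<in>A. \<forall>\<zeta>\<in>deriv_box \<Omega> n \<mu> \<rho> \<xi>. ennreal (norm (F \<zeta>) powr p) \<le> k \<xi>) \<and>
      (\<integral>\<^sup>+x. k x \<partial>lborel) \<le> ennreal ((3 * 8 powr p) ^ DIM('a) * (36 * 8 powr p * 2)) * (\<integral>\<^sup>+y. ?W y \<partial>lborel)"
    proof (intro exI[of _ "\<lambda>x. ?C * (?C' * ?k x)"] conjI ballI)
      show "(\<lambda>x. ?C * (?C' * ?k x)) \<in> borel_measurable borel" using av(1) by measurable
      show "ennreal (norm (F \<zeta>) powr p) \<le> ?C * (?C' * ?k x)" if x: "x \<in> A" and \<zeta>: "\<zeta> \<in> deriv_box \<Omega> n \<mu> \<rho> x" for x \<zeta>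
      proof -
        obtain t s where ts: "\<zeta> = chart_offset x t s" "\<forall>i\<in>Basis. norm (s i) \<le> c / (1024 * real (n * 2))"
            "norm t \<le> \<Lambda> * (sqrt (depth x) + 1 / real n) / (2048 * real n)"
          using offset[OF x h(1) \<zeta>] by blast
        have "x \<in> \<Omega>" "ball x \<delta> \<subseteq> U" using x by (auto simp: A_def)
        from chart_offset_bound(1)[OF h(2,3,1) this \<delta> L[OF this(1)] c(1) \<Lambda>(1,2) d2[OF x] K2[unfolded d_def] ts(3) _ p] ts(2)
        show ?thesis unfolding ts(1) by blast
      qed
      have "(\<integral>\<^sup>+x. ?C * (?C' * ?k x) \<partial>lborel) = ?C * (\<integral>\<^sup>+x. ?C' * ?k x \<partial>lborel)"
        by (rule nn_integral_cmult) (use av(1) in measurable)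
      also have "(\<integral>\<^sup>+x. ?C' * ?k x \<partial>lborel) = ?C' * (\<integral>\<^sup>+x. ?k x \<partial>lborel)"
        by (rule nn_integral_cmult) (use av(1) in simp)
      also have "(\<integral>\<^sup>+x. ?k x \<partial>lborel) = (\<integral>\<^sup>+x. ?V x \<partial>lborel)" by (rule av(2))
      also have "?C * (?C' * (\<integral>\<^sup>+x. ?V x \<partial>lborel)) \<le> ?C * (?C' * (2 * (\<integral>\<^sup>+x. ?W x \<partial>lborel)))"
        by (intro mult_left_mono nn_integral_vertical_term[OF W h(1) \<Lambda>(1)]) auto
      also have "\<dots> = ?C * (?C' * 2) * (\<integral>\<^sup>+x. ?W x \<partial>lborel)" by (simp only: mult.assoc)
      also have "?C * (?C' * 2) = ennreal ((3 * 8 powr p) ^ DIM('a) * (36 * 8 powr p * 2))"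
      proof -
        have "?C' * 2 = ennreal (36 * 8 powr p * 2)" by (subst ennreal_mult') auto
        moreover have "?C = ennreal ((3 * 8 powr p) ^ DIM('a))" by (rule ennreal_power) simp
        ultimately show ?thesis by (simp only: ennreal_mult'[symmetric] zero_le_power zero_le_mult_iff powr_ge_zero) (simp add: ennreal_mult')
      qed
      finally show "(\<integral>\<^sup>+x. ?C * (?C' * ?k x) \<partial>lborel) \<le> ennreal ((3 * 8 powr p) ^ DIM('a) * (36 * 8 powr p * 2)) * (\<integral>\<^sup>+y. ?W y \<partial>lborel)" .
    qed
  qed
  then have Lp: "\<exists>C\<ge>0. box_Lp_bound \<Omega> \<mu> \<rho> A p C" if "p > 0" for p
    using that by (intro exI[of _ "(3 * 8 powr p) ^ DIM('a) * (36 * 8 powr p * 2)"]) simp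
  have sup: "box_sup_bound \<Omega> \<mu> \<rho> A (24 ^ DIM('a) * 24)"
    unfolding box_sup_bound_def
  proof (intro allI impI ballI)
    fix n F and f :: "'a \<times> real \<Rightarrow> real" and X x \<zeta>
    assume h: "1 \<le> n" "cpoly n F" "complexifies F f" "0 \<le> X" "\<forall>y\<in>\<Omega>. \<bar>f y\<bar> \<le> X"
      and x: "x \<in> A" and \<zeta>: "\<zeta> \<in> deriv_box \<Omega> n \<mu> \<rho> x"
    obtain t s where ts: "\<zeta> = chart_offset x t s" "\<forall>i\<in>Basis. norm (s i) \<le> c / (1024 * real (n * 2))"
        "norm t \<le> \<Lambda> * (sqrt (depth x) + 1 / real n) / (2048 * real n)"
      using offset[OF x h(1) \<zeta>] by blast
    have xx: "x \<in> \<Omega>" "ball x \<delta> \<subseteq> U" using x by (auto simp: A_def)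
    have "norm (F (chart_offset x t s)) \<le> 24 ^ DIM('a) * (24 * X)"
      by (rule chart_offset_bound(2)[OF h(2,3,1) xx \<delta> L[OF xx(1)] c(1) \<Lambda>(1,2) d2[OF x] K2[unfolded d_def] ts(3) _ zero_less_one])
         (use ts(2) h(5) in auto)
    then show "norm (F \<zeta>) \<le> 24 ^ DIM('a) * 24 * X" unfolding ts(1) by (simp only: mult.assoc)
  qed
  have "good_piece \<Omega> \<mu> A"
    unfolding good_piece_def using \<rho>(1) Lp sup by (intro exI[of _ \<rho>]) (auto intro!: exI[of _ "24 ^ DIM('a) * 24"])
  then show ?thesis using \<epsilon>(1) unfolding A_def by blast
qed

end

section \<open>From charts to the whole domain\<close>

lemma C2_domain_charts:
  assumes "C2_domain \<Omega>" and closed: "closed \<Omega>"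
  obtains \<delta> \<U> where "\<delta> > 0" and "finite \<U>" and "frontier \<Omega> \<subseteq> \<Union>\<U>"
    and "\<And>x. x \<in> \<Omega> \<Longrightarrow> infdist x (frontier \<Omega>) < \<delta> \<Longrightarrow> \<exists>U\<in>\<U>. ball x \<delta> \<subseteq> U"
    and "\<And>U. U \<in> \<U> \<Longrightarrow> \<exists>T a g K. boundary_chart \<Omega> U T a g K"
proof -
  obtain \<delta> M \<U> where \<delta>: "\<delta> > 0" and M: "M > 0" and \<U>: "finite \<U>" "\<forall>U\<in>\<U>. open U \<and> connected U" "frontier \<Omega> \<subseteq> \<Union>\<U>"
    and near: "\<forall>x\<in>\<Omega>. infdist x (frontier \<Omega>) < \<delta> \<longrightarrow> (\<exists>U\<in>\<U>. x \<in> U \<and> infdist x (frontier U) > \<delta>)"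
    and charts: "\<forall>U\<in>\<U>. \<exists>(Q :: 'a \<times> real \<Rightarrow> 'a \<times> real) a g.
           orthogonal_transformation Q \<and> C2_function g \<and>
           (\<forall>b\<in>Basis. \<forall>c\<in>Basis. \<forall>y. \<bar>dir_deriv b (dir_deriv c g) y\<bar> \<le> M) \<and>
           \<Omega> \<inter> U = {x\<in>U. snd (Q x + a) \<le> g (fst (Q x + a))}"
    using assms(1) unfolding C2_domain_def by (elim conjE exE) (rule that)
  have bounded: "bounded \<Omega>" using assms(1) unfolding C2_domain_def by blast
  show ?thesis
  proof (rule that[OF \<delta> \<U>(1) \<U>(3)])
    fix x assume "x \<in> \<Omega>" "infdist x (frontier \<Omega>) < \<delta>"
    then obtain U where "U \<in> \<U>" "x \<in> U" "infdist x (frontier U) > \<delta>" using near by blast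
    then show "\<exists>U\<in>\<U>. ball x \<delta> \<subseteq> U" using ball_subset_of_infdist_frontier[of x U \<delta>] by auto
  next
    fix U assume U: "U \<in> \<U>"
    from bspec[OF charts this] obtain Q :: "'a \<times> real \<Rightarrow> 'a \<times> real" and a g where
      Q: "orthogonal_transformation Q" and g: "C2_function g"
        and gM': "\<forall>b\<in>Basis. \<forall>c\<in>Basis. \<forall>y. \<bar>dir_deriv b (dir_deriv c g) y\<bar> \<le> M"
        and eq: "\<Omega> \<inter> U = {x\<in>U. snd (Q x + a) \<le> g (fst (Q x + a))}"
      by (elim conjE exE) (rule that)
    have gM: "\<bar>dir_deriv b (dir_deriv c g) y\<bar> \<le> M" if "b \<in> Basis" "c \<in> Basis" for b c y
      using gM' that by blast
    have "boundary_chart \<Omega> U Q a g ((real DIM('a))\<^sup>2 * M)"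
    proof
      show "(g has_derivative (\<lambda>v. grad g x \<bullet> v)) (at x)" for x
        using g by (intro has_derivative_grad) (simp add: C2_function_def)
      show "norm (grad g x - grad g y) \<le> (real DIM('a))\<^sup>2 * M * norm (x - y)" for x y
        by (rule C2_function_grad_Lipschitz[OF g gM])
    qed (use Q \<U>(2) U bounded closed M eq in auto)
    then show "\<exists>T a g K. boundary_chart \<Omega> U T a g K" by blast
  qed
qed

lemma C2_domain_norm_outer_normal:
  assumes "C2_domain \<Omega>" and "closed \<Omega>" and "\<eta> \<in> frontier \<Omega>"
  shows "norm (outer_normal \<Omega> \<eta>) = 1"
proof (rule C2_domain_charts[OF assms(1,2)])
  fix \<U> assume "frontier \<Omega> \<subseteq> \<Union>\<U>" and c: "\<And>U. U \<in> \<U> \<Longrightarrow> \<exists>T a g K. boundary_chart \<Omega> U T a g K"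
  then obtain U where U: "U \<in> \<U>" "\<eta> \<in> U" using assms(3) by blast
  from c[OF this(1)] obtain T a g K where "boundary_chart \<Omega> U T a g K" by blast
  then interpret boundary_chart \<Omega> U T a g K .
  show ?thesis using outer_normal_chart[OF U(2) assms(3)] norm_chart_normal by simp
qed

lemma C2_domain_continuous_outer_normal:
  assumes "C2_domain \<Omega>" and "closed \<Omega>"
  shows "continuous_on (frontier \<Omega>) (outer_normal \<Omega>)"
proof (rule C2_domain_charts[OF assms])
  fix \<U> assume cover: "frontier \<Omega> \<subseteq> \<Union>\<U>" and c: "\<And>U. U \<in> \<U> \<Longrightarrow> \<exists>T a g K. boundary_chart \<Omega> U T a g K"
  have "continuous (at \<eta> within frontier \<Omega>) (outer_normal \<Omega>)" if \<eta>: "\<eta> \<in> frontier \<Omega>" for \<eta>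
  proof -
    obtain U where U: "U \<in> \<U>" "\<eta> \<in> U" using cover \<eta> by blast
    from c[OF this(1)] obtain T a g K where "boundary_chart \<Omega> U T a g K" by blast
    then interpret boundary_chart \<Omega> U T a g K .
    have "continuous (at \<eta> within frontier \<Omega> \<inter> U) (outer_normal \<Omega>)"
      using continuous_on_outer_normal U \<eta> by (simp add: continuous_on_eq_continuous_within)
    moreover have "at \<eta> within frontier \<Omega> \<inter> U = at \<eta> within frontier \<Omega>"
      using open_U U(2) by (intro at_within_nhd[of _ U]) auto
    ultimately show ?thesis by simp
  qed
  then show ?thesis by (simp add: continuous_on_eq_continuous_within)
qed

text \<open>Near the frontier finitely many charts suffice, each with its own width
  \<open>\<epsilon> U\<close>. The points at least \<open>e\<close> away from the frontier, with
  \<open>e\<close> below all the widths, form the interior piece.\<close>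

lemma C2_domain_good_piece:
  assumes "C2_domain \<Omega>" and "closed \<Omega>" and \<mu>: "\<mu> > 0"
  shows "good_piece \<Omega> \<mu> \<Omega>"
proof (rule C2_domain_charts[OF assms(1,2)])
  fix \<delta> :: real and \<U>
  assume \<delta>: "\<delta> > 0" and fin: "finite \<U>"
    and near: "\<And>x. x \<in> \<Omega> \<Longrightarrow> infdist x (frontier \<Omega>) < \<delta> \<Longrightarrow> \<exists>U\<in>\<U>. ball x \<delta> \<subseteq> U"
    and charts: "\<And>U. U \<in> \<U> \<Longrightarrow> \<exists>T a g K. boundary_chart \<Omega> U T a g K"
  have "bounded \<Omega>" using assms(1) by (simp add: C2_domain_def)
  then obtain \<Phi> where \<Phi>: "\<Phi> \<ge> 1" "\<And>n x. n \<ge> 1 \<Longrightarrow> x \<in> \<Omega> \<Longrightarrow> phi \<Omega> n x \<le> \<Phi>"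
    using phi_bounded[of \<Omega>] by metis
  note normal = C2_domain_norm_outer_normal[OF assms(1,2)]
  let ?A = "\<lambda>U \<epsilon>. {x \<in> \<Omega>. ball x \<delta> \<subseteq> U \<and> infdist x (frontier \<Omega>) \<le> \<epsilon>}"
  have "\<forall>U\<in>\<U>. \<exists>\<epsilon>>0. good_piece \<Omega> \<mu> (?A U \<epsilon>)"
  proof
    fix U assume "U \<in> \<U>"
    then obtain T a g K where "boundary_chart \<Omega> U T a g K" using charts by blast
    then interpret boundary_chart \<Omega> U T a g K .
    show "\<exists>\<epsilon>>0. good_piece \<Omega> \<mu> (?A U \<epsilon>)" by (rule near_good_piece[OF \<delta> \<mu> \<Phi> normal])
  qed
  from bchoice[OF this] obtain \<epsilon> where "\<forall>U\<in>\<U>. \<epsilon> U > 0 \<and> good_piece \<Omega> \<mu> (?A U (\<epsilon> U))" ..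
  note \<epsilon> = conjunct1[OF bspec[OF this]] conjunct2[OF bspec[OF this]]
  \<comment> \<open>Inserting \<open>\<delta>\<close> keeps the minimum defined for an empty cover
    and guarantees that points closer than \<open>e\<close> to the frontier lie in a chart.\<close>
  define e where "e = Min (insert \<delta> (\<epsilon> ` \<U>))"
  have e: "e > 0" "e \<le> \<delta>" "\<And>U. U \<in> \<U> \<Longrightarrow> e \<le> \<epsilon> U" unfolding e_def using fin \<epsilon>(1) \<delta> by (simp_all add: Min_gr_iff)
  have "good_piece \<Omega> \<mu> ((\<Union>U\<in>\<U>. ?A U (\<epsilon> U)) \<union> {x \<in> \<Omega>. e \<le> infdist x (frontier \<Omega>)})"
    by (intro good_piece_Un good_piece_UN fin \<epsilon>(2) interior_good_piece[OF assms(2) e(1) \<Phi> normal])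
  moreover have "\<Omega> \<subseteq> (\<Union>U\<in>\<U>. ?A U (\<epsilon> U)) \<union> {x \<in> \<Omega>. e \<le> infdist x (frontier \<Omega>)}"
  proof
    fix x assume x: "x \<in> \<Omega>"
    show "x \<in> (\<Union>U\<in>\<U>. ?A U (\<epsilon> U)) \<union> {x \<in> \<Omega>. e \<le> infdist x (frontier \<Omega>)}"
    proof (cases "e \<le> infdist x (frontier \<Omega>)")
      case False
      then have "infdist x (frontier \<Omega>) < \<delta>" using e(2) by linarith
      from near[OF x this] obtain U where U: "U \<in> \<U>" "ball x \<delta> \<subseteq> U" by blast
      moreover have "infdist x (frontier \<Omega>) \<le> \<epsilon> U" using False e(3)[OF U(1)] by simp
      ultimately show ?thesis using x by blast
    qed (use x in simp)
  qed
  ultimately show ?thesis by (rule good_piece_mono)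
qed

section \<open>Measurability of the maximal derivative\<close>

text \<open>The direction is treated as a second block \<open>q\<close> of variables, from which
  \<open>\<kappa>\<close> selects the components. The derivative is then polynomial in point and
  direction together, which yields joint continuity.\<close>

lemma cpoly_cderiv_joint:
  fixes H :: "(('i + 'j) \<Rightarrow> complex) \<Rightarrow> complex" and \<kappa> :: "'i \<Rightarrow> 'j"
  assumes "cpoly n H"
  shows "\<exists>m H'. cpoly m H' \<and> (\<forall>\<zeta> q. cderiv (\<lambda>i. q (\<kappa> i)) (\<lambda>\<zeta>. H (case_sum \<zeta> q)) \<zeta> = H' (case_sum \<zeta> q))"
proof -
  have sub: "cpoly m (\<lambda>\<zeta>. H (case_sum \<zeta> q))" if "cpoly m H" for m and H :: "(('i + 'j) \<Rightarrow> complex) \<Rightarrow> complex" and q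
  proof -
    have "cpoly 1 (\<lambda>\<zeta>. case_sum \<zeta> q i)" for i :: "'i + 'j"
      by (cases i) (auto intro: cpoly.const cpoly.var)
    from cpoly_compose[OF that this] show ?thesis by simp
  qed
  show ?thesis using assms
  proof (induction rule: cpoly.induct)
    case (const n a)
    show ?case by (rule exI[of _ 0], rule exI[of _ "\<lambda>_. 0"]) (simp add: cderiv_simps cpoly.const)
  next
    case (var n i)
    show ?case
    proof (cases i)
      case (Inl k)
      then show ?thesis
        by (intro exI[of _ 1] exI[of _ "\<lambda>\<zeta>. \<zeta> (Inr (\<kappa> k))"]) (simp add: cderiv_simps cpoly.var)
    next
      case (Inr k)
      then show ?thesis
        by (intro exI[of _ 0] exI[of _ "\<lambda>_. 0"]) (simp add: cderiv_simps cpoly.const)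
    qed
  next
    case (add n F G)
    then obtain m F' m' G' where "cpoly m F'" "cpoly m' G'"
      "\<And>\<zeta> q. cderiv (\<lambda>i. q (\<kappa> i)) (\<lambda>\<zeta>. F (case_sum \<zeta> q)) \<zeta> = F' (case_sum \<zeta> q)"
      "\<And>\<zeta> q. cderiv (\<lambda>i. q (\<kappa> i)) (\<lambda>\<zeta>. G (case_sum \<zeta> q)) \<zeta> = G' (case_sum \<zeta> q)" by blast
    then show ?case
      by (intro exI[of _ "max m m'"] exI[of _ "\<lambda>\<zeta>. F' \<zeta> + G' \<zeta>"])
         (auto simp: cderiv_simps(3)[OF sub[OF add.hyps(1)] sub[OF add.hyps(2)]] intro!: cpoly.add intro: cpoly_mono)
  next
    case (mult m F n G k)
    then obtain m1 F' m2 G' where FG: "cpoly m1 F'" "cpoly m2 G'"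
      "\<And>\<zeta> q. cderiv (\<lambda>i. q (\<kappa> i)) (\<lambda>\<zeta>. F (case_sum \<zeta> q)) \<zeta> = F' (case_sum \<zeta> q)"
      "\<And>\<zeta> q. cderiv (\<lambda>i. q (\<kappa> i)) (\<lambda>\<zeta>. G (case_sum \<zeta> q)) \<zeta> = G' (case_sum \<zeta> q)" by blast
    have "cpoly (m + n + m1 + m2) (\<lambda>\<zeta>. F \<zeta> * G' \<zeta> + F' \<zeta> * G \<zeta>)"
      by (rule cpoly.add; rule cpoly.mult[OF mult.hyps(1) FG(2)] cpoly.mult[OF FG(1) mult.hyps(2)]) auto
    then show ?case using FG(3,4)
      by (intro exI[of _ "m + n + m1 + m2"] exI[of _ "\<lambda>\<zeta>. F \<zeta> * G' \<zeta> + F' \<zeta> * G \<zeta>"])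
         (simp add: cderiv_simps(4)[OF sub[OF mult.hyps(1)] sub[OF mult.hyps(2)]])
  qed
qed

lemma cpoly_cderiv_funpow_joint:
  fixes H :: "(('i + 'j) \<Rightarrow> complex) \<Rightarrow> complex" and \<kappa> :: "'i \<Rightarrow> 'j"
  assumes "cpoly n H"
  shows "\<exists>m H'. cpoly m H' \<and> (\<forall>\<zeta> q. (cderiv (\<lambda>i. q (\<kappa> i)) ^^ k) (\<lambda>\<zeta>. H (case_sum \<zeta> q)) \<zeta> = H' (case_sum \<zeta> q))"
proof (induction k)
  case 0
  then show ?case using assms by (intro exI[of _ n] exI[of _ H]) simp
next
  case (Suc k)
  then obtain m H' where H': "cpoly m H'"
    "\<And>q. (cderiv (\<lambda>i. q (\<kappa> i)) ^^ k) (\<lambda>\<zeta>. H (case_sum \<zeta> q)) = (\<lambda>\<zeta>. H' (case_sum \<zeta> q))" by blast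
  from cpoly_cderiv_joint[OF H'(1), of \<kappa>] show ?case by (simp add: H'(2))
qed

lemma continuous_on_dir_deriv:
  fixes f :: "'a::euclidean_space \<Rightarrow> real"
  assumes F: "cpoly n F" and f: "complexifies F f"
  shows "continuous_on A (\<lambda>(x, \<tau>, \<nu>). (dir_deriv \<tau> ^^ r) ((dir_deriv \<nu> ^^ k) f) x)"
proof -
  have "cpoly n (\<lambda>\<psi>. F (\<lambda>i. \<psi> (Inl i :: 'a + ('a + 'a))))"
    using cpoly_compose[OF F cpoly.var[of 1]] by simp
  \<comment> \<open>Both directions share one block of extra variables: \<open>Inr\<close> holds the
    normal, differentiated first, and \<open>Inl\<close> the tangent.\<close>
  from cpoly_cderiv_funpow_joint[where \<kappa> = Inr and k = k, OF this] obtain m1 H1 where H1: "cpoly m1 H1"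
    "\<And>q \<zeta>. (cderiv (\<lambda>i. q (Inr i)) ^^ k) F \<zeta> = H1 (case_sum \<zeta> (q :: 'a + 'a \<Rightarrow> complex))" by auto
  have H1': "(cderiv (\<lambda>i. q (Inr i)) ^^ k) F = (\<lambda>\<zeta>. H1 (case_sum \<zeta> (q :: 'a + 'a \<Rightarrow> complex)))" for q
    using H1(2) by (rule ext)
  from cpoly_cderiv_funpow_joint[where \<kappa> = Inl and k = r, OF H1(1)] obtain m2 H2 where H2: "cpoly m2 H2"
    "\<And>q \<zeta>. (cderiv (\<lambda>i. q (Inl i)) ^^ r) (\<lambda>\<zeta>. H1 (case_sum \<zeta> q)) \<zeta> = H2 (case_sum \<zeta> (q :: 'a + 'a \<Rightarrow> complex))" by auto
  have eq: "(dir_deriv \<tau> ^^ r) ((dir_deriv \<nu> ^^ k) f) x =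
      Re (H2 (\<lambda>i. case_sum (ccoords x) (case_sum (ccoords \<tau>) (ccoords \<nu>)) i))" for x \<tau> \<nu>
  proof -
    have "complexifies ((cderiv (ccoords \<tau>) ^^ r) ((cderiv (ccoords \<nu>) ^^ k) F)) ((dir_deriv \<tau> ^^ r) ((dir_deriv \<nu> ^^ k) f))"
      by (intro complexifies_dir_deriv_funpow[OF cpoly_cderiv_funpow[OF F]] complexifies_dir_deriv_funpow[OF F f])
    then have "of_real ((dir_deriv \<tau> ^^ r) ((dir_deriv \<nu> ^^ k) f) x) = (cderiv (ccoords \<tau>) ^^ r) ((cderiv (ccoords \<nu>) ^^ k) F) (ccoords x)"
      by (simp add: complexifies_def)
    also have "\<dots> = H2 (case_sum (ccoords x) (case_sum (ccoords \<tau>) (ccoords \<nu>)))"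
      using H1'[of "case_sum (ccoords \<tau>) (ccoords \<nu>)"] H2(2)[of "case_sum (ccoords \<tau>) (ccoords \<nu>)" "ccoords x"] by simp
    finally show ?thesis by (metis Re_complex_of_real)
  qed
  have "continuous_on A (\<lambda>y. H2 (\<lambda>i. case_sum (ccoords (fst y)) (case_sum (ccoords (fst (snd y))) (ccoords (snd (snd y)))) i))"
  proof (rule cpoly_continuous[OF H2(1)])
    fix i :: "'a + ('a + 'a)"
    show "continuous_on A (\<lambda>y. case_sum (ccoords (fst y)) (case_sum (ccoords (fst (snd y))) (ccoords (snd (snd y)))) i)"
    proof (cases i)
      case (Inr j)
      then show ?thesis by (cases j) (auto simp: ccoords_def intro!: continuous_intros)
    qed (auto simp: ccoords_def intro!: continuous_intros)
  qed
  then show ?thesis unfolding split_def eq by (intro continuous_intros)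
qed

lemma continuous_on_max_deriv_integrand:
  fixes f :: "'a::euclidean_space \<Rightarrow> real"
  assumes F: "cpoly N F" and f: "complexifies F f" and normal: "continuous_on (frontier \<Omega>) (outer_normal \<Omega>)"
    and "continuous_on A x" "continuous_on A \<eta>" "continuous_on A \<tau>" "\<eta> ` A \<subseteq> frontier \<Omega>"
  shows "continuous_on A (\<lambda>y. \<bar>(dir_deriv (\<tau> y) ^^ r) ((dir_deriv (outer_normal \<Omega> (\<eta> y)) ^^ k) f) (x y)\<bar>)"
proof -
  have "continuous_on A (\<lambda>y. (x y, \<tau> y, outer_normal \<Omega> (\<eta> y)))"
    by (intro continuous_intros assms continuous_on_compose2[OF normal])
  from continuous_on_compose2[OF continuous_on_dir_deriv[OF F f, of UNIV r k] this]
  have "continuous_on A (\<lambda>y. (dir_deriv (\<tau> y) ^^ r) ((dir_deriv (outer_normal \<Omega> (\<eta> y)) ^^ k) f) (x y))" by simp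
  then show ?thesis by (intro continuous_intros)
qed

text \<open>The suprema in \<open>max_deriv\<close> are real, so their terms have to be bounded
  before they are dominated; this follows from joint continuity on the compact set of frontier
  points and unit vectors.\<close>

lemma abs_dir_deriv_le_max_deriv:
  fixes \<Omega> :: "'a::euclidean_space set"
  assumes dim: "DIM('a) \<ge> 2" and F: "cpoly N F" and f: "complexifies F f" and \<Omega>: "compact \<Omega>"
    and normal: "continuous_on (frontier \<Omega>) (outer_normal \<Omega>)"
    and \<eta>: "\<eta> \<in> near_boundary \<Omega> n \<mu> x" and \<tau>: "\<tau> \<in> unit_tangents \<Omega> \<eta>"
  shows "\<bar>(dir_deriv \<tau> ^^ r) ((dir_deriv (outer_normal \<Omega> \<eta>) ^^ k) f) x\<bar> \<le> max_deriv \<Omega> n \<mu> r k f x"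
proof -
  let ?\<Gamma> = "frontier \<Omega>"
  let ?S = "sphere (0::'a) 1"
  let ?d = "\<lambda>\<eta> \<tau>. \<bar>(dir_deriv \<tau> ^^ r) ((dir_deriv (outer_normal \<Omega> \<eta>) ^^ k) f) x\<bar>"
  have "bounded ((\<lambda>y. ?d (fst y) (snd y)) ` (?\<Gamma> \<times> ?S))"
    using compact_frontier[OF \<Omega>]
    by (intro compact_imp_bounded compact_continuous_image compact_Times compact_sphere
        continuous_on_max_deriv_integrand[OF F f normal] continuous_intros) auto
  then obtain B where B: "\<And>\<eta> \<tau>. \<eta> \<in> ?\<Gamma> \<Longrightarrow> norm \<tau> = 1 \<Longrightarrow> ?d \<eta> \<tau> \<le> B"
    unfolding bounded_iff by force
  have B': "?d \<eta> \<tau> \<le> B" if "\<eta> \<in> near_boundary \<Omega> n \<mu> x" "\<tau> \<in> unit_tangents \<Omega> \<eta>" for \<eta> \<tau>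
    using that by (intro B) (auto simp: near_boundary_def unit_tangents_def)
  have S: "(SUP \<tau>\<in>unit_tangents \<Omega> \<eta>. ?d \<eta> \<tau>) \<le> B" if "\<eta> \<in> near_boundary \<Omega> n \<mu> x" for \<eta>
    using unit_tangents_nonempty[OF dim] B'[OF that] by (intro cSUP_least) auto
  have "?d \<eta> \<tau> \<le> (SUP \<tau>\<in>unit_tangents \<Omega> \<eta>. ?d \<eta> \<tau>)"
    using B'[OF \<eta>] \<tau> by (intro cSUP_upper) (auto intro!: bdd_aboveI)
  also have "\<dots> \<le> (SUP \<eta>\<in>near_boundary \<Omega> n \<mu> x. SUP \<tau>\<in>unit_tangents \<Omega> \<eta>. ?d \<eta> \<tau>)"
    using S \<eta> by (rule_tac cSUP_upper) (auto intro!: bdd_aboveI)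
  finally show ?thesis using \<eta> by (auto simp: max_deriv_def)
qed

lemma max_deriv_nonneg:
  fixes \<Omega> :: "'a::euclidean_space set"
  assumes "DIM('a) \<ge> 2" and "cpoly N F" and "complexifies F f" and "compact \<Omega>"
    and "continuous_on (frontier \<Omega>) (outer_normal \<Omega>)"
  shows "0 \<le> max_deriv \<Omega> n \<mu> r k f x"
proof (cases "near_boundary \<Omega> n \<mu> x = {}")
  case False
  then obtain \<eta> where \<eta>: "\<eta> \<in> near_boundary \<Omega> n \<mu> x" by blast
  obtain \<tau> where "\<tau> \<in> unit_tangents \<Omega> \<eta>" using unit_tangents_nonempty[OF assms(1)] by blast
  from abs_dir_deriv_le_max_deriv[OF assms \<eta> this] show ?thesis using abs_ge_zero order_trans by blast
qed (simp add: max_deriv_def)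

text \<open>Measurability matters for \<open>p = \<infinity>\<close> only, where the \<open>esssup\<close> of a non-measurable function would be \<open>\<infinity>\<close>.
  The superlevel set is the projection of a compact set of triples \<open>(\<xi>, \<eta>, \<tau>)\<close>.\<close>

lemma compact_max_deriv_superlevel:
  fixes \<Omega> :: "'a::euclidean_space set"
  assumes dim: "DIM('a) \<ge> 2" and F: "cpoly N F" and f: "complexifies F f" and \<Omega>: "compact \<Omega>"
    and normal: "continuous_on (frontier \<Omega>) (outer_normal \<Omega>)" and c: "c > 0"
  shows "compact {x \<in> \<Omega>. c \<le> max_deriv \<Omega> n \<mu> r k f x}"
proof -
  let ?\<Gamma> = "frontier \<Omega>"
  let ?S = "sphere (0::'a) 1"
  let ?d = "\<lambda>x \<eta> \<tau>. \<bar>(dir_deriv \<tau> ^^ r) ((dir_deriv (outer_normal \<Omega> \<eta>) ^^ k) f) x\<bar>"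
  let ?K = "\<Omega> \<times> ?\<Gamma> \<times> ?S"
  have comp\<Gamma>: "compact ?\<Gamma>" using \<Omega> by (rule compact_frontier)
  have compK: "compact ?K" using \<Omega> comp\<Gamma> by (intro compact_Times compact_sphere)
  note cn = continuous_on_compose2[OF normal]
  note cd = continuous_on_max_deriv_integrand[OF F f normal]
  have cphi: "continuous_on A (\<lambda>y. phi \<Omega> n (h y))" if "continuous_on A h" for A :: "'c::topological_space set" and h
    unfolding phi_def by (intro continuous_intros that)
  define Z where "Z = {y \<in> ?K. norm (fst (snd y) - fst y) \<le> \<mu> * phi \<Omega> n (fst y)} \<inter>
    {y \<in> ?K. snd (snd y) \<bullet> outer_normal \<Omega> (fst (snd y)) = 0} \<inter>
    {y \<in> ?K. c \<le> ?d (fst y) (fst (snd y)) (snd (snd y))}"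
  have "closed Z" unfolding Z_def
  proof (intro closed_Int)
    show "closed {y \<in> ?K. norm (fst (snd y) - fst y) \<le> \<mu> * phi \<Omega> n (fst y)}"
      by (intro continuous_on_closed_Collect_le compact_imp_closed compK continuous_intros cphi)
    have "closed ({y \<in> ?K. snd (snd y) \<bullet> outer_normal \<Omega> (fst (snd y)) \<le> 0} \<inter> {y \<in> ?K. 0 \<le> snd (snd y) \<bullet> outer_normal \<Omega> (fst (snd y))})"
      by (intro closed_Int continuous_on_closed_Collect_le compact_imp_closed compK continuous_intros cn) auto
    then show "closed {y \<in> ?K. snd (snd y) \<bullet> outer_normal \<Omega> (fst (snd y)) = 0}"
      by (rule back_subst[of closed]) auto
    show "closed {y \<in> ?K. c \<le> ?d (fst y) (fst (snd y)) (snd (snd y))}"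
      by (intro continuous_on_closed_Collect_le compact_imp_closed compK cd continuous_intros) auto
  qed
  moreover have "Z \<subseteq> ?K" by (auto simp: Z_def)
  ultimately have "compact Z" using compact_Int_closed[OF compK] by (metis inf.absorb2)
  moreover have "{x \<in> \<Omega>. c \<le> max_deriv \<Omega> n \<mu> r k f x} = fst ` Z"
  proof (intro equalityI subsetI)
    fix x assume x: "x \<in> {x \<in> \<Omega>. c \<le> max_deriv \<Omega> n \<mu> r k f x}"
    let ?B = "near_boundary \<Omega> n \<mu> x"
    \<comment> \<open>\<open>Y\<close> is the compact set of admissible pairs for fixed
      \<open>x\<close>. The maximum is attained on it, which turns \<open>c \<le> max_deriv\<close>
      into the existence of one pair with value at least \<open>c\<close>.\<close>
    define Y where "Y = {y \<in> ?\<Gamma> \<times> ?S. norm (fst y - x) \<le> \<mu> * phi \<Omega> n x} \<inter> {y \<in> ?\<Gamma> \<times> ?S. snd y \<bullet> outer_normal \<Omega> (fst y) = 0}"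
    have Y: "y \<in> Y \<longleftrightarrow> fst y \<in> ?B \<and> snd y \<in> unit_tangents \<Omega> (fst y)" for y
      by (cases y) (auto simp: Y_def near_boundary_def unit_tangents_def)
    have compY: "compact (?\<Gamma> \<times> ?S)" using comp\<Gamma> by (intro compact_Times compact_sphere)
    have "closed Y" unfolding Y_def
    proof (intro closed_Int)
      show "closed {y \<in> ?\<Gamma> \<times> ?S. norm (fst y - x) \<le> \<mu> * phi \<Omega> n x}"
        by (intro continuous_on_closed_Collect_le compact_imp_closed compY continuous_intros)
      have "closed ({y \<in> ?\<Gamma> \<times> ?S. snd y \<bullet> outer_normal \<Omega> (fst y) \<le> 0} \<inter> {y \<in> ?\<Gamma> \<times> ?S. 0 \<le> snd y \<bullet> outer_normal \<Omega> (fst y)})"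
        by (intro closed_Int continuous_on_closed_Collect_le compact_imp_closed compY continuous_intros cn) auto
      then show "closed {y \<in> ?\<Gamma> \<times> ?S. snd y \<bullet> outer_normal \<Omega> (fst y) = 0}"
        by (rule back_subst[of closed]) auto
    qed
    moreover have "Y \<subseteq> ?\<Gamma> \<times> ?S" by (auto simp: Y_def)
    ultimately have "compact Y" using compact_Int_closed[OF compY] by (metis inf.absorb2)
    \<comment> \<open>An empty \<open>near_boundary\<close> would give the default value 0, which
      \<open>c > 0\<close> excludes.\<close>
    have ne: "?B \<noteq> {}" using x c by (auto simp: max_deriv_def)
    then obtain \<eta>0 where "\<eta>0 \<in> ?B" by blast
    then have "Y \<noteq> {}" using unit_tangents_nonempty[OF dim] Y by (metis all_not_in_conv fst_conv snd_conv)
    moreover have "continuous_on Y (\<lambda>y. ?d x (fst y) (snd y))"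
      by (intro cd continuous_intros) (auto simp: Y_def)
    ultimately obtain y where y: "y \<in> Y" "\<And>y'. y' \<in> Y \<Longrightarrow> ?d x (fst y') (snd y') \<le> ?d x (fst y) (snd y)"
      using continuous_attains_sup[OF \<open>compact Y\<close>] by blast
    have "(SUP \<tau>\<in>unit_tangents \<Omega> \<eta>. ?d x \<eta> \<tau>) \<le> ?d x (fst y) (snd y)" if "\<eta> \<in> ?B" for \<eta>
      using unit_tangents_nonempty[OF dim] y(2)[of "(\<eta>, _)"] that Y by (intro cSUP_least) auto
    then have "max_deriv \<Omega> n \<mu> r k f x \<le> ?d x (fst y) (snd y)"
      unfolding max_deriv_def if_not_P[OF ne] by (rule cSUP_least[OF ne])
    then have "(x, y) \<in> Z" using x y(1) by (auto simp: Z_def Y_def)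
    then show "x \<in> fst ` Z" by force
  next
    fix x assume "x \<in> fst ` Z"
    then obtain \<eta> \<tau> where x: "x \<in> \<Omega>" and \<eta>: "\<eta> \<in> near_boundary \<Omega> n \<mu> x" and \<tau>: "\<tau> \<in> unit_tangents \<Omega> \<eta>" and d: "c \<le> ?d x \<eta> \<tau>"
      by (auto simp: Z_def near_boundary_def unit_tangents_def)
    have "c \<le> max_deriv \<Omega> n \<mu> r k f x"
      using d abs_dir_deriv_le_max_deriv[OF dim F f \<Omega> normal \<eta> \<tau>] by (rule order_trans)
    then show "x \<in> {x \<in> \<Omega>. c \<le> max_deriv \<Omega> n \<mu> r k f x}" using x by simp
  qed
  ultimately show ?thesis by (simp add: compact_continuous_image continuous_on_fst)
qed


lemma max_deriv_measurable:
  fixes \<Omega> :: "'a::euclidean_space set"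
  assumes dim: "DIM('a) \<ge> 2" and F: "cpoly N F" and f: "complexifies F f" and \<Omega>: "compact \<Omega>"
    and normal: "continuous_on (frontier \<Omega>) (outer_normal \<Omega>)"
  shows "max_deriv \<Omega> n \<mu> r k f \<in> borel_measurable (lebesgue_on \<Omega>)"
  unfolding borel_measurable_iff_ge
proof
  fix c :: real
  have s: "\<Omega> \<in> sets lebesgue" using \<Omega> by (simp add: borel_compact)
  show "{x \<in> space (lebesgue_on \<Omega>). c \<le> max_deriv \<Omega> n \<mu> r k f x} \<in> sets (lebesgue_on \<Omega>)"
  proof (cases "c > 0")
    case True
    have "compact {x \<in> \<Omega>. c \<le> max_deriv \<Omega> n \<mu> r k f x}"
      by (rule compact_max_deriv_superlevel[OF dim F f \<Omega> normal True])
    then have "{x \<in> \<Omega>. c \<le> max_deriv \<Omega> n \<mu> r k f x} \<in> sets lebesgue" by (simp add: borel_compact)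
    then show ?thesis using s by (simp add: sets_restrict_space_iff space_restrict_space)
  next
    case False
    \<comment> \<open>For \<open>c \<le> 0\<close> nonnegativity makes the superlevel set all of
      \<open>\<Omega>\<close>; this also covers the points with default value 0.\<close>
    then have "{x \<in> \<Omega>. c \<le> max_deriv \<Omega> n \<mu> r k f x} = \<Omega>"
      using max_deriv_nonneg[OF dim F f \<Omega> normal] by (auto intro: order_trans[of c 0])
    then show ?thesis using s by (simp add: sets_restrict_space_iff space_restrict_space)
  qed
qed

section \<open>Passage to the \<open>Lp_norm\<close>\<close>

lemma ennreal_powr_mono: "x \<le> y \<Longrightarrow> a \<ge> 0 \<Longrightarrow> ennreal_powr x a \<le> ennreal_powr y a"
  by (auto simp: ennreal_powr_def top_unique less_top intro!: ennreal_leI powr_mono2 enn2real_mono)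

lemma ennreal_powr_mult:
  assumes "c > 0"
  shows "ennreal_powr (ennreal c * x) a = ennreal (c powr a) * ennreal_powr x a"
proof (cases "x = \<infinity>")
  case True
  then show ?thesis using assms by (simp add: ennreal_powr_def ennreal_mult_top ennreal_mult_eq_top_iff)
next
  case False
  then have "ennreal c * x \<noteq> \<infinity>" by (simp add: ennreal_mult_eq_top_iff)
  with False show ?thesis using assms
    by (simp add: ennreal_powr_def enn2real_mult powr_mult ennreal_mult')
qed

lemma nn_integral_lebesgue_on_borel:
  assumes [measurable]: "\<Omega> \<in> sets borel" "h \<in> borel_measurable borel"
  shows "(\<integral>\<^sup>+x. h x \<partial>lebesgue_on \<Omega>) = (\<integral>\<^sup>+x. h x * indicator \<Omega> x \<partial>lborel)"
proof -
  have "\<Omega> \<in> sets lebesgue" using assms(1) by simp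
  then have "(\<integral>\<^sup>+x. h x \<partial>lebesgue_on \<Omega>) = (\<integral>\<^sup>+x. h x * indicator \<Omega> x \<partial>lebesgue)"
    by (subst nn_integral_restrict_space) auto
  also have "\<dots> = (\<integral>\<^sup>+x. h x * indicator \<Omega> x \<partial>lborel)"
    by (rule nn_integral_completion) measurable
  finally show ?thesis .
qed

text \<open>If \<open>\<bar>f y\<bar>\<close> exceeded the essential supremum, so would the values
  on an open set around \<open>y\<close>. It meets \<open>D\<close> because \<open>y\<close> lies in
  the closure, and a nonempty open set is not negligible.\<close>

lemma abs_le_esssup:
  fixes f :: "'a::euclidean_space \<Rightarrow> real"
  assumes D: "open D" "\<Omega> = closure D" and f: "continuous_on UNIV f" and y: "y \<in> \<Omega>"
  shows "ennreal \<bar>f y\<bar> \<le> esssup (lebesgue_on \<Omega>) (\<lambda>x. ennreal \<bar>f x\<bar>)"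
proof (rule ccontr)
  let ?E = "esssup (lebesgue_on \<Omega>) (\<lambda>x. ennreal \<bar>f x\<bar>)"
  assume "\<not> ennreal \<bar>f y\<bar> \<le> ?E"
  then have E: "?E < ennreal \<bar>f y\<bar>" by simp
  then have fin: "?E < \<infinity>" by (metis ennreal_less_top less_trans infinity_ennreal_def)
  define e where "e = enn2real ?E"
  have Ee: "?E = ennreal e" using fin by (simp add: e_def)
  have e0: "e \<ge> 0" by (simp add: e_def)
  have ey: "e < \<bar>f y\<bar>" using E e0 unfolding Ee by (simp add: ennreal_less_iff)
  let ?V = "{x. e < \<bar>f x\<bar>}"
  have V: "open ?V" by (intro open_Collect_less continuous_intros f)
  have "y \<in> closure D" using y D(2) by simp
  then have "?V \<inter> D \<noteq> {}" using V ey open_Int_closure_eq_empty[of ?V D] by blast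
  then have "\<not> negligible (?V \<inter> D)" using open_not_negligible[of "?V \<inter> D"] V D(1) by auto
  moreover have "?V \<inter> D \<subseteq> {x \<in> \<Omega>. ennreal \<bar>f x\<bar> > ?E}"
    unfolding Ee using D(2) closure_subset[of D] e0 by (auto simp: ennreal_less_iff)
  moreover have "negligible {x \<in> \<Omega>. ennreal \<bar>f x\<bar> > ?E}"
  proof -
    have s: "\<Omega> \<in> sets lebesgue" using D(2) by simp
    have "open {x. ?E < ennreal \<bar>f x\<bar>}"
      unfolding Ee using V e0 by (simp add: ennreal_less_iff)
    then have m: "{x \<in> \<Omega>. ?E < ennreal \<bar>f x\<bar>} \<in> sets lebesgue"
      using s by (simp add: Collect_conj_eq sets.Int)
    have "emeasure (lebesgue_on \<Omega>) {x \<in> space (lebesgue_on \<Omega>). ?E < ennreal \<bar>f x\<bar>} = 0"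
      by (rule esssup_zero_measure)
    then have "emeasure lebesgue {x \<in> \<Omega>. ?E < ennreal \<bar>f x\<bar>} = 0"
      using s by (simp add: space_restrict_space emeasure_restrict_space)
    then show ?thesis using m by (simp add: negligible_iff_null_sets null_sets_def)
  qed
  ultimately show False using negligible_subset by blast
qed

theorem theorem2p10:
  fixes D \<Omega> :: "((real ^ 'd) \<times> real) set"
    and \<mu> :: real and p :: ennreal and r j l :: nat
  assumes "open D" and "connected D" and "D \<noteq> {}" and "bounded D"
    and "\<Omega> = closure D" and "C2_domain \<Omega>"
    and "\<mu> > 1" and "0 < p"
  shows "\<exists>C::real. C > 0 \<and>
    (\<forall>n::nat. \<forall>f :: (real ^ 'd) \<times> real \<Rightarrow> real.
       n \<ge> 1 \<longrightarrow> poly_of_degree_at_most n f \<longrightarrow>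
       Lp_norm p \<Omega> (\<lambda>\<xi>. phi \<Omega> n \<xi> ^ j * max_deriv \<Omega> n \<mu> r (j + l) f \<xi>)
         \<le> ennreal (C * real n ^ (r + j + 2 * l)) * Lp_norm p \<Omega> f)"
proof -
  have closed: "closed \<Omega>" and compact: "compact \<Omega>" using assms(4,5) by (auto simp: compact_closure)
  have dim: "DIM((real ^ 'd) \<times> real) \<ge> 2" by (simp add: Suc_le_eq)
  have [measurable]: "\<Omega> \<in> sets borel" using closed by simp
  have "good_piece \<Omega> \<mu> \<Omega>" using C2_domain_good_piece[OF assms(6) closed] assms(7) by simp
  then obtain \<rho> where \<rho>: "\<rho> > 0" and Lp: "\<And>q. q > 0 \<Longrightarrow> \<exists>C\<ge>0. box_Lp_bound \<Omega> \<mu> \<rho> \<Omega> q C"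
    and sup: "\<exists>C\<ge>0. box_sup_bound \<Omega> \<mu> \<rho> \<Omega> C"
    unfolding good_piece_def by auto
  define K where "K = fact r * fact (j + l) / \<rho> ^ (r + (j + l))"
  have K: "K > 0" using \<rho> by (simp add: K_def)
  let ?m = "r + j + 2 * l"
  let ?M = "\<lambda>n f \<xi>. phi \<Omega> n \<xi> ^ j * max_deriv \<Omega> n \<mu> r (j + l) f \<xi>"
  have bound: "\<bar>?M n f \<xi>\<bar> \<le> K * real n ^ ?m * X"
    if "cpoly n F" "complexifies F f" "n \<ge> 1" "X \<ge> 0" "\<And>\<zeta>. \<zeta> \<in> deriv_box \<Omega> n \<mu> \<rho> \<xi> \<Longrightarrow> norm (F \<zeta>) \<le> X"
    for n F f \<xi> X
    unfolding K_def by (rule max_deriv_bound[OF dim that(1-3) \<rho> that(4,5)])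
  show ?thesis
  proof (cases "p = \<infinity>")
    case True
    obtain C where C: "C \<ge> 0" "box_sup_bound \<Omega> \<mu> \<rho> \<Omega> C" using sup by blast
    show ?thesis
    \<comment> \<open>\<open>C\<close> may be 0, while the constant of the theorem is positive;
      hence \<open>C + 1\<close>.\<close>
    proof (intro exI[of _ "K * (C + 1)"] conjI allI impI)
      show "K * (C + 1) > 0" using K C by simp
      fix n and f :: "(real ^ 'd) \<times> real \<Rightarrow> real"
      assume n: "n \<ge> 1" and "poly_of_degree_at_most n f"
      then obtain F where F: "cpoly n F" "complexifies F f" using poly_of_degree_at_most_complexifies by blast
      let ?E = "esssup (lebesgue_on \<Omega>) (\<lambda>x. ennreal \<bar>f x\<bar>)"
      have cont: "continuous_on UNIV f" by (rule complexifies_continuous[OF F])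
      have pos: "K * (C + 1) * real n ^ ?m > 0" using K C n by simp
      have fE: "ennreal \<bar>f y\<bar> \<le> ?E" if "y \<in> \<Omega>" for y
        by (rule abs_le_esssup[OF assms(1,5) cont that])
      have ptw: "\<bar>?M n f \<xi>\<bar> \<le> K * (C + 1) * real n ^ ?m * X"
        if \<xi>: "\<xi> \<in> \<Omega>" and X: "X \<ge> 0" "\<And>y. y \<in> \<Omega> \<Longrightarrow> \<bar>f y\<bar> \<le> X" for \<xi> X
      proof -
        have "\<bar>?M n f \<xi>\<bar> \<le> K * real n ^ ?m * (C * X)"
          using C(2) F n X \<xi> C(1) by (intro bound[OF F n]) (auto simp: box_sup_bound_def)
        also have "\<dots> \<le> K * real n ^ ?m * ((C + 1) * X)"
          using K X(1) by (intro mult_left_mono mult_right_mono) auto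
        finally show ?thesis by (simp add: mult_ac)
      qed
      show "Lp_norm p \<Omega> (?M n f) \<le> ennreal (K * (C + 1) * real n ^ ?m) * Lp_norm p \<Omega> f"
      proof (cases "?E = \<infinity>")
        \<comment> \<open>The factor in front has to be nonzero for the product with
          \<open>top\<close> to be \<open>top\<close>; a zero factor would give 0.\<close>
        case True
        moreover have "ennreal (K * (C + 1) * real n ^ ?m) \<noteq> 0" using pos by (simp only: ennreal_eq_0_iff not_le)
        then have "ennreal (K * (C + 1) * real n ^ ?m) * top = top" by (simp only: ennreal_mult_top if_False)
        ultimately show ?thesis using \<open>p = \<infinity>\<close> by (simp only: Lp_norm_def simp_thms if_True infinity_ennreal_def top_greatest)
      next
        case False
        define X where "X = enn2real ?E"
        have EX: "?E = ennreal X" using False by (simp add: X_def less_top)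
        have X0: "X \<ge> 0" by (simp add: X_def)
        have fX: "\<bar>f y\<bar> \<le> X" if "y \<in> \<Omega>" for y using fE[OF that] X0 unfolding EX by (simp add: ennreal_le_iff)
        have "(\<lambda>x. phi \<Omega> n x ^ j) \<in> borel_measurable borel"
          unfolding phi_def by (intro borel_measurable_continuous_onI continuous_intros)
        then have "(\<lambda>x. phi \<Omega> n x ^ j) \<in> borel_measurable (lebesgue_on \<Omega>)"
          by (intro measurable_restrict_space1 measurable_completion) simp
        moreover have "max_deriv \<Omega> n \<mu> r (j + l) f \<in> borel_measurable (lebesgue_on \<Omega>)"
          by (rule max_deriv_measurable[OF dim F compact C2_domain_continuous_outer_normal[OF assms(6) closed]])
        ultimately have meas: "(\<lambda>x. ennreal \<bar>?M n f x\<bar>) \<in> borel_measurable (lebesgue_on \<Omega>)"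
          by measurable
        have "esssup (lebesgue_on \<Omega>) (\<lambda>x. ennreal \<bar>?M n f x\<bar>) \<le> ennreal (K * (C + 1) * real n ^ ?m * X)"
          using ptw[OF _ X0 fX] by (intro esssup_I[OF meas] AE_I2 ennreal_leI) (simp add: space_restrict_space)
        also have "\<dots> = ennreal (K * (C + 1) * real n ^ ?m) * ?E"
          unfolding EX using pos by (subst ennreal_mult') auto
        finally show ?thesis using \<open>p = \<infinity>\<close> by (simp add: Lp_norm_def)
      qed
    qed
  next
    case False
    define q where "q = enn2real p"
    have q: "q > 0" using assms(8) False by (simp add: q_def enn2real_positive_iff less_top)
    obtain C where C: "C \<ge> 0" "box_Lp_bound \<Omega> \<mu> \<rho> \<Omega> q C" using Lp[OF q] by blast
    show ?thesis
    \<comment> \<open>\<open>C + 1\<close> is positive, as required both of the constant and of the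
      factor pulled out of \<open>ennreal_powr\<close>.\<close>
    proof (intro exI[of _ "K * (C + 1) powr (1 / q)"] conjI allI impI)
      show "K * (C + 1) powr (1 / q) > 0" using K C by simp
      fix n and f :: "(real ^ 'd) \<times> real \<Rightarrow> real"
      assume n: "n \<ge> 1" and "poly_of_degree_at_most n f"
      then obtain F where F: "cpoly n F" "complexifies F f" using poly_of_degree_at_most_complexifies by blast
      have [measurable]: "f \<in> borel_measurable borel"
        by (rule borel_measurable_continuous_onI[OF complexifies_continuous[OF F]])
      let ?I = "\<integral>\<^sup>+y. ennreal (\<bar>f y\<bar> powr q) * indicator \<Omega> y \<partial>lborel"
      obtain k where [measurable]: "k \<in> borel_measurable borel"
        and k1: "\<And>\<xi> \<zeta>. \<xi> \<in> \<Omega> \<Longrightarrow> \<zeta> \<in> deriv_box \<Omega> n \<mu> \<rho> \<xi> \<Longrightarrow> ennreal (norm (F \<zeta>) powr q) \<le> k \<xi>"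
        and k2: "(\<integral>\<^sup>+x. k x \<partial>lborel) \<le> ennreal C * ?I"
        using C(2)[unfolded box_Lp_bound_def, rule_format, OF n F] by blast
      define A where "A = K * real n ^ ?m"
      have A: "A > 0" using K n by (simp add: A_def)
      \<comment> \<open>The majorant bounds all values of \<open>F\<close> on the box by
        \<open>\<kappa> powr (1 / q)\<close>, hence the weighted maximal derivative by
        \<open>A\<close> times that. Only monotonicity of powers is used, so \<open>q < 1\<close> is
        covered as well.\<close>
      have ptw: "ennreal (\<bar>?M n f \<xi>\<bar> powr q) \<le> ennreal (A powr q) * k \<xi>" if \<xi>: "\<xi> \<in> \<Omega>" for \<xi>
      proof (cases "k \<xi> = \<infinity>")
        case True
        then show ?thesis using A by (simp add: ennreal_mult_eq_top_iff)
      next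
        case False
        define \<kappa> where "\<kappa> = enn2real (k \<xi>)"
        have k\<kappa>: "k \<xi> = ennreal \<kappa>" using False by (simp add: \<kappa>_def less_top)
        have \<kappa>0: "\<kappa> \<ge> 0" by (simp add: \<kappa>_def)
        have "norm (F \<zeta>) \<le> \<kappa> powr (1 / q)" if "\<zeta> \<in> deriv_box \<Omega> n \<mu> \<rho> \<xi>" for \<zeta>
        proof -
          have "norm (F \<zeta>) powr q \<le> \<kappa>" using k1[OF \<xi> that] \<kappa>0 unfolding k\<kappa> by (simp add: ennreal_le_iff)
          then have "(norm (F \<zeta>) powr q) powr (1 / q) \<le> \<kappa> powr (1 / q)" using q by (intro powr_mono2) auto
          then show ?thesis using q by (simp add: powr_powr)
        qed
        then have "\<bar>?M n f \<xi>\<bar> \<le> A * \<kappa> powr (1 / q)" unfolding A_def by (intro bound[OF F n]) auto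
        then have "\<bar>?M n f \<xi>\<bar> powr q \<le> (A * \<kappa> powr (1 / q)) powr q" using q by (intro powr_mono2) auto
        also have "\<dots> = A powr q * \<kappa>" using A q \<kappa>0 by (simp add: powr_mult powr_powr)
        finally show ?thesis unfolding k\<kappa> using \<kappa>0 by (simp add: ennreal_mult'[symmetric] ennreal_leI)
      qed
      have "(\<integral>\<^sup>+x. ennreal (\<bar>?M n f x\<bar> powr q) \<partial>lebesgue_on \<Omega>) \<le> (\<integral>\<^sup>+x. ennreal (A powr q) * k x \<partial>lebesgue_on \<Omega>)"
        by (intro nn_integral_mono ptw) (simp add: space_restrict_space)
      also have "\<dots> = (\<integral>\<^sup>+x. ennreal (A powr q) * k x * indicator \<Omega> x \<partial>lborel)"
        by (rule nn_integral_lebesgue_on_borel) measurable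
      also have "\<dots> \<le> (\<integral>\<^sup>+x. ennreal (A powr q) * k x \<partial>lborel)"
        by (intro nn_integral_mono) (auto simp: indicator_def)
      also have "\<dots> = ennreal (A powr q) * (\<integral>\<^sup>+x. k x \<partial>lborel)" by (rule nn_integral_cmult) measurable
      also have "\<dots> \<le> ennreal (A powr q) * (ennreal (C + 1) * ?I)"
        using C(1) by (intro mult_left_mono order_trans[OF k2] mult_right_mono ennreal_leI) auto
      also have "?I = (\<integral>\<^sup>+x. ennreal (\<bar>f x\<bar> powr q) \<partial>lebesgue_on \<Omega>)"
        by (rule nn_integral_lebesgue_on_borel[symmetric]) measurable
      finally have le: "(\<integral>\<^sup>+x. ennreal (\<bar>?M n f x\<bar> powr q) \<partial>lebesgue_on \<Omega>) \<le>
          ennreal (A powr q) * (ennreal (C + 1) * (\<integral>\<^sup>+x. ennreal (\<bar>f x\<bar> powr q) \<partial>lebesgue_on \<Omega>))" .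
      have "Lp_norm p \<Omega> (?M n f) \<le> ennreal_powr (ennreal (A powr q) * (ennreal (C + 1) *
          (\<integral>\<^sup>+x. ennreal (\<bar>f x\<bar> powr q) \<partial>lebesgue_on \<Omega>))) (1 / q)"
        using ennreal_powr_mono[OF le, of "1 / q"] False q by (simp add: Lp_norm_def q_def)
      also have "\<dots> = ennreal ((A powr q) powr (1 / q)) * (ennreal ((C + 1) powr (1 / q)) * Lp_norm p \<Omega> f)"
        using A C(1) False
        by (subst ennreal_powr_mult, simp, subst ennreal_powr_mult, simp, simp add: Lp_norm_def q_def)
      also have "(A powr q) powr (1 / q) = A" using A q by (simp add: powr_powr)
      also have "ennreal A * (ennreal ((C + 1) powr (1 / q)) * Lp_norm p \<Omega> f) =
          ennreal (A * (C + 1) powr (1 / q)) * Lp_norm p \<Omega> f"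
        using A by (simp only: mult.assoc[symmetric] ennreal_mult'[symmetric] less_imp_le)
      also have "A * (C + 1) powr (1 / q) = K * (C + 1) powr (1 / q) * real n ^ ?m" by (simp add: A_def)
      finally show "Lp_norm p \<Omega> (?M n f) \<le> ennreal (K * (C + 1) powr (1 / q) * real n ^ ?m) * Lp_norm p \<Omega> f" .
    qed
  qed
qed

end
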